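(* Let $p$ be a prime. Let $K$ be a finitely generated group, let $A$ and $B$ be isomorphic subgroups of $K$ with a fixed isomorphism $\varphi:A\to B$, and let $\Gamma=K*_A=\langle K,t\mid tAt^{-1}=B\rangle$ be the corresponding HNN extension. Suppose that $\Gamma$ is finitely generated and residually-$p$ and that $A$ is amenable. Let $\{H_n\}$ be a lattice of normal subgroups of $p$-power index in $\Gamma$ such that $\bigcap H_n=1$. Then $$RG_p(\Gamma,\{H_n\}) = RG_p(K,\{K\cap H_n\})+\frac{1}{|A|}.$$ In particular, $RG_p(\Gamma)\ge RG_p(K)+\frac{1}{|A|}$.
   Context: For a group $H$ and a prime $p$, $d_p(H)=d\left(H/[H,H]H^p\right)$, where $d$ denotes the minimal number of generators; equivalently $d_p(H)$ is the dimension of $H/[H,H]H^p$ over $\mathbb{F}_p$. A set of subgroups $\{H_n\}$ of a group is called a lattice if it is closed under finite intersections. The $p$-gradient of a finitely generated group $G$ relative to a lattice $\{H_n\}$ of normal subgroups of $p$-power index is $$RG_p(G,\{H_n\})=\inf_n\frac{d_p(H_n)-1}{[G:H_n]}.$$ The absolute $p$-gradient $RG_p(G)$ is the infimum of $\frac{d_p(H)-1}{[G:H]}$ over all normal subgroups $H$ of $p$-power index in $G$. A group is residually-$p$ if its normal subgroups of $p$-power index have trivial intersection. Convention: $\frac{1}{|A|}=0$ if $A$ is infinite. The notation $\langle K,t\mid tAt^{-1}=B\rangle$ means the HNN extension with relations $tat^{-1}=\varphi(a)$ for all $a\in A$. *)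

theory Defs
  imports Complex_Main "HOL-Computational_Algebra.Primes" "HOL-Algebra.Generated_Groups"
begin

definition finitely_generated :: "('a, 'b) monoid_scheme \<Rightarrow> bool" where
  "finitely_generated G \<longleftrightarrow>
     (\<exists>S. finite S \<and> S \<subseteq> carrier G \<and> generate G S = carrier G)"

(* Meaningful only for finitely generated G; the gradients below apply it only to
   quotients of finite-index subgroups of finitely generated groups. *)
definition min_generators :: "('a, 'b) monoid_scheme \<Rightarrow> nat" where
  "min_generators G =
     (LEAST n. \<exists>S. finite S \<and> card S = n \<and> S \<subseteq> carrier G \<and> generate G S = carrier G)"

(* The subgroup [G,G]G^p. *)
definition p_derived :: "nat \<Rightarrow> ('a, 'b) monoid_scheme \<Rightarrow> 'a set" where
  "p_derived p G =
     derived G (carrier G) <#>\<^bsub>G\<^esub> generate G {x [^]\<^bsub>G\<^esub> p | x. x \<in> carrier G}"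

definition d_p :: "nat \<Rightarrow> ('a, 'b) monoid_scheme \<Rightarrow> nat" where
  "d_p p G = min_generators (G Mod p_derived p G)"

definition group_index :: "('a, 'b) monoid_scheme \<Rightarrow> 'a set \<Rightarrow> nat" where
  "group_index G H = card (rcosets\<^bsub>G\<^esub> H)"

(* For a prime p the index equation also forces the index to be finite, since card is 0
   on infinite sets. *)
definition p_normal_subgroups :: "nat \<Rightarrow> ('a, 'b) monoid_scheme \<Rightarrow> 'a set set" where
  "p_normal_subgroups p G = {H. H \<lhd> G \<and> (\<exists>k. group_index G H = p ^ k)}"

definition residually_p :: "nat \<Rightarrow> ('a, 'b) monoid_scheme \<Rightarrow> bool" where
  "residually_p p G \<longleftrightarrow> \<Inter> (p_normal_subgroups p G) = {\<one>\<^bsub>G\<^esub>}"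

definition subgroup_lattice :: "('a, 'b) monoid_scheme \<Rightarrow> 'a set set \<Rightarrow> bool" where
  "subgroup_lattice G L \<longleftrightarrow>
     (\<forall>H\<in>L. subgroup H G) \<and> (\<forall>F. finite F \<and> F \<noteq> {} \<and> F \<subseteq> L \<longrightarrow> \<Inter> F \<in> L)"

(* The quotients are bounded below by -1, so for nonempty L the real-valued infimum is genuine. *)
definition p_gradient_rel :: "nat \<Rightarrow> ('a, 'b) monoid_scheme \<Rightarrow> 'a set set \<Rightarrow> real" where
  "p_gradient_rel p G L =
     (INF H\<in>L. (real (d_p p (G\<lparr>carrier := H\<rparr>)) - 1) / real (group_index G H))"

definition p_gradient :: "nat \<Rightarrow> ('a, 'b) monoid_scheme \<Rightarrow> real" where
  "p_gradient p G = p_gradient_rel p G (p_normal_subgroups p G)"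

definition bounded_fun_on :: "'a set \<Rightarrow> ('a \<Rightarrow> real) \<Rightarrow> bool" where
  "bounded_fun_on X f \<longleftrightarrow> (\<exists>C. \<forall>x\<in>X. \<bar>f x\<bar> \<le> C)"

(* Amenability of a discrete group: there is a left-invariant mean m on the bounded real
   functions on G.  Functions live on the whole ambient type, but additivity and positivity
   make m depend only on the restriction of its argument to the carrier. *)
definition amenable :: "('a, 'b) monoid_scheme \<Rightarrow> bool" where
  "amenable G \<longleftrightarrow> (\<exists>m :: ('a \<Rightarrow> real) \<Rightarrow> real.
     (\<forall>f g. bounded_fun_on (carrier G) f \<longrightarrow> bounded_fun_on (carrier G) g \<longrightarrow>
        m (\<lambda>x. f x + g x) = m f + m g) \<and>
     (\<forall>c f. bounded_fun_on (carrier G) f \<longrightarrow> m (\<lambda>x. c * f x) = c * m f) \<and>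
     (\<forall>f. bounded_fun_on (carrier G) f \<longrightarrow> (\<forall>x\<in>carrier G. 0 \<le> f x) \<longrightarrow> 0 \<le> m f) \<and>
     m (\<lambda>_. 1) = 1 \<and>
     (\<forall>f. \<forall>g\<in>carrier G. bounded_fun_on (carrier G) f \<longrightarrow>
        m (\<lambda>x. f (g \<otimes>\<^bsub>G\<^esub> x)) = m f))"

section \<open>HNN extensions\<close>

(* The HNN extension is the group presented by the elements of K and a stable letter t, subject
   to the multiplication table of K and to t a t^-1 = phi a for a in A.  It is built as the
   set of words in the letters x (x in K), t, t^-1 modulo the congruence generated by these
   relations and by t t^-1 = t^-1 t = 1.  The second associated subgroup is B = phi ` A. *)

datatype 'a hnn_letter = Elem 'a | Stable | Stable_inv

definition hnn_words :: "('a, 'b) monoid_scheme \<Rightarrow> 'a hnn_letter list set" where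
  "hnn_words K = lists (insert Stable (insert Stable_inv (Elem ` carrier K)))"

inductive hnn_cong ::
  "('a, 'b) monoid_scheme \<Rightarrow> 'a set \<Rightarrow> ('a \<Rightarrow> 'a) \<Rightarrow> 'a hnn_letter list \<Rightarrow> 'a hnn_letter list \<Rightarrow> bool"
  for K A \<phi> where
  refl: "w \<in> hnn_words K \<Longrightarrow> hnn_cong K A \<phi> w w"
| sym: "hnn_cong K A \<phi> u v \<Longrightarrow> hnn_cong K A \<phi> v u"
| trans: "hnn_cong K A \<phi> u v \<Longrightarrow> hnn_cong K A \<phi> v w \<Longrightarrow> hnn_cong K A \<phi> u w"
| append: "hnn_cong K A \<phi> u u' \<Longrightarrow> hnn_cong K A \<phi> v v' \<Longrightarrow> hnn_cong K A \<phi> (u @ v) (u' @ v')"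
| one: "hnn_cong K A \<phi> [Elem \<one>\<^bsub>K\<^esub>] []"
| mult: "x \<in> carrier K \<Longrightarrow> y \<in> carrier K \<Longrightarrow>
    hnn_cong K A \<phi> [Elem x, Elem y] [Elem (x \<otimes>\<^bsub>K\<^esub> y)]"
| stable_right: "hnn_cong K A \<phi> [Stable, Stable_inv] []"
| stable_left: "hnn_cong K A \<phi> [Stable_inv, Stable] []"
| conj: "a \<in> A \<Longrightarrow> hnn_cong K A \<phi> [Stable, Elem a, Stable_inv] [Elem (\<phi> a)]"

definition hnn_class ::
  "('a, 'b) monoid_scheme \<Rightarrow> 'a set \<Rightarrow> ('a \<Rightarrow> 'a) \<Rightarrow> 'a hnn_letter list \<Rightarrow> 'a hnn_letter list set" where
  "hnn_class K A \<phi> w = {v. hnn_cong K A \<phi> w v}"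

definition hnn_extension ::
  "('a, 'b) monoid_scheme \<Rightarrow> 'a set \<Rightarrow> ('a \<Rightarrow> 'a) \<Rightarrow> 'a hnn_letter list set monoid" where
  "hnn_extension K A \<phi> = \<lparr>
     carrier = hnn_class K A \<phi> ` hnn_words K,
     mult = (\<lambda>X Y. {w. \<exists>u\<in>X. \<exists>v\<in>Y. hnn_cong K A \<phi> (u @ v) w}),
     one = hnn_class K A \<phi> []\<rparr>"

(* The canonical map K -> Gamma, through which K is regarded as a subgroup of Gamma. *)
definition hnn_base ::
  "('a, 'b) monoid_scheme \<Rightarrow> 'a set \<Rightarrow> ('a \<Rightarrow> 'a) \<Rightarrow> 'a \<Rightarrow> 'a hnn_letter list set" where
  "hnn_base K A \<phi> x = hnn_class K A \<phi> [Elem x]"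

(* The subgroup "K intersected with H" of K, for a subgroup H of Gamma. *)
definition hnn_base_inter ::
  "('a, 'b) monoid_scheme \<Rightarrow> 'a set \<Rightarrow> ('a \<Rightarrow> 'a) \<Rightarrow> 'a hnn_letter list set set \<Rightarrow> 'a set" where
  "hnn_base_inter K A \<phi> H = {x \<in> carrier K. hnn_base K A \<phi> x \<in> H}"

context
  fixes K :: "('a, 'b) monoid_scheme" and A :: "'a set" and \<phi> :: "'a \<Rightarrow> 'a"
  assumes K: "group K" and A: "A \<subseteq> carrier K" and \<phi>: "\<phi> ` A \<subseteq> carrier K"
begin

interpretation K: group K by (fact K)

lemma hnn_cong_words:
  "hnn_cong K A \<phi> u v \<Longrightarrow> u \<in> hnn_words K \<and> v \<in> hnn_words K"
  by (induction rule: hnn_cong.induct) (use A \<phi> in \<open>auto simp: hnn_words_def\<close>)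

lemma hnn_class_eq_iff:
  "u \<in> hnn_words K \<Longrightarrow> hnn_class K A \<phi> u = hnn_class K A \<phi> v \<longleftrightarrow> hnn_cong K A \<phi> u v"
  unfolding hnn_class_def
  by (auto intro: hnn_cong.refl hnn_cong.sym hnn_cong.trans)

lemma hnn_mult_class:
  assumes "u \<in> hnn_words K" "v \<in> hnn_words K"
  shows "hnn_class K A \<phi> u \<otimes>\<^bsub>hnn_extension K A \<phi>\<^esub> hnn_class K A \<phi> v = hnn_class K A \<phi> (u @ v)"
proof -
  have "hnn_cong K A \<phi> (u @ v) w"
    if "hnn_cong K A \<phi> u u'" "hnn_cong K A \<phi> v v'" "hnn_cong K A \<phi> (u' @ v') w" for u' v' w
    using that hnn_cong.append hnn_cong.trans by metis
  moreover have "hnn_cong K A \<phi> u u" "hnn_cong K A \<phi> v v"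
    using assms hnn_cong.refl by auto
  ultimately show ?thesis
    unfolding hnn_extension_def hnn_class_def by auto
qed

lemma hnn_word_left_inverse:
  "w \<in> hnn_words K \<Longrightarrow> \<exists>v\<in>hnn_words K. hnn_cong K A \<phi> (v @ w) []"
proof (induction w)
  case Nil
  then show ?case by (auto intro!: bexI[of _ "[]"] hnn_cong.refl)
next
  case (Cons c w)
  then have w: "w \<in> hnn_words K" by (auto simp: hnn_words_def)
  with Cons obtain v where v: "v \<in> hnn_words K" "hnn_cong K A \<phi> (v @ w) []" by auto
  have "\<exists>d. [d] \<in> hnn_words K \<and> hnn_cong K A \<phi> [d, c] []"
  proof (cases c)
    case (Elem x)
    then have x: "x \<in> carrier K" using Cons.prems by (auto simp: hnn_words_def)
    then have "hnn_cong K A \<phi> [Elem (inv\<^bsub>K\<^esub> x), Elem x] [Elem (inv\<^bsub>K\<^esub> x \<otimes>\<^bsub>K\<^esub> x)]"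
      by (intro hnn_cong.mult) auto
    then have "hnn_cong K A \<phi> [Elem (inv\<^bsub>K\<^esub> x), Elem x] []"
      using x hnn_cong.one hnn_cong.trans by (metis K.l_inv)
    then show ?thesis using Elem x by (auto simp: hnn_words_def intro!: exI[of _ "Elem (inv\<^bsub>K\<^esub> x)"])
  next
    case Stable
    then show ?thesis using hnn_cong.stable_left by (force simp: hnn_words_def)
  next
    case Stable_inv
    then show ?thesis using hnn_cong.stable_right by (force simp: hnn_words_def)
  qed
  then obtain d where d: "[d] \<in> hnn_words K" "hnn_cong K A \<phi> [d, c] []" by blast
  have "hnn_cong K A \<phi> (v @ ([d, c] @ w)) (v @ ([] @ w))"
    using d v w by (intro hnn_cong.append hnn_cong.refl) auto
  then have "hnn_cong K A \<phi> ((v @ [d]) @ (c # w)) []"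
    using v(2) hnn_cong.trans by fastforce
  moreover have "v @ [d] \<in> hnn_words K"
    using v d by (auto simp: hnn_words_def)
  ultimately show ?case by blast
qed

lemma hnn_words_append: "u \<in> hnn_words K \<Longrightarrow> v \<in> hnn_words K \<Longrightarrow> u @ v \<in> hnn_words K"
  by (auto simp: hnn_words_def)

lemma hnn_words_Nil: "[] \<in> hnn_words K"
  by (auto simp: hnn_words_def)

lemma hnn_carrier: "carrier (hnn_extension K A \<phi>) = hnn_class K A \<phi> ` hnn_words K"
  and hnn_one: "\<one>\<^bsub>hnn_extension K A \<phi>\<^esub> = hnn_class K A \<phi> []"
  by (simp_all add: hnn_extension_def)

lemma group_hnn_extension: "group (hnn_extension K A \<phi>)"
proof (rule groupI)
  fix X assume "X \<in> carrier (hnn_extension K A \<phi>)"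
  then obtain w where w: "w \<in> hnn_words K" "X = hnn_class K A \<phi> w" by (auto simp: hnn_carrier)
  with hnn_word_left_inverse obtain v where v: "v \<in> hnn_words K" "hnn_cong K A \<phi> (v @ w) []"
    by blast
  then have "hnn_class K A \<phi> v \<otimes>\<^bsub>hnn_extension K A \<phi>\<^esub> X = \<one>\<^bsub>hnn_extension K A \<phi>\<^esub>"
    using w by (simp add: hnn_mult_class hnn_one hnn_class_eq_iff hnn_words_append)
  then show "\<exists>Y\<in>carrier (hnn_extension K A \<phi>). Y \<otimes>\<^bsub>hnn_extension K A \<phi>\<^esub> X = \<one>\<^bsub>hnn_extension K A \<phi>\<^esub>"
    using v by (auto simp: hnn_carrier)
qed (auto simp: hnn_carrier hnn_one hnn_mult_class hnn_words_append hnn_words_Nil)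

lemma hnn_base_hom: "hnn_base K A \<phi> \<in> hom K (hnn_extension K A \<phi>)"
  unfolding hom_def hnn_base_def
  by (auto simp: hnn_carrier hnn_mult_class hnn_class_eq_iff hnn_words_def
      intro!: hnn_cong.sym[OF hnn_cong.mult])

lemma hnn_conj:
  assumes "a \<in> A"
  defines "t \<equiv> hnn_class K A \<phi> [Stable]"
  shows "t \<otimes>\<^bsub>hnn_extension K A \<phi>\<^esub> hnn_base K A \<phi> a \<otimes>\<^bsub>hnn_extension K A \<phi>\<^esub>
           inv\<^bsub>hnn_extension K A \<phi>\<^esub> t = hnn_base K A \<phi> (\<phi> a)"
proof -
  interpret G: group "hnn_extension K A \<phi>" by (fact group_hnn_extension)
  have letters: "[Stable] \<in> hnn_words K" "[Stable_inv] \<in> hnn_words K" "[Elem a] \<in> hnn_words K"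
    using assms A by (auto simp: hnn_words_def)
  have "hnn_class K A \<phi> [Stable_inv] \<otimes>\<^bsub>hnn_extension K A \<phi>\<^esub> t = \<one>\<^bsub>hnn_extension K A \<phi>\<^esub>"
    unfolding t_def using letters hnn_words_append[OF letters(2,1)]
    by (simp add: hnn_mult_class hnn_one hnn_class_eq_iff hnn_cong.stable_left)
  then have "inv\<^bsub>hnn_extension K A \<phi>\<^esub> t = hnn_class K A \<phi> [Stable_inv]"
    using letters by (intro G.inv_equality) (auto simp: t_def hnn_carrier)
  then show ?thesis
    using letters hnn_words_append[OF letters(1) hnn_words_append[OF letters(3,2)]]
      hnn_words_append[OF letters(1,3)] hnn_cong.conj[OF \<open>a \<in> A\<close>]
    by (simp add: t_def hnn_base_def hnn_mult_class hnn_class_eq_iff)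
qed

end

end

theory Submission
  imports Defs "HOL-Library.Function_Algebras" "HOL-Algebra.Group_Action" "HOL-Algebra.SndIsomorphismGrp"
    "HOL-Number_Theory.Cong" "HOL-Analysis.Function_Topology"
begin

text \<open>
  For a finite quotient \<open>Q\<close> of a group \<open>G\<close> with kernel \<open>U\<close>, Shapiro's lemma gives
  \<open>(d\<^sub>p(U) - 1) / |Q| = dim Z\<^sup>1(G, \<bbbF>\<^sub>p[Q]) / |Q| - 1\<close>. A cocycle of the HNN extension is a cocycle \<open>c\<close> of \<open>K\<close> together with an
  arbitrary function \<open>\<tau>\<close> (its value on the stable letter), subject to one relation for every element of \<open>A\<close>. The
  coboundaries of \<open>\<tau>\<close> alone show that the relations have rank at least \<open>|Q| (1 - 1 / |A\<^sub>Q|)\<close>, where \<open>A\<^sub>Q\<close> is the image of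
  \<open>A\<close> in \<open>Q\<close>; this is the upper bound for the gradient. For the lower bound, independent relations form a subgraph of the Cayley graph of \<open>A\<close> that is
  locally a forest; a forest in an amenable group has at most one edge per vertex on average, and in a finite group
  at most \<open>1 - 1 / |A|\<close>. The rates are monotone in \<open>Q\<close>, because the \<open>\<bbbF>\<^sub>p\<close>-representation \<open>V\<close> of a finite \<open>p\<close>-group \<open>P\<close> satisfies
  \<open>dim V \<le> |P| dim V\<^sup>P\<close>; so both infima are limits along the lattice. The subgroup \<open>A\<close> may be infinitely generated, but on a fixed
  \<open>Q\<close> finitely many of the relations imply all others.
\<close>

section \<open>Spaces of functions with values in a group of prime order\<close>

text \<open>All counts are made over one finite quotient Q of the HNN extension, although K need not
  map onto Q: dividing by |Q| compensates, since Q then splits into copies of the image of K. The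
  delicate point is the order of the choices in the lower bound. A finite set S of relations that
  suffices for Q depends on Q, whereas the amenability estimate for S is available only in quotients
  that are injective on a finite set depending on S. So S is chosen for Q, the estimate is made in a
  deeper quotient with the relations in S alone, and monotonicity of the count for this fixed S
  carries it back to Q. Separating finite subsets of A by quotients of the HNN extension presupposes
  that K embeds in it, which is why an embedding argument is included. Dimensions are never formed
  as such: all spaces are finite additive groups of functions, and the dimension is the logarithm to
  base p of the cardinality.\<close>

definition add_subgroup :: "'v::ab_group_add set \<Rightarrow> bool" where
  "add_subgroup V \<longleftrightarrow> 0 \<in> V \<and> (\<forall>u\<in>V. \<forall>v\<in>V. u - v \<in> V)"

lemma add_subgroup_zero: "add_subgroup V \<Longrightarrow> 0 \<in> V"
  by (simp add: add_subgroup_def)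

lemma add_subgroup_diff: "add_subgroup V \<Longrightarrow> u \<in> V \<Longrightarrow> v \<in> V \<Longrightarrow> u - v \<in> V"
  by (simp add: add_subgroup_def)

lemma add_subgroup_uminus: "add_subgroup V \<Longrightarrow> v \<in> V \<Longrightarrow> - v \<in> V"
  using add_subgroup_diff[of V 0 v] add_subgroup_zero by auto

lemma add_subgroup_add: "add_subgroup V \<Longrightarrow> u \<in> V \<Longrightarrow> v \<in> V \<Longrightarrow> u + v \<in> V"
  using add_subgroup_diff[of V u "- v"] add_subgroup_uminus[of V v] by auto

lemma add_subgroup_sum: "add_subgroup V \<Longrightarrow> (\<And>i. i \<in> I \<Longrightarrow> f i \<in> V) \<Longrightarrow> sum f I \<in> V"
  by (induction I rule: infinite_finite_induct) (auto simp: add_subgroup_zero add_subgroup_add)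

lemma card_le_fibres:
  assumes "finite V" "h ` V \<subseteq> W" "finite W" "\<And>w. w \<in> W \<Longrightarrow> card {v\<in>V. h v = w} \<le> n"
  shows "card V \<le> card W * n"
proof -
  have "V = (\<Union>w\<in>W. {v\<in>V. h v = w})" using assms(2) by auto
  then have "card V \<le> (\<Sum>w\<in>W. card {v\<in>V. h v = w})"
    using card_UN_le[OF assms(3), of "\<lambda>w. {v\<in>V. h v = w}"] by simp
  also have "\<dots> \<le> card W * n" using sum_bounded_above[of W _ n] assms(4) by simp
  finally show ?thesis .
qed

lemma sum_fun_apply: "(\<Sum>i\<in>I. f i) x = (\<Sum>i\<in>I. f i x)" for f :: "'i \<Rightarrow> 'x \<Rightarrow> 'y::ab_group_add"
  by (induction I rule: infinite_finite_induct) auto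

text \<open>An additive map with kernel \<open>pZ\<close>, so its range is a copy of the field with
  p elements inside some additive group; no type can depend on the variable p. Scalars are residues
  of integers, so an additive subgroup of a space of F-valued functions is already a
  subspace.\<close>

locale prime_coeff =
  fixes p :: nat and \<iota> :: "int \<Rightarrow> 'f::ab_group_add"
  assumes prime: "Factorial_Ring.prime p"
    and iota_add: "\<iota> (i + j) = \<iota> i + \<iota> j"
    and iota_eq_0: "\<iota> i = 0 \<longleftrightarrow> int p dvd i"
begin

abbreviation F where "F \<equiv> range \<iota>"

lemma p_gt_1: "p > 1"
  using prime prime_gt_1_nat by auto

lemma iota_0: "\<iota> 0 = 0"
  by (simp add: iota_eq_0)

lemma iota_minus: "\<iota> (- i) = - \<iota> i"
  using iota_add[of i "- i"] by (simp add: iota_0 eq_neg_iff_add_eq_0 add.commute)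

lemma iota_diff: "\<iota> (i - j) = \<iota> i - \<iota> j"
  using iota_add[of i "- j"] by (simp add: iota_minus)

lemma iota_eq_iff: "\<iota> i = \<iota> j \<longleftrightarrow> int p dvd (i - j)"
  using iota_eq_0[of "i - j"] by (simp add: iota_diff)

lemma iota_mult_nat: "\<iota> (int n * i) = (\<Sum>j<n. \<iota> i)"
  by (induction n) (auto simp: iota_0 iota_add ring_distribs)

lemma F_subgroup: "add_subgroup F"
proof -
  have "0 \<in> F" using iota_0 by (metis rangeI)
  moreover have "\<iota> i - \<iota> j \<in> F" for i j by (metis iota_diff rangeI)
  ultimately show ?thesis by (auto simp: add_subgroup_def)
qed

lemma F_image: "F = \<iota> ` {0..<int p}"
proof -
  have "\<iota> i = \<iota> (i mod int p)" for i
    by (simp add: iota_eq_iff minus_mod_eq_mult_div)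
  moreover have "i mod int p \<in> {0..<int p}" for i using p_gt_1 by simp
  ultimately show ?thesis by blast
qed

lemma card_F: "card F = p"
proof -
  have "inj_on \<iota> {0..<int p}"
    by (rule inj_onI) (smt (verit) iota_eq_iff atLeastLessThan_iff zdvd_imp_le)
  then show ?thesis unfolding F_image by (simp add: card_image)
qed

lemma finite_F: "finite F"
  by (simp add: F_image)

lemma F_subgroup_trivial:
  assumes "add_subgroup D" "D \<subseteq> F" "d \<in> D" "d \<noteq> 0"
  shows "D = F"
proof -
  obtain k where k: "d = \<iota> k" using assms by auto
  have "coprime k (int p)"
    using assms(4) prime k prime_imp_coprime[of "int p" k] by (simp add: iota_eq_0 coprime_commute)
  then obtain m where m: "[k * m = 1] (mod int p)" using cong_solve_coprime_int by blast
  have "\<iota> i \<in> D" for i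
  proof -
    \<comment> \<open>\<open>m\<close> inverts \<open>k\<close> modulo p. The non-negative
      representative \<open>n\<close> of \<open>m * i\<close> makes \<open>\<iota> i\<close> an
      n-fold sum of \<open>d\<close>, so closure under sums suffices.\<close>
    define n where "n = nat ((m * i) mod int p)"
    have n: "int n = (m * i) mod int p" using p_gt_1 by (simp add: n_def)
    have "[int n * k = m * i * k] (mod int p)" unfolding n by (simp add: cong_def mod_mult_left_eq)
    also have "[m * i * k = i] (mod int p)"
      using cong_scalar_left[OF m, of i] by (simp add: ac_simps)
    finally have "\<iota> (int n * k) = \<iota> i" by (simp add: iota_eq_iff cong_iff_dvd_diff)
    moreover have "\<iota> (int n * k) \<in> D"
      unfolding iota_mult_nat using assms k by (intro add_subgroup_sum) auto
    ultimately show ?thesis by simp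
  qed
  then show ?thesis using assms(2) by blast
qed

lemma card_vanishing_functions:
  assumes "finite D"
  shows "card {f. (\<forall>x. f x \<in> F) \<and> (\<forall>x. x \<notin> D \<longrightarrow> f x = 0)} = p ^ card D"
proof -
  let ?S = "{f. (\<forall>x. f x \<in> F) \<and> (\<forall>x. x \<notin> D \<longrightarrow> f x = 0)}"
  have 0: "0 \<in> F" using F_subgroup by (rule add_subgroup_zero)
  have "bij_betw (\<lambda>f x. if x \<in> D then f x else 0) (PiE D (\<lambda>_. F)) ?S"
  proof (rule bij_betw_byWitness[where f' = "\<lambda>f. restrict f D"])
    show "\<forall>f\<in>PiE D (\<lambda>_. F). restrict (\<lambda>x. if x \<in> D then f x else 0) D = f"
      by (auto simp: fun_eq_iff PiE_def extensional_def)
    show "\<forall>f\<in>?S. (\<lambda>x. if x \<in> D then restrict f D x else 0) = f"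
      by (auto simp: fun_eq_iff)
    show "(\<lambda>f x. if x \<in> D then f x else 0) ` PiE D (\<lambda>_. F) \<subseteq> ?S"
    proof safe
      fix f x assume "f \<in> PiE D (\<lambda>_. F)"
      then show "(if x \<in> D then f x else 0) \<in> F" using 0 by (cases "x \<in> D") (auto dest: PiE_mem)
    qed auto
    show "(\<lambda>f. restrict f D) ` ?S \<subseteq> PiE D (\<lambda>_. F)"
      by (intro image_subsetI restrict_PiE_iff[THEN iffD2]) auto
  qed
  then show ?thesis
    using bij_betw_same_card[of _ "PiE D (\<lambda>_. F)" ?S] card_PiE[OF assms, of "\<lambda>_. F"] by (simp add: card_F)
qed

text \<open>Point evaluations span the dual space of \<open>V\<close>, and a smallest separating set
  of points is a basis of it. Restriction to \<open>\<Theta>\<close> is then an isomorphism onto all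
  F-valued functions on \<open>\<Theta>\<close>, which supplies basis and dimension at once.\<close>

lemma pivots:
  fixes V :: "('y \<Rightarrow> 'f) set"
  assumes fin: "finite V" and V: "add_subgroup V" and VF: "\<forall>v\<in>V. \<forall>y. v y \<in> F"
  obtains \<Theta> where "finite \<Theta>" "\<forall>v\<in>V. (\<forall>e\<in>\<Theta>. v e = 0) \<longrightarrow> v = 0"
    "\<forall>f. (\<forall>e\<in>\<Theta>. f e \<in> F) \<longrightarrow> (\<exists>v\<in>V. \<forall>e\<in>\<Theta>. v e = f e)"
    "card V = p ^ card \<Theta>"
proof -
  define sep where "sep \<Theta> \<longleftrightarrow> finite \<Theta> \<and> (\<forall>v\<in>V. (\<forall>e\<in>\<Theta>. v e = 0) \<longrightarrow> v = 0)" for \<Theta> :: "'y set"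
  have "\<forall>v\<in>V. \<exists>y. v \<noteq> 0 \<longrightarrow> v y \<noteq> 0" by (auto simp: fun_eq_iff)
  then obtain y where y: "\<And>v. v \<in> V \<Longrightarrow> v \<noteq> 0 \<Longrightarrow> v (y v) \<noteq> 0" by metis
  have "sep (y ` V)" unfolding sep_def using fin y by auto
  then obtain \<Theta> where \<Theta>: "sep \<Theta>" and min: "\<And>\<Theta>'. sep \<Theta>' \<Longrightarrow> card \<Theta> \<le> card \<Theta>'"
    using ex_has_least_nat[of sep "y ` V" card] by blast
  have fin\<Theta>: "finite \<Theta>" and inj: "\<And>v. v \<in> V \<Longrightarrow> (\<And>e. e \<in> \<Theta> \<Longrightarrow> v e = 0) \<Longrightarrow> v = 0"
    using \<Theta> by (auto simp: sep_def)
  \<comment> \<open>By minimality some nonzero vector vanishes on the rest of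
    \<open>\<Theta>\<close>, and it cannot vanish at \<open>e\<close> as well. The values at
    \<open>e\<close> of such vectors form a nonzero subgroup of F, hence all of F.\<close>
  have dual: "\<exists>v\<in>V. v e = d \<and> (\<forall>e'\<in>\<Theta> - {e}. v e' = 0)" if e: "e \<in> \<Theta>" and d: "d \<in> F" for e d
  proof -
    define D where "D = {v e |v. v \<in> V \<and> (\<forall>e'\<in>\<Theta> - {e}. v e' = 0)}"
    have "\<not> sep (\<Theta> - {e})" using min[of "\<Theta> - {e}"] card_Diff1_less[OF fin\<Theta> e] by auto
    then obtain v where v: "v \<in> V" "\<forall>e'\<in>\<Theta> - {e}. v e' = 0" "v \<noteq> 0"
      using fin\<Theta> by (auto simp: sep_def)
    then have "v e \<noteq> 0" using inj[of v] by blast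
    moreover have "v e \<in> D" using v by (auto simp: D_def)
    moreover have "D \<subseteq> F" using VF by (auto simp: D_def)
    moreover have "add_subgroup D"
    proof -
      have "0 \<in> D" unfolding D_def
        by (intro CollectI exI[of _ 0]) (auto simp: add_subgroup_zero[OF V])
      moreover have "a - b \<in> D" if "a \<in> D" "b \<in> D" for a b
      proof -
        from that obtain u w where "a = u e" "b = w e" "u \<in> V" "w \<in> V"
          "\<forall>e'\<in>\<Theta> - {e}. u e' = 0" "\<forall>e'\<in>\<Theta> - {e}. w e' = 0" unfolding D_def by blast
        then show ?thesis unfolding D_def
          by (intro CollectI exI[of _ "u - w"]) (auto simp: add_subgroup_diff[OF V])
      qed
      ultimately show ?thesis by (simp add: add_subgroup_def)
    qed
    ultimately have "D = F" using F_subgroup_trivial by blast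
    with d have "d \<in> D" by simp
    then show ?thesis unfolding D_def by blast
  qed
  have surj: "\<exists>v\<in>V. \<forall>e\<in>\<Theta>. v e = f e" if f: "\<And>e. e \<in> \<Theta> \<Longrightarrow> f e \<in> F" for f
  proof -
    have "\<forall>e\<in>\<Theta>. \<exists>v. v \<in> V \<and> v e = f e \<and> (\<forall>e'\<in>\<Theta> - {e}. v e' = 0)"
    proof
      fix e assume "e \<in> \<Theta>"
      from dual[OF this f[OF this]] show "\<exists>v. v \<in> V \<and> v e = f e \<and> (\<forall>e'\<in>\<Theta> - {e}. v e' = 0)" by blast
    qed
    then obtain w where w: "\<And>e. e \<in> \<Theta> \<Longrightarrow> w e \<in> V" "\<And>e. e \<in> \<Theta> \<Longrightarrow> w e e = f e"
      "\<And>e e'. e \<in> \<Theta> \<Longrightarrow> e' \<in> \<Theta> - {e} \<Longrightarrow> w e e' = 0" by metis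
    have "(\<Sum>e\<in>\<Theta>. w e) e' = f e'" if "e' \<in> \<Theta>" for e'
    proof -
      have "(\<Sum>e\<in>\<Theta>. w e e') = (\<Sum>e\<in>\<Theta>. if e = e' then f e' else 0)"
        using w that by (intro sum.cong) auto
      then show ?thesis using fin\<Theta> that by (simp add: sum_fun_apply)
    qed
    moreover have "(\<Sum>e\<in>\<Theta>. w e) \<in> V" using w V by (intro add_subgroup_sum) auto
    ultimately show ?thesis by blast
  qed
  have "bij_betw (\<lambda>v. restrict v \<Theta>) V (PiE \<Theta> (\<lambda>_. F))"
  proof (rule bij_betwI')
    fix u v assume uv: "u \<in> V" "v \<in> V"
    show "(restrict u \<Theta> = restrict v \<Theta>) = (u = v)"
    proof
      assume eq: "restrict u \<Theta> = restrict v \<Theta>"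
      have "u e = v e" if "e \<in> \<Theta>" for e using fun_cong[OF eq, of e] that by simp
      then have "u - v = 0" using inj[of "u - v"] add_subgroup_diff[OF V uv] by simp
      then show "u = v" by simp
    qed simp
  next
    fix f assume f: "f \<in> PiE \<Theta> (\<lambda>_. F)"
    have "\<exists>v\<in>V. \<forall>e\<in>\<Theta>. v e = f e" by (rule surj) (rule PiE_mem[OF f])
    then obtain v where v: "v \<in> V" "\<And>e. e \<in> \<Theta> \<Longrightarrow> v e = f e" by blast
    have "f = restrict v \<Theta>"
      by (rule extensionalityI[of _ \<Theta>]) (use f v in \<open>auto simp: PiE_def\<close>)
    with v(1) show "\<exists>v\<in>V. f = restrict v \<Theta>" by blast
  next
    fix v assume "v \<in> V"
    then show "restrict v \<Theta> \<in> PiE \<Theta> (\<lambda>_. F)" by (intro restrict_PiE_iff[THEN iffD2] ballI VF[rule_format])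
  qed
  then have "card V = p ^ card \<Theta>"
    using bij_betw_same_card[of _ V "PiE \<Theta> (\<lambda>_. F)"] card_PiE[OF fin\<Theta>, of "\<lambda>_. F"] by (simp add: card_F)
  moreover have "\<forall>v\<in>V. (\<forall>e\<in>\<Theta>. v e = 0) \<longrightarrow> v = 0" using \<Theta> by (simp add: sep_def)
  moreover have "\<forall>f. (\<forall>e\<in>\<Theta>. f e \<in> F) \<longrightarrow> (\<exists>v\<in>V. \<forall>e\<in>\<Theta>. v e = f e)"
    by (intro allI impI surj) (erule bspec)
  ultimately show ?thesis by (intro that[OF fin\<Theta>])
qed

text \<open>Without nonzero fixed vectors every orbit of nonzero vectors has length a positive power
  of p, so p divides |V| - 1. But |V| is itself a power of p, hence equal to 1.\<close>

lemma no_fixed_points_trivial: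
  fixes V :: "('y \<Rightarrow> 'f) set"
  assumes P: "group P" "order P = p ^ k"
    and fin: "finite V" and V: "add_subgroup V" and VF: "\<forall>v\<in>V. \<forall>y. v y \<in> F"
    and closed: "\<And>g v. g \<in> carrier P \<Longrightarrow> v \<in> V \<Longrightarrow> \<rho> g v \<in> V"
    and mult: "\<And>g h v. g \<in> carrier P \<Longrightarrow> h \<in> carrier P \<Longrightarrow> v \<in> V \<Longrightarrow> \<rho> (g \<otimes>\<^bsub>P\<^esub> h) v = \<rho> g (\<rho> h v)"
    and one: "\<And>v. v \<in> V \<Longrightarrow> \<rho> \<one>\<^bsub>P\<^esub> v = v"
    and diff: "\<And>g u v. g \<in> carrier P \<Longrightarrow> u \<in> V \<Longrightarrow> v \<in> V \<Longrightarrow> \<rho> g (u - v) = \<rho> g u - \<rho> g v"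
    and fixd: "\<And>v. v \<in> V \<Longrightarrow> (\<And>g. g \<in> carrier P \<Longrightarrow> \<rho> g v = v) \<Longrightarrow> v = 0"
  shows "V = {0}"
proof -
  interpret P: group P by (fact P)
  define E where "E = V - {0}"
  have zero: "\<rho> g 0 = 0" if "g \<in> carrier P" for g
    using diff[OF that add_subgroup_zero[OF V] add_subgroup_zero[OF V]] by simp
  have invl: "\<rho> (inv\<^bsub>P\<^esub> g) (\<rho> g v) = v" "\<rho> g (\<rho> (inv\<^bsub>P\<^esub> g) v) = v" if "g \<in> carrier P" "v \<in> V" for g v
    using mult[of "inv\<^bsub>P\<^esub> g" g v] mult[of g "inv\<^bsub>P\<^esub> g" v] that one by auto
  have closedE: "\<rho> g v \<in> E" if "g \<in> carrier P" "v \<in> E" for g v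
    using that closed invl(1)[of g v] zero[of "inv\<^bsub>P\<^esub> g"] unfolding E_def by force
  \<comment> \<open>\<open>BijGroup\<close> consists of extensional maps, hence the restriction to
    the nonzero vectors.\<close>
  define \<phi> where "\<phi> g = restrict (\<rho> g) E" for g
  have bij: "bij_betw (\<phi> g) E E" if g: "g \<in> carrier P" for g
    by (rule bij_betw_byWitness[where f' = "\<rho> (inv\<^bsub>P\<^esub> g)"])
       (use g closedE invl in \<open>auto simp: \<phi>_def E_def\<close>)
  have "group_action P E \<phi>"
  proof (intro group_action.intro group_hom.intro group_hom_axioms.intro homI P group_BijGroup)
    fix g assume "g \<in> carrier P"
    then show "\<phi> g \<in> carrier (BijGroup E)"
      using bij by (auto simp: BijGroup_def Bij_def \<phi>_def)
  next
    fix g h assume "g \<in> carrier P" "h \<in> carrier P"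
    then show "\<phi> (g \<otimes>\<^bsub>P\<^esub> h) = \<phi> g \<otimes>\<^bsub>BijGroup E\<^esub> \<phi> h"
      using bij[of g] bij[of h] mult closedE
      by (auto simp: BijGroup_def Bij_def \<phi>_def compose_def fun_eq_iff E_def)
  qed
  then interpret act: group_action P E \<phi> .
  have finE: "finite E" using fin by (simp add: E_def)
  have "p dvd card Ob" if "Ob \<in> orbits P E \<phi>" for Ob
  proof -
    from that obtain x where x: "x \<in> E" "Ob = orbit P \<phi> x" by (auto simp: orbits_def)
    have "card Ob dvd p ^ k" using act.orbit_stabilizer_theorem[OF x(1)] x(2) P(2) by (metis dvd_triv_left)
    then obtain i where i: "card Ob = p ^ i" using divides_primepow_nat[OF prime] by blast
    have "i \<noteq> 0"
    proof
      assume "i = 0"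
      then obtain y where "Ob = {y}" using i by (auto simp: card_1_singleton_iff)
      moreover have "x \<in> Ob" using act.orbit_refl x by simp
      ultimately have "Ob = {x}" by auto
      then have "\<rho> g x = x" if "g \<in> carrier P" for g
        using x that by (auto simp: orbit_def \<phi>_def)
      then show False using fixd x(1) by (auto simp: E_def)
    qed
    then show ?thesis using i by simp
  qed
  moreover have "card E = (\<Sum>Ob\<in>orbits P E \<phi>. card Ob)"
    using act.disjoint_sum[OF finE, of "\<lambda>_. 1::nat"] by simp
  ultimately have "p dvd card E" by (metis dvd_sum)
  moreover have "card V = Suc (card E)"
    unfolding E_def using card.remove[OF fin add_subgroup_zero[OF V]] .
  moreover obtain \<Theta> :: "'y set" where "card V = p ^ card \<Theta>" using pivots[OF fin V VF] by metis
  ultimately have "p dvd card E" "card V = Suc (card E)" "card V = p ^ card \<Theta>" by auto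
  have "card \<Theta> = 0"
  proof (rule ccontr)
    assume "card \<Theta> \<noteq> 0"
    then have "p dvd card V" using \<open>card V = p ^ card \<Theta>\<close> by simp
    then have "p dvd Suc (card E) - card E" unfolding \<open>card V = Suc (card E)\<close>
      using \<open>p dvd card E\<close> by (rule dvd_diff_nat)
    then show False using p_gt_1 by simp
  qed
  then have "card V = 1" using \<open>card V = p ^ card \<Theta>\<close> by simp
  then show ?thesis using add_subgroup_zero[OF V] by (auto simp: card_1_singleton_iff)
qed

text \<open>A \<open>p\<close>-group acting linearly: \<open>V\<close> embeds into the coinduced module of its fixed space, since a nonzero
  kernel of the map reading off the pivots of the fixed space along the orbits would contain a fixed vector.\<close>

lemma card_le_fixed_points:
  fixes V :: "('y \<Rightarrow> 'f) set"
  assumes P: "group P" "order P = p ^ k"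
    and fin: "finite V" and V: "add_subgroup V" and VF: "\<forall>v\<in>V. \<forall>y. v y \<in> F"
    and closed: "\<And>g v. g \<in> carrier P \<Longrightarrow> v \<in> V \<Longrightarrow> \<rho> g v \<in> V"
    and mult: "\<And>g h v. g \<in> carrier P \<Longrightarrow> h \<in> carrier P \<Longrightarrow> v \<in> V \<Longrightarrow> \<rho> (g \<otimes>\<^bsub>P\<^esub> h) v = \<rho> g (\<rho> h v)"
    and one: "\<And>v. v \<in> V \<Longrightarrow> \<rho> \<one>\<^bsub>P\<^esub> v = v"
    and diff: "\<And>g u v. g \<in> carrier P \<Longrightarrow> u \<in> V \<Longrightarrow> v \<in> V \<Longrightarrow> \<rho> g (u - v) = \<rho> g u - \<rho> g v"
  shows "card V \<le> card {v\<in>V. \<forall>g\<in>carrier P. \<rho> g v = v} ^ order P"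
proof -
  interpret P: group P by (fact P)
  define X where "X = {v\<in>V. \<forall>g\<in>carrier P. \<rho> g v = v}"
  have zero: "\<rho> g 0 = 0" if "g \<in> carrier P" for g
    using diff[OF that add_subgroup_zero[OF V] add_subgroup_zero[OF V]] by simp
  have XS: "add_subgroup X"
    unfolding add_subgroup_def X_def using zero diff add_subgroup_zero[OF V] add_subgroup_diff[OF V] by auto
  have finX: "finite X" and XF: "\<forall>v\<in>X. \<forall>y. v y \<in> F" using fin VF by (auto simp: X_def)
  obtain \<Theta> :: "'y set" where \<Theta>: "finite \<Theta>" "\<forall>v\<in>X. (\<forall>e\<in>\<Theta>. v e = 0) \<longrightarrow> v = 0"
    "card X = p ^ card \<Theta>" by (rule pivots[OF finX XS XF])
  define N where "N = {v\<in>V. \<forall>g\<in>carrier P. \<forall>e\<in>\<Theta>. \<rho> g v e = 0}"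
  have "N = {0}"
  proof (rule no_fixed_points_trivial[OF P, where \<rho> = \<rho>])
    show "finite N" using fin by (simp add: N_def)
    show "add_subgroup N"
      unfolding add_subgroup_def N_def using zero diff add_subgroup_zero[OF V] add_subgroup_diff[OF V] by auto
    show "\<rho> g v \<in> N" if "g \<in> carrier P" "v \<in> N" for g v
      using that closed mult[of _ g v, symmetric] by (auto simp: N_def)
    \<comment> \<open>The case \<open>g = 1\<close> in the definition of \<open>N\<close> says that
      a fixed vector in \<open>N\<close> vanishes on the pivots of the fixed space.\<close>
    show "v = 0" if v: "v \<in> N" and fixd: "\<And>g. g \<in> carrier P \<Longrightarrow> \<rho> g v = v" for v
    proof (rule \<Theta>(2)[rule_format])
      show "v \<in> X" using v fixd by (auto simp: N_def X_def)
      show "v e = 0" if "e \<in> \<Theta>" for e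
        using v that fixd[OF P.one_closed] P.one_closed unfolding N_def by (metis (mono_tags, lifting) mem_Collect_eq)
    qed
  qed (use VF mult one diff in \<open>auto simp: N_def\<close>)
  let ?r = "\<lambda>v. \<lambda>(g, e)\<in>carrier P \<times> \<Theta>. \<rho> g v e"
  have finP: "finite (carrier P)"
    using P(2) p_gt_1 by (intro card_ge_0_finite) (simp add: order_def)
  have "inj_on ?r V"
  proof (rule inj_onI)
    fix u v assume uv: "u \<in> V" "v \<in> V" "?r u = ?r v"
    have "\<rho> g u e = \<rho> g v e" if "g \<in> carrier P" "e \<in> \<Theta>" for g e
      using fun_cong[OF uv(3), of "(g, e)"] that by simp
    then have "u - v \<in> N" using uv by (auto simp: N_def diff add_subgroup_diff[OF V])
    then show "u = v" using \<open>N = {0}\<close> by simp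
  qed
  moreover have "?r ` V \<subseteq> PiE (carrier P \<times> \<Theta>) (\<lambda>_. F)"
    using closed VF by (auto split: if_splits)
  ultimately have "card V \<le> card (PiE (carrier P \<times> \<Theta>) (\<lambda>_. F))"
    using finP \<Theta>(1) finite_F by (intro card_inj_on_le[of ?r]) (auto intro!: finite_PiE)
  also have "\<dots> = p ^ (card \<Theta> * order P)"
    using finP \<Theta>(1) by (subst card_PiE) (auto simp: card_F card_cartesian_product order_def mult.commute)
  also have "\<dots> = card X ^ order P" using \<Theta>(3) by (simp add: power_mult)
  finally show ?thesis unfolding X_def .
qed

end

section \<open>Homomorphisms to a group of prime order\<close>

lemma (in group) rcos_eqI:
  assumes "subgroup N G" "x \<in> carrier G" "y \<in> carrier G" "x \<otimes> inv y \<in> N"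
  shows "N #> x = N #> y"
proof -
  have "x = (x \<otimes> inv y) \<otimes> y" using assms by (simp add: m_assoc)
  then have "x \<in> N #> y" using assms(4) by (auto simp: r_coset_def)
  then show ?thesis using repr_independence[OF _ assms(3,1)] by simp
qed

text \<open>Schreier's generators: for a transversal \<open>r\<close> of the kernel these are the elements
  \<open>r q s (r (q \<theta>(s)))\<^sup>-\<^sup>1\<close>.\<close>

lemma finitely_generated_kernel:
  assumes G: "group G" and Q: "group Q" and fin: "finite (carrier Q)" and \<theta>: "\<theta> \<in> hom G Q"
    and fg: "finitely_generated G"
  shows "finitely_generated (G\<lparr>carrier := kernel G Q \<theta>\<rparr>)"
proof -
  interpret group_hom G Q \<theta> using G Q \<theta> by (simp add: group_hom_def group_hom_axioms_def)
  obtain S where S: "finite S" "S \<subseteq> carrier G" "generate G S = carrier G"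
    using fg by (auto simp: finitely_generated_def)
  define I where "I = \<theta> ` carrier G"
  \<comment> \<open>The transversal contains the identity, so that \<open>y\<close> at the identity
    coset returns every element of the kernel unchanged.\<close>
  define r where "r q = (if q = \<one>\<^bsub>Q\<^esub> then \<one>\<^bsub>G\<^esub> else SOME g. g \<in> carrier G \<and> \<theta> g = q)" for q
  have r: "r q \<in> carrier G" "\<theta> (r q) = q" if "q \<in> I" for q
  proof -
    have "\<exists>g. g \<in> carrier G \<and> \<theta> g = q" using that by (auto simp: I_def)
    from someI_ex[OF this] show "r q \<in> carrier G" "\<theta> (r q) = q" by (auto simp: r_def)
  qed
  have I_mult: "q \<otimes>\<^bsub>Q\<^esub> \<theta> g \<in> I" if "q \<in> I" "g \<in> carrier G" for q g
    using that unfolding I_def by (metis (no_types, lifting) G.m_closed hom_mult imageE image_eqI)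
  have I_sub: "I \<subseteq> carrier Q" by (auto simp: I_def)
  define y where "y q g = r q \<otimes>\<^bsub>G\<^esub> g \<otimes>\<^bsub>G\<^esub> inv\<^bsub>G\<^esub> (r (q \<otimes>\<^bsub>Q\<^esub> \<theta> g))" for q g
  define Y where "Y = (\<lambda>(q, s). y q s) ` (I \<times> S)"
  let ?U = "kernel G Q \<theta>"
  have U: "subgroup ?U G" by (rule subgroup_kernel)
  have finY: "finite Y" using finite_subset[OF I_sub fin] S(1) by (simp add: Y_def)
  have yU: "y q g \<in> ?U" if "q \<in> I" "g \<in> carrier G" for q g
    using that r[OF that(1)] r[OF I_mult[OF that]] I_sub I_mult[OF that]
    by (auto simp: y_def kernel_def)
  have YU: "Y \<subseteq> ?U" using yU S(2) by (auto simp: Y_def)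
  have Yc: "Y \<subseteq> carrier G" using YU by (auto simp: kernel_def)
  \<comment> \<open>The rule y(q, g h) = y(q, g) y(q \<theta>(g), h) moves the coset, so the
    induction has to treat all \<open>q\<close> at once.\<close>
  have gen: "\<forall>q\<in>I. y q g \<in> generate G Y" if "g \<in> generate G S" for g
    using that
  proof (induction rule: generate.induct)
    case one
    show ?case
    proof
      fix q assume "q \<in> I"
      then show "y q \<one>\<^bsub>G\<^esub> \<in> generate G Y" using r[of q] I_sub generate.one[of G Y] by (auto simp: y_def)
    qed
  next
    case (incl h)
    then show ?case by (auto simp: Y_def intro!: generate.incl)
  next
    case (inv h)
    show ?case
    proof
      fix q assume q: "q \<in> I"
      have h: "h \<in> carrier G" using inv S by auto
      define q' where "q' = q \<otimes>\<^bsub>Q\<^esub> \<theta> (inv\<^bsub>G\<^esub> h)"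
      have q': "q' \<in> I" using I_mult[OF q, of "inv\<^bsub>G\<^esub> h"] h by (simp add: q'_def)
      have qq: "q' \<otimes>\<^bsub>Q\<^esub> \<theta> h = q" using q h I_sub by (auto simp: q'_def H.m_assoc)
      have "y q (inv\<^bsub>G\<^esub> h) = inv\<^bsub>G\<^esub> (y q' h)"
        unfolding y_def qq using q q' r[of q] r[of q'] h unfolding q'_def[symmetric]
        by (simp add: G.inv_mult_group G.m_assoc)
      moreover have "y q' h \<in> Y" using q' inv by (auto simp: Y_def)
      ultimately show "y q (inv\<^bsub>G\<^esub> h) \<in> generate G Y" by (simp add: generate.inv)
    qed
  next
    case (eng g h)
    have c: "g \<in> carrier G" "h \<in> carrier G" using eng S(3) by auto
    show ?case
    proof
      fix q assume q: "q \<in> I"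
      define q' where "q' = q \<otimes>\<^bsub>Q\<^esub> \<theta> g"
      have q': "q' \<in> I" using I_mult[OF q c(1)] by (simp add: q'_def)
      have qq: "q \<otimes>\<^bsub>Q\<^esub> \<theta> (g \<otimes>\<^bsub>G\<^esub> h) = q' \<otimes>\<^bsub>Q\<^esub> \<theta> h" using q c I_sub by (auto simp: q'_def H.m_assoc)
      have "y q (g \<otimes>\<^bsub>G\<^esub> h) = y q g \<otimes>\<^bsub>G\<^esub> y q' h"
        unfolding y_def qq unfolding q'_def[symmetric]
        using r[OF q] r[OF q'] r[OF I_mult[OF q' c(2)]] c by (simp add: G.m_assoc G.inv_solve_left)
      then show "y q (g \<otimes>\<^bsub>G\<^esub> h) \<in> generate G Y" using eng.IH q q' generate.eng by metis
    qed
  qed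
  have "generate G Y = ?U"
  proof
    show "generate G Y \<subseteq> ?U" by (rule G.generate_subgroup_incl[OF YU U])
    show "?U \<subseteq> generate G Y"
    proof
      fix u assume u: "u \<in> ?U"
      then have "u \<in> generate G S" using S(3) by (simp add: kernel_def)
      moreover have "\<one>\<^bsub>Q\<^esub> \<in> I" unfolding I_def by (metis G.one_closed hom_one image_eqI)
      ultimately have "y \<one>\<^bsub>Q\<^esub> u \<in> generate G Y" using gen by blast
      moreover have "y \<one>\<^bsub>Q\<^esub> u = u" using u by (simp add: y_def r_def kernel_def)
      ultimately show "u \<in> generate G Y" by simp
    qed
  qed
  then show ?thesis
    unfolding finitely_generated_def using finY YU G.generate_consistent[OF YU U] by auto
qed

section \<open>Homomorphisms to F and the rank of the quotient by \<open>[G,G]G^p\<close>\<close>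

context prime_coeff
begin

text \<open>Values outside the carrier are set to zero, so that a homomorphism on the carrier is
  exactly one function and the set can be counted.\<close>

definition homs :: "('g, 'b) monoid_scheme \<Rightarrow> ('g \<Rightarrow> 'f) set" where
  "homs G = {\<chi>. (\<forall>x. \<chi> x \<in> F) \<and> (\<forall>x. x \<notin> carrier G \<longrightarrow> \<chi> x = 0) \<and>
     (\<forall>x\<in>carrier G. \<forall>y\<in>carrier G. \<chi> (x \<otimes>\<^bsub>G\<^esub> y) = \<chi> x + \<chi> y)}"

lemma homs_mult: "\<chi> \<in> homs G \<Longrightarrow> x \<in> carrier G \<Longrightarrow> y \<in> carrier G \<Longrightarrow> \<chi> (x \<otimes>\<^bsub>G\<^esub> y) = \<chi> x + \<chi> y"
  by (simp add: homs_def)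

lemma homs_F: "\<chi> \<in> homs G \<Longrightarrow> \<chi> x \<in> F"
  by (simp add: homs_def)

lemma homs_outside: "\<chi> \<in> homs G \<Longrightarrow> x \<notin> carrier G \<Longrightarrow> \<chi> x = 0"
  by (simp add: homs_def)

lemma homs_subgroup: "add_subgroup (homs G)"
proof -
  have "\<chi> - \<psi> \<in> homs G" if "\<chi> \<in> homs G" "\<psi> \<in> homs G" for \<chi> \<psi>
    using that add_subgroup_diff[OF F_subgroup] by (auto simp: homs_def)
  moreover have "0 \<in> homs G" using add_subgroup_zero[OF F_subgroup] by (simp add: homs_def)
  ultimately show ?thesis by (simp add: add_subgroup_def)
qed

lemma sum_p_zero:
  assumes "d \<in> F" shows "(\<Sum>j<p. d) = 0"
  using assms iota_mult_nat[of p] iota_eq_0 by (metis dvd_triv_left rangeE)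

lemma homs_one: assumes "group G" "\<chi> \<in> homs G" shows "\<chi> \<one>\<^bsub>G\<^esub> = 0"
proof -
  interpret group G by fact
  show ?thesis using homs_mult[OF assms(2) one_closed one_closed] by simp
qed

lemma homs_inv: assumes "group G" "\<chi> \<in> homs G" "x \<in> carrier G" shows "\<chi> (inv\<^bsub>G\<^esub> x) = - \<chi> x"
proof -
  interpret group G by fact
  show ?thesis
    using homs_mult[OF assms(2) assms(3) inv_closed[OF assms(3)]] homs_one[OF assms(1,2)] assms(3)
    by (simp add: eq_neg_iff_add_eq_0 add.commute)
qed

lemma homs_pow:
  assumes "group G" "\<chi> \<in> homs G" "x \<in> carrier G" shows "\<chi> (x [^]\<^bsub>G\<^esub> (n::nat)) = (\<Sum>j<n. \<chi> x)"
proof -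
  interpret group G by fact
  show ?thesis
    by (induction n) (use assms in \<open>auto simp: homs_one homs_mult[OF assms(2)]\<close>)
qed

lemma homs_kernel_subgroup:
  assumes "group G" "\<chi> \<in> homs G" shows "subgroup {x\<in>carrier G. \<chi> x = 0} G"
proof -
  interpret group G by fact
  show ?thesis
    by (rule subgroupI) (use homs_one[OF assms] homs_inv[OF assms] homs_mult[OF assms(2)] in \<open>auto intro: one_closed\<close>)
qed

lemma homs_eqI:
  assumes "group G" "\<chi> \<in> homs G" "\<psi> \<in> homs G" "S \<subseteq> carrier G" "generate G S = carrier G"
    "\<And>s. s \<in> S \<Longrightarrow> \<chi> s = \<psi> s"
  shows "\<chi> = \<psi>"
proof -
  interpret group G by fact
  have "\<chi> - \<psi> \<in> homs G" by (rule add_subgroup_diff[OF homs_subgroup assms(2,3)])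
  from homs_kernel_subgroup[OF assms(1) this]
  have "generate G S \<subseteq> {x\<in>carrier G. (\<chi> - \<psi>) x = 0}"
    by (rule generate_subgroup_incl[rotated]) (use assms in auto)
  then have "\<chi> x = \<psi> x" if "x \<in> carrier G" for x using assms(5) that by auto
  then show ?thesis using homs_outside assms(2,3) by (metis ext)
qed

text \<open>In the vector space \<open>V\<close>, written multiplicatively, let \<open>W\<close> be
  the span of the other generators. Every element is a product of some w in \<open>W\<close> and a
  power of \<open>s\<close> whose exponent is unique modulo p; the functional reads off this
  exponent.\<close>

lemma dual_hom:
  assumes V: "comm_group V" and exp: "\<And>x. x \<in> carrier V \<Longrightarrow> x [^]\<^bsub>V\<^esub> p = \<one>\<^bsub>V\<^esub>"
    and S: "S \<subseteq> carrier V" "generate V S = carrier V" and s: "s \<in> S" "s \<notin> generate V (S - {s})"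
  shows "\<exists>\<chi>\<in>homs V. \<chi> s = \<iota> 1 \<and> (\<forall>s'\<in>S - {s}. \<chi> s' = 0)"
proof -
  interpret comm_group V by (fact V)
  define W where "W = generate V (S - {s})"
  have W: "subgroup W V" unfolding W_def using S(1) by (intro generate_is_subgroup) auto
  have Wc: "w \<in> carrier V" if "w \<in> W" for w using W that by (rule subgroup.mem_carrier)
  have sc: "s \<in> carrier V" using s S by auto
  have ex: "\<exists>k::int. \<exists>w\<in>W. v = w \<otimes>\<^bsub>V\<^esub> s [^]\<^bsub>V\<^esub> k" if "v \<in> generate V S" for v
    using that
  proof (induction rule: generate.induct)
    case one
    show ?case by (intro exI[of _ 0] bexI[of _ "\<one>\<^bsub>V\<^esub>"]) (auto simp: subgroup.one_closed[OF W])
  next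
    case (incl h)
    show ?case
    proof (cases "h = s")
      case True
      then show ?thesis
        by (intro exI[of _ 1] bexI[of _ "\<one>\<^bsub>V\<^esub>"]) (use sc in \<open>auto simp: subgroup.one_closed[OF W] int_pow_1\<close>)
    next
      case False
      then have "h \<in> W" using incl by (auto simp: W_def intro: generate.incl)
      then show ?thesis by (intro exI[of _ 0] bexI[of _ h]) (auto simp: Wc)
    qed
  next
    case (inv h)
    show ?case
    proof (cases "h = s")
      case True
      then show ?thesis
        by (intro exI[of _ "-1"] bexI[of _ "\<one>\<^bsub>V\<^esub>"])
          (use sc in \<open>auto simp: subgroup.one_closed[OF W] int_pow_neg int_pow_1\<close>)
    next
      case False
      then have "inv\<^bsub>V\<^esub> h \<in> W" using inv by (auto simp: W_def intro: generate.inv)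
      then show ?thesis by (intro exI[of _ 0] bexI[of _ "inv\<^bsub>V\<^esub> h"]) (auto simp: Wc)
    qed
  next
    case (eng g h)
    then obtain k l w u where *: "w \<in> W" "u \<in> W" "g = w \<otimes>\<^bsub>V\<^esub> s [^]\<^bsub>V\<^esub> (k::int)" "h = u \<otimes>\<^bsub>V\<^esub> s [^]\<^bsub>V\<^esub> (l::int)"
      by blast
    have "g \<otimes>\<^bsub>V\<^esub> h = (w \<otimes>\<^bsub>V\<^esub> u) \<otimes>\<^bsub>V\<^esub> s [^]\<^bsub>V\<^esub> (k + l)"
      using * Wc sc by (simp add: int_pow_mult m_ac)
    then show ?case using subgroup.m_closed[OF W *(1,2)] by blast
  qed
  \<comment> \<open>If p did not divide \<open>j\<close>, some power of \<open>s^j\<close> would be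
    \<open>s\<close> itself, placing \<open>s\<close> in \<open>W\<close>.\<close>
  have mem: "int p dvd j" if "s [^]\<^bsub>V\<^esub> (j::int) \<in> W" for j
  proof (rule ccontr)
    assume "\<not> int p dvd j"
    then have "coprime j (int p)"
      using prime prime_imp_coprime[of "int p" j] by (simp add: coprime_commute)
    then obtain m where m: "[j * m = 1] (mod int p)" using cong_solve_coprime_int by blast
    then obtain l where l: "j * m = 1 + int p * l"
      using cong_iff_lin[of 1 "j * m" "int p"] by (auto simp: cong_sym_eq)
    have "s [^]\<^bsub>V\<^esub> (int p * l) = \<one>\<^bsub>V\<^esub>"
      using exp[OF sc] sc by (simp add: int_pow_pow[symmetric] int_pow_int)
    then have "s [^]\<^bsub>V\<^esub> (j * m) = s" unfolding l using sc by (simp add: int_pow_mult int_pow_1)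
    moreover have "s [^]\<^bsub>V\<^esub> (j * m) \<in> W"
      using subgroup_int_pow_closed[OF W that, of m] sc by (simp add: int_pow_pow)
    ultimately show False using s by (simp add: W_def)
  qed
  have uniq: "\<iota> k = \<iota> l" if "w \<in> W" "u \<in> W" "w \<otimes>\<^bsub>V\<^esub> s [^]\<^bsub>V\<^esub> (k::int) = u \<otimes>\<^bsub>V\<^esub> s [^]\<^bsub>V\<^esub> (l::int)" for w u k l
  proof -
    have "s [^]\<^bsub>V\<^esub> (k - l) = s [^]\<^bsub>V\<^esub> k \<otimes>\<^bsub>V\<^esub> inv\<^bsub>V\<^esub> (s [^]\<^bsub>V\<^esub> l)" using sc by (simp add: int_pow_diff)
    also have "\<dots> = inv\<^bsub>V\<^esub> w \<otimes>\<^bsub>V\<^esub> (w \<otimes>\<^bsub>V\<^esub> s [^]\<^bsub>V\<^esub> k) \<otimes>\<^bsub>V\<^esub> inv\<^bsub>V\<^esub> (s [^]\<^bsub>V\<^esub> l)"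
      using sc Wc[OF that(1)] by (simp flip: m_assoc)
    also have "\<dots> = inv\<^bsub>V\<^esub> w \<otimes>\<^bsub>V\<^esub> u"
      unfolding that(3) using sc Wc[OF that(1)] Wc[OF that(2)] by (simp add: m_assoc)
    finally have "s [^]\<^bsub>V\<^esub> (k - l) \<in> W"
      using subgroup.m_closed[OF W subgroup.m_inv_closed[OF W that(1)] that(2)] by simp
    then show ?thesis using mem iota_eq_iff by blast
  qed
  define \<chi> where "\<chi> v = (if v \<in> carrier V then \<iota> (SOME k. \<exists>w\<in>W. v = w \<otimes>\<^bsub>V\<^esub> s [^]\<^bsub>V\<^esub> (k::int)) else 0)" for v
  have \<chi>: "\<chi> (w \<otimes>\<^bsub>V\<^esub> s [^]\<^bsub>V\<^esub> (k::int)) = \<iota> k" if w: "w \<in> W" for w k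
  proof -
    let ?P = "\<lambda>l::int. \<exists>u\<in>W. w \<otimes>\<^bsub>V\<^esub> s [^]\<^bsub>V\<^esub> k = u \<otimes>\<^bsub>V\<^esub> s [^]\<^bsub>V\<^esub> l"
    have "?P (SOME l. ?P l)" by (rule someI[of ?P k]) (use w in blast)
    then obtain u where "u \<in> W" "w \<otimes>\<^bsub>V\<^esub> s [^]\<^bsub>V\<^esub> k = u \<otimes>\<^bsub>V\<^esub> s [^]\<^bsub>V\<^esub> (SOME l. ?P l)" by blast
    from uniq[OF w this] show ?thesis using Wc[OF w] sc by (simp add: \<chi>_def)
  qed
  have "\<chi> \<in> homs V"
    unfolding homs_def
  proof (intro CollectI conjI allI ballI impI)
    show "\<chi> x \<in> F" for x using add_subgroup_zero[OF F_subgroup] by (simp add: \<chi>_def)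
    show "\<chi> x = 0" if "x \<notin> carrier V" for x using that by (simp add: \<chi>_def)
    fix g h assume "g \<in> carrier V" "h \<in> carrier V"
    then obtain k l w u where *: "w \<in> W" "u \<in> W" "g = w \<otimes>\<^bsub>V\<^esub> s [^]\<^bsub>V\<^esub> (k::int)" "h = u \<otimes>\<^bsub>V\<^esub> s [^]\<^bsub>V\<^esub> (l::int)"
      using ex S(2) by metis
    have "g \<otimes>\<^bsub>V\<^esub> h = (w \<otimes>\<^bsub>V\<^esub> u) \<otimes>\<^bsub>V\<^esub> s [^]\<^bsub>V\<^esub> (k + l)"
      using * Wc sc by (simp add: int_pow_mult m_ac)
    then show "\<chi> (g \<otimes>\<^bsub>V\<^esub> h) = \<chi> g + \<chi> h"
      using \<chi>[OF subgroup.m_closed[OF W *(1,2)], of "k + l"] \<chi>[OF *(1), of k] \<chi>[OF *(2), of l] *(3,4)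
      by (simp add: iota_add)
  qed
  moreover have "\<chi> s = \<iota> 1"
    using \<chi>[OF subgroup.one_closed[OF W], of 1] sc by (simp add: int_pow_1)
  moreover have "\<chi> s' = 0" if "s' \<in> S - {s}" for s'
  proof -
    have "s' \<in> W" using that by (simp add: W_def generate.incl)
    then show ?thesis using \<chi>[of s' 0] Wc by (simp add: iota_0)
  qed
  ultimately show ?thesis by blast
qed

text \<open>A generating set of least size is a basis, because a generator in the span of the others
  could be dropped. The dual functionals then identify the homomorphisms with the F-valued functions
  on that set.\<close>

lemma card_homs_elementary_abelian:
  assumes V: "comm_group V" and exp: "\<And>x. x \<in> carrier V \<Longrightarrow> x [^]\<^bsub>V\<^esub> p = \<one>\<^bsub>V\<^esub>"
    and fg: "finitely_generated V"
  shows "card (homs V) = p ^ min_generators V"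
proof -
  interpret comm_group V by (fact V)
  let ?P = "\<lambda>n. \<exists>S. finite S \<and> card S = n \<and> S \<subseteq> carrier V \<and> generate V S = carrier V"
  have "\<exists>n. ?P n" using fg by (auto simp: finitely_generated_def)
  from LeastI_ex[OF this] obtain S where S: "finite S" "card S = min_generators V" "S \<subseteq> carrier V"
    "generate V S = carrier V" unfolding min_generators_def by blast
  have min: "min_generators V \<le> card S'" if "finite S'" "S' \<subseteq> carrier V" "generate V S' = carrier V" for S'
    unfolding min_generators_def using that by (intro Least_le) auto
  have "s \<notin> generate V (S - {s})" if s: "s \<in> S" for s
  proof
    assume *: "s \<in> generate V (S - {s})"
    have sub: "subgroup (generate V (S - {s})) V" using S(3) by (intro generate_is_subgroup) auto
    have "S \<subseteq> generate V (S - {s})"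
    proof
      fix x assume "x \<in> S"
      then show "x \<in> generate V (S - {s})" using * by (cases "x = s") (auto intro: generate.incl)
    qed
    then have "generate V (S - {s}) = carrier V"
      using generate_subgroup_incl[OF _ sub] S(4) subgroup.subset[OF sub] by blast
    then have "card S \<le> card (S - {s})" using min[of "S - {s}"] S by auto
    then show False using card_Diff1_less[OF S(1) s] by simp
  qed
  then have "\<forall>s\<in>S. \<exists>\<chi>. \<chi> \<in> homs V \<and> \<chi> s = \<iota> 1 \<and> (\<forall>s'\<in>S - {s}. \<chi> s' = 0)"
    using dual_hom[OF V exp S(3,4)] by blast
  then obtain D where D: "\<forall>s\<in>S. D s \<in> homs V \<and> D s s = \<iota> 1 \<and> (\<forall>s'\<in>S - {s}. D s s' = 0)" by metis
  have "bij_betw (\<lambda>v. restrict v S) (homs V) (PiE S (\<lambda>_. F))"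
  proof (rule bij_betwI')
    fix u v assume uv: "u \<in> homs V" "v \<in> homs V"
    show "(restrict u S = restrict v S) = (u = v)"
    proof
      assume eq: "restrict u S = restrict v S"
      have "u s = v s" if "s \<in> S" for s using fun_cong[OF eq, of s] that by simp
      then show "u = v" by (rule homs_eqI[OF group_axioms uv S(3,4)])
    next
      assume "u = v"
      then show "restrict u S = restrict v S" by (simp only:)
    qed
  next
    fix v assume "v \<in> homs V"
    then show "restrict v S \<in> PiE S (\<lambda>_. F)" by (intro restrict_PiE_iff[THEN iffD2] ballI homs_F)
  next
    fix f assume f: "f \<in> PiE S (\<lambda>_. F)"
    have "\<exists>n::nat. f s = \<iota> (int n)" if "s \<in> S" for s
    proof -
      have "f s \<in> \<iota> ` {0..<int p}" using PiE_mem[OF f that] F_image by simp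
      then obtain k where "k \<ge> 0" "f s = \<iota> k" by auto
      then show ?thesis by (intro exI[of _ "nat k"]) simp
    qed
    then obtain n where n: "\<And>s. s \<in> S \<Longrightarrow> f s = \<iota> (int (n s))" by metis
    \<comment> \<open>Scalar multiplication is only available as repeated addition, so the
      coefficient of \<open>D s\<close> is a natural number representing \<open>f s\<close>.\<close>
    define \<chi> where "\<chi> = (\<Sum>s\<in>S. \<Sum>j<n s. D s)"
    have "\<chi> \<in> homs V" unfolding \<chi>_def using D by (intro add_subgroup_sum homs_subgroup) blast
    moreover have "f s = restrict \<chi> S s" for s
    proof (cases "s \<in> S")
      case True
      note s = this
      have "\<chi> s = (\<Sum>s'\<in>S. \<Sum>j<n s'. D s' s)" by (simp add: \<chi>_def sum_fun_apply)
      also have "\<dots> = (\<Sum>s'\<in>S. if s' = s then f s else 0)"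
      proof (rule sum.cong[OF HOL.refl])
        fix s' assume s': "s' \<in> S"
        show "(\<Sum>j<n s'. D s' s) = (if s' = s then f s else 0)"
        proof (cases "s' = s")
          case True
          then show ?thesis using D s iota_mult_nat[of "n s" 1] n[OF s] by simp
        next
          case False
          then have "D s' s = 0" using D s s' by auto
          then show ?thesis using False by simp
        qed
      qed
      finally show "f s = restrict \<chi> S s" using S(1) s by simp
    next
      case False
      then show ?thesis using PiE_arb[OF f] by simp
    qed
    then have "f = restrict \<chi> S" by (rule ext)
    ultimately show "\<exists>v\<in>homs V. f = restrict v S" by blast
  qed
  then have "card (homs V) = card (PiE S (\<lambda>_. F))" by (rule bij_betw_same_card)
  then show ?thesis using S card_PiE[OF S(1), of "\<lambda>_. F"] by (simp add: card_F)
qed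

lemma homs_p_derived:
  assumes G: "group G" and \<chi>: "\<chi> \<in> homs G" and x: "x \<in> p_derived p G"
  shows "\<chi> x = 0"
proof -
  interpret group G by (fact G)
  let ?Z = "{x\<in>carrier G. \<chi> x = 0}"
  have Z: "subgroup ?Z G" by (rule homs_kernel_subgroup[OF G \<chi>])
  have "derived G (carrier G) \<subseteq> ?Z"
    unfolding derived_def
    by (rule generate_subgroup_incl[OF _ Z]) (auto simp: homs_mult[OF \<chi>] homs_inv[OF G \<chi>])
  moreover have "generate G {x [^]\<^bsub>G\<^esub> p | x. x \<in> carrier G} \<subseteq> ?Z"
    by (rule generate_subgroup_incl[OF _ Z])
      (auto simp: homs_pow[OF G \<chi>] sum_p_zero[OF homs_F[OF \<chi>]] simp del: sum_constant)
  moreover obtain d q where "d \<in> derived G (carrier G)" "q \<in> generate G {x [^]\<^bsub>G\<^esub> p | x. x \<in> carrier G}"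
    "x = d \<otimes>\<^bsub>G\<^esub> q" using x by (auto simp: p_derived_def set_mult_def)
  ultimately have "d \<in> ?Z" "q \<in> ?Z" "x = d \<otimes>\<^bsub>G\<^esub> q" by blast+
  then show ?thesis using homs_mult[OF \<chi>, of d q] by simp
qed

lemma p_derived_normal:
  assumes "group G" shows "p_derived p G \<lhd> G"
proof -
  interpret group G by (fact assms)
  have "generate G {x [^]\<^bsub>G\<^esub> p | x. x \<in> carrier G} \<lhd> G"
  proof (rule normal_generateI)
    fix h g assume "h \<in> {x [^]\<^bsub>G\<^esub> p | x. x \<in> carrier G}" and g: "g \<in> carrier G"
    then obtain x where x: "x \<in> carrier G" "h = x [^]\<^bsub>G\<^esub> p" by auto
    have "g \<otimes>\<^bsub>G\<^esub> x [^]\<^bsub>G\<^esub> n \<otimes>\<^bsub>G\<^esub> inv\<^bsub>G\<^esub> g = (g \<otimes>\<^bsub>G\<^esub> x \<otimes>\<^bsub>G\<^esub> inv\<^bsub>G\<^esub> g) [^]\<^bsub>G\<^esub> n" for n :: nat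
    proof (induction n)
      case (Suc n)
      have "g \<otimes>\<^bsub>G\<^esub> x [^]\<^bsub>G\<^esub> Suc n \<otimes>\<^bsub>G\<^esub> inv\<^bsub>G\<^esub> g
          = (g \<otimes>\<^bsub>G\<^esub> x [^]\<^bsub>G\<^esub> n \<otimes>\<^bsub>G\<^esub> inv\<^bsub>G\<^esub> g) \<otimes>\<^bsub>G\<^esub> (g \<otimes>\<^bsub>G\<^esub> x \<otimes>\<^bsub>G\<^esub> inv\<^bsub>G\<^esub> g)"
        using g x by (simp add: m_assoc inv_solve_left)
      then show ?case using Suc by simp
    qed (use g in simp)
    then show "g \<otimes>\<^bsub>G\<^esub> h \<otimes>\<^bsub>G\<^esub> inv\<^bsub>G\<^esub> g \<in> {x [^]\<^bsub>G\<^esub> p | x. x \<in> carrier G}"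
      using g x by (auto intro!: exI[of _ "g \<otimes>\<^bsub>G\<^esub> x \<otimes>\<^bsub>G\<^esub> inv\<^bsub>G\<^esub> g"])
  qed auto
  then show ?thesis
    unfolding p_derived_def by (rule normal_subgroup_set_mult_closed[OF derived_self_is_normal])
qed

text \<open>A homomorphism into F kills commutators and p-th powers, so it factors uniquely through
  the elementary abelian quotient.\<close>

lemma card_homs:
  assumes G: "group G" and fg: "finitely_generated G"
  shows "card (homs G) = p ^ d_p p G"
proof -
  interpret group G by (fact G)
  define N where "N = p_derived p G"
  interpret N: normal N G unfolding N_def by (rule p_derived_normal[OF G])
  define V where "V = G Mod N"
  have VG: "group V" unfolding V_def by (rule N.factorgroup_is_group)
  have derN: "x \<in> N" if "x \<in> derived G (carrier G)" for x
    unfolding N_def p_derived_def set_mult_def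
    using that generate.one[of G] subgroup.mem_carrier[OF derived_is_subgroup[OF subset_refl]] by force
  have powN: "x [^]\<^bsub>G\<^esub> p \<in> N" if "x \<in> carrier G" for x
  proof -
    have "\<one>\<^bsub>G\<^esub> \<otimes>\<^bsub>G\<^esub> x [^]\<^bsub>G\<^esub> p \<in> N"
      unfolding N_def p_derived_def set_mult_def
      using that subgroup.one_closed[OF derived_is_subgroup[OF subset_refl]]
        generate.incl[of "x [^]\<^bsub>G\<^esub> p" "{x [^]\<^bsub>G\<^esub> p | x. x \<in> carrier G}" G] by blast
    then show ?thesis using that by simp
  qed
  have cV: "carrier V = (\<lambda>x. N #>\<^bsub>G\<^esub> x) ` carrier G" by (simp add: V_def carrier_FactGroup)
  have mV: "(N #>\<^bsub>G\<^esub> x) \<otimes>\<^bsub>V\<^esub> (N #>\<^bsub>G\<^esub> y) = N #>\<^bsub>G\<^esub> (x \<otimes>\<^bsub>G\<^esub> y)" if "x \<in> carrier G" "y \<in> carrier G" for x y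
    using that by (simp add: V_def N.rcos_sum)
  have "comm_group V"
  proof (rule group.group_comm_groupI[OF VG])
    fix a b assume "a \<in> carrier V" "b \<in> carrier V"
    then obtain x y where xy: "x \<in> carrier G" "y \<in> carrier G" "a = N #>\<^bsub>G\<^esub> x" "b = N #>\<^bsub>G\<^esub> y" by (auto simp: cV)
    have "x \<otimes>\<^bsub>G\<^esub> y \<otimes>\<^bsub>G\<^esub> inv\<^bsub>G\<^esub> (y \<otimes>\<^bsub>G\<^esub> x) = x \<otimes>\<^bsub>G\<^esub> y \<otimes>\<^bsub>G\<^esub> inv\<^bsub>G\<^esub> x \<otimes>\<^bsub>G\<^esub> inv\<^bsub>G\<^esub> y"
      using xy by (simp add: inv_mult_group m_assoc)
    also have "\<dots> \<in> derived G (carrier G)" unfolding derived_def using xy by (intro generate.incl) auto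
    finally have "N #>\<^bsub>G\<^esub> (x \<otimes>\<^bsub>G\<^esub> y) = N #>\<^bsub>G\<^esub> (y \<otimes>\<^bsub>G\<^esub> x)"
      using xy derN by (intro rcos_eqI N.subgroup_axioms) auto
    then show "a \<otimes>\<^bsub>V\<^esub> b = b \<otimes>\<^bsub>V\<^esub> a" using xy mV by simp
  qed
  moreover have "a [^]\<^bsub>V\<^esub> p = \<one>\<^bsub>V\<^esub>" if a: "a \<in> carrier V" for a
  proof -
    obtain x where x: "x \<in> carrier G" "a = N #>\<^bsub>G\<^esub> x" using a by (auto simp: cV)
    then have "a [^]\<^bsub>V\<^esub> p = N #>\<^bsub>G\<^esub> (x [^]\<^bsub>G\<^esub> p)" by (simp add: V_def N.FactGroup_pow)
    also have "\<dots> = N" using powN[OF x(1)] x by (intro coset_join2 N.subgroup_axioms) auto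
    finally show ?thesis by (simp add: V_def)
  qed
  moreover have "finitely_generated V"
  proof -
    obtain S where S: "finite S" "S \<subseteq> carrier G" "generate G S = carrier G"
      using fg by (auto simp: finitely_generated_def)
    interpret h: group_hom G V "\<lambda>x. N #>\<^bsub>G\<^esub> x"
      using G VG N.r_coset_hom_Mod by (simp add: group_hom_def group_hom_axioms_def V_def)
    show ?thesis unfolding finitely_generated_def
      using S h.generate_img[OF S(2)] cV by (intro exI[of _ "(\<lambda>x. N #>\<^bsub>G\<^esub> x) ` S"]) auto
  qed
  ultimately have "card (homs V) = p ^ d_p p G"
    using card_homs_elementary_abelian[of V] by (simp add: d_p_def V_def N_def)
  moreover have "bij_betw (\<lambda>\<chi> x. if x \<in> carrier G then \<chi> (N #>\<^bsub>G\<^esub> x) else 0) (homs V) (homs G)"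
  proof (rule bij_betwI')
    fix \<chi> \<psi> assume *: "\<chi> \<in> homs V" "\<psi> \<in> homs V"
    show "((\<lambda>x. if x \<in> carrier G then \<chi> (N #>\<^bsub>G\<^esub> x) else 0) = (\<lambda>x. if x \<in> carrier G then \<psi> (N #>\<^bsub>G\<^esub> x) else 0)) = (\<chi> = \<psi>)"
      (is "(?l = ?r) = _")
    proof
      assume eq: "?l = ?r"
      have "\<chi> a = \<psi> a" for a
      proof (cases "a \<in> carrier V")
        case True
        then obtain x where x: "x \<in> carrier G" "a = N #>\<^bsub>G\<^esub> x" by (auto simp: cV)
        then show ?thesis using fun_cong[OF eq, of x] by simp
      next
        case False
        then show ?thesis using * homs_outside by metis
      qed
      then show "\<chi> = \<psi>" by (rule ext)
    next
      assume "\<chi> = \<psi>"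
      then show "?l = ?r" by (simp only:)
    qed
  next
    fix \<chi> assume "\<chi> \<in> homs V"
    then show "(\<lambda>x. if x \<in> carrier G then \<chi> (N #>\<^bsub>G\<^esub> x) else 0) \<in> homs G"
      using add_subgroup_zero[OF F_subgroup] mV[symmetric] by (auto simp: homs_def cV)
  next
    fix \<psi> assume \<psi>: "\<psi> \<in> homs G"
    have wd: "\<psi> x = \<psi> y" if "x \<in> carrier G" "y \<in> carrier G" "N #>\<^bsub>G\<^esub> x = N #>\<^bsub>G\<^esub> y" for x y
    proof -
      have "x \<in> N #>\<^bsub>G\<^esub> y" using rcos_self[OF that(1) N.subgroup_axioms] that(3) by simp
      then obtain n where n: "n \<in> N" "x = n \<otimes>\<^bsub>G\<^esub> y" by (auto simp: r_coset_def)
      then show ?thesis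
        using homs_mult[OF \<psi>, of n y] homs_p_derived[OF G \<psi>, of n] that by (simp add: N_def[symmetric])
    qed
    obtain \<chi>0 where \<chi>0: "\<And>x. x \<in> carrier G \<Longrightarrow> \<psi> x = \<chi>0 (N #>\<^bsub>G\<^esub> x)"
      using function_factors_left_gen[of "\<lambda>x. x \<in> carrier G" "\<lambda>x. N #>\<^bsub>G\<^esub> x" \<psi>] wd by metis
    define \<chi> where "\<chi> a = (if a \<in> carrier V then \<chi>0 a else 0)" for a
    have \<chi>: "\<chi> (N #>\<^bsub>G\<^esub> x) = \<psi> x" if "x \<in> carrier G" for x
      using that \<chi>0 by (simp add: \<chi>_def cV)
    have "\<chi> \<in> homs V"
      unfolding homs_def
    proof (intro CollectI conjI allI ballI impI)
      show "\<chi> a \<in> F" for a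
      proof (cases "a \<in> carrier V")
        case True
        then obtain x where x: "x \<in> carrier G" "a = N #>\<^bsub>G\<^esub> x" by (auto simp: cV)
        then show ?thesis using \<chi> homs_F[OF \<psi>] by simp
      next
        case False
        then show ?thesis using add_subgroup_zero[OF F_subgroup] by (simp add: \<chi>_def)
      qed
      show "\<chi> a = 0" if "a \<notin> carrier V" for a using that by (simp add: \<chi>_def)
      fix a b assume "a \<in> carrier V" "b \<in> carrier V"
      then obtain x y where xy: "x \<in> carrier G" "y \<in> carrier G" "a = N #>\<^bsub>G\<^esub> x" "b = N #>\<^bsub>G\<^esub> y" by (auto simp: cV)
      then show "\<chi> (a \<otimes>\<^bsub>V\<^esub> b) = \<chi> a + \<chi> b" using \<chi> mV homs_mult[OF \<psi>] by simp
    qed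
    moreover have "\<psi> = (\<lambda>x. if x \<in> carrier G then \<chi> (N #>\<^bsub>G\<^esub> x) else 0)"
      using \<chi> homs_outside[OF \<psi>] by auto
    ultimately show "\<exists>\<chi>\<in>homs V. \<psi> = (\<lambda>x. if x \<in> carrier G then \<chi> (N #>\<^bsub>G\<^esub> x) else 0)" by blast
  qed
  ultimately show ?thesis using bij_betw_same_card by fastforce
qed

end

section \<open>Cocycles of finite quotients\<close>

lemma (in group) inv_mult_cancel:
  assumes "x \<in> carrier G" "y \<in> carrier G"
  shows "x \<otimes> (inv x \<otimes> y) = y" "inv x \<otimes> (x \<otimes> y) = y"
  using assms by (simp_all flip: m_assoc)

context prime_coeff
begin

text \<open>Crossed homomorphisms from G to the functions on Q, written with two arguments.
  Equivalently, \<open>c (g, x)\<close> labels the arrow from x to \<theta>(g) x in the action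
  groupoid of G on Q, and labels add up along composed arrows. Zero values elsewhere make the set
  countable by cardinality.\<close>

definition cocycles ::
  "('g, 'b) monoid_scheme \<Rightarrow> ('q, 'c) monoid_scheme \<Rightarrow> ('g \<Rightarrow> 'q) \<Rightarrow> ('g \<times> 'q \<Rightarrow> 'f) set" where
  "cocycles G Q \<theta> = {c. (\<forall>y. c y \<in> F) \<and> (\<forall>g x. g \<notin> carrier G \<or> x \<notin> carrier Q \<longrightarrow> c (g, x) = 0) \<and>
     (\<forall>g\<in>carrier G. \<forall>h\<in>carrier G. \<forall>x\<in>carrier Q. c (g \<otimes>\<^bsub>G\<^esub> h, x) = c (g, \<theta> h \<otimes>\<^bsub>Q\<^esub> x) + c (h, x))}"

lemma cocycles_F: "c \<in> cocycles G Q \<theta> \<Longrightarrow> c y \<in> F"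
  unfolding cocycles_def by blast

lemma cocycles_outside: "c \<in> cocycles G Q \<theta> \<Longrightarrow> g \<notin> carrier G \<or> x \<notin> carrier Q \<Longrightarrow> c (g, x) = 0"
  by (simp add: cocycles_def)

lemma cocycles_mult:
  "c \<in> cocycles G Q \<theta> \<Longrightarrow> g \<in> carrier G \<Longrightarrow> h \<in> carrier G \<Longrightarrow> x \<in> carrier Q \<Longrightarrow>
    c (g \<otimes>\<^bsub>G\<^esub> h, x) = c (g, \<theta> h \<otimes>\<^bsub>Q\<^esub> x) + c (h, x)"
  by (simp add: cocycles_def)

lemma zero_F: "0 \<in> F"
  by (rule add_subgroup_zero[OF F_subgroup])

lemma diff_F: "a \<in> F \<Longrightarrow> b \<in> F \<Longrightarrow> a - b \<in> F"
  by (rule add_subgroup_diff[OF F_subgroup])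

lemma add_F: "a \<in> F \<Longrightarrow> b \<in> F \<Longrightarrow> a + b \<in> F"
  by (rule add_subgroup_add[OF F_subgroup])

lemma cocycles_subgroup: "add_subgroup (cocycles G Q \<theta>)"
proof -
  have "c - d \<in> cocycles G Q \<theta>" if "c \<in> cocycles G Q \<theta>" "d \<in> cocycles G Q \<theta>" for c d
    using that diff_F by (auto simp: cocycles_def)
  moreover have "0 \<in> cocycles G Q \<theta>" using zero_F by (simp add: cocycles_def)
  ultimately show ?thesis by (simp add: add_subgroup_def)
qed

lemma cocycles_one:
  assumes "group G" "group Q" "\<theta> \<in> hom G Q" "c \<in> cocycles G Q \<theta>"
  shows "c (\<one>\<^bsub>G\<^esub>, x) = 0"
proof (cases "x \<in> carrier Q")
  case True
  interpret group_hom G Q \<theta> using assms by (simp add: group_hom_def group_hom_axioms_def)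
  show ?thesis using cocycles_mult[OF assms(4) G.one_closed G.one_closed True] True by simp
next
  case False
  then show ?thesis using cocycles_outside[OF assms(4)] by blast
qed

lemma cocycles_inv:
  assumes "group G" "group Q" "\<theta> \<in> hom G Q" "c \<in> cocycles G Q \<theta>" "g \<in> carrier G" "x \<in> carrier Q"
  shows "c (inv\<^bsub>G\<^esub> g, x) = - c (g, inv\<^bsub>Q\<^esub> \<theta> g \<otimes>\<^bsub>Q\<^esub> x)"
proof -
  interpret group_hom G Q \<theta> using assms by (simp add: group_hom_def group_hom_axioms_def)
  have "c (g \<otimes>\<^bsub>G\<^esub> inv\<^bsub>G\<^esub> g, x) = c (g, \<theta> (inv\<^bsub>G\<^esub> g) \<otimes>\<^bsub>Q\<^esub> x) + c (inv\<^bsub>G\<^esub> g, x)"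
    using assms by (intro cocycles_mult) auto
  then show ?thesis
    using assms cocycles_one[OF assms(1-4)] by (simp add: eq_neg_iff_add_eq_0 add.commute)
qed

lemma cocycles_vanish:
  assumes "group G" "group Q" "\<theta> \<in> hom G Q" "c \<in> cocycles G Q \<theta>" "S \<subseteq> carrier G"
    "\<And>s x. s \<in> S \<Longrightarrow> x \<in> carrier Q \<Longrightarrow> c (s, x) = 0" "g \<in> generate G S"
  shows "c (g, x) = 0"
proof (cases "x \<in> carrier Q")
  case True
  interpret group_hom G Q \<theta> using assms by (simp add: group_hom_def group_hom_axioms_def)
  have "\<forall>x\<in>carrier Q. c (g, x) = 0"
    using assms(7)
  proof (induction rule: generate.induct)
    case one
    then show ?case using cocycles_one[OF assms(1-4)] by simp
  next
    case (incl h)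
    then show ?case using assms(6) by simp
  next
    case (inv h)
    then have "h \<in> carrier G" using assms(5) by auto
    then show ?case using inv cocycles_inv[OF assms(1-4)] assms(6) by simp
  next
    case (eng g h)
    then have "g \<in> carrier G" "h \<in> carrier G" using G.generate_in_carrier[OF assms(5)] by auto
    then show ?case using eng cocycles_mult[OF assms(4)] by simp
  qed
  then show ?thesis using True by blast
next
  case False
  then show ?thesis using cocycles_outside[OF assms(4)] by blast
qed

lemma cocycles_eqI:
  assumes "group G" "group Q" "\<theta> \<in> hom G Q" "c \<in> cocycles G Q \<theta>" "d \<in> cocycles G Q \<theta>"
    "S \<subseteq> carrier G" "generate G S = carrier G"
    "\<And>s x. s \<in> S \<Longrightarrow> x \<in> carrier Q \<Longrightarrow> c (s, x) = d (s, x)"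
  shows "c = d"
proof -
  have cd: "c - d \<in> cocycles G Q \<theta>" using add_subgroup_diff[OF cocycles_subgroup] assms by blast
  have "(c - d) (g, x) = 0" for g x
  proof (cases "g \<in> carrier G")
    case True
    then show ?thesis
      using cocycles_vanish[OF assms(1-3) cd assms(6), of g x] assms(7,8) by simp
  next
    case False
    then show ?thesis using cocycles_outside[OF cd] by blast
  qed
  then show ?thesis by (intro ext) auto
qed

lemma finite_cocycles:
  assumes "group G" "group Q" "\<theta> \<in> hom G Q" "finitely_generated G" "finite (carrier Q)"
  shows "finite (cocycles G Q \<theta>)"
proof -
  obtain S where S: "finite S" "S \<subseteq> carrier G" "generate G S = carrier G"
    using assms(4) by (auto simp: finitely_generated_def)
  have "inj_on (\<lambda>c. restrict c (S \<times> carrier Q)) (cocycles G Q \<theta>)"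
  proof (rule inj_onI)
    fix c d assume cd: "c \<in> cocycles G Q \<theta>" "d \<in> cocycles G Q \<theta>"
      and eq: "restrict c (S \<times> carrier Q) = restrict d (S \<times> carrier Q)"
    have "c (s, x) = d (s, x)" if "s \<in> S" "x \<in> carrier Q" for s x
      using fun_cong[OF eq, of "(s, x)"] that by simp
    then show "c = d" by (rule cocycles_eqI[OF assms(1-3) cd S(2,3)])
  qed
  moreover have "(\<lambda>c. restrict c (S \<times> carrier Q)) ` cocycles G Q \<theta> \<subseteq> PiE (S \<times> carrier Q) (\<lambda>_. F)"
    by (intro image_subsetI restrict_PiE_iff[THEN iffD2] ballI cocycles_F)
  moreover have "finite (PiE (S \<times> carrier Q) (\<lambda>_. F))"
    using S(1) assms(5) finite_F by (intro finite_PiE) auto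
  ultimately show ?thesis by (meson finite_imageD finite_subset)
qed

text \<open>Shapiro's lemma, as a count: on each orbit a cocycle is a homomorphism on the stabilizer of the base point
  together with a potential that vanishes at the base point.\<close>

lemma card_cocycles_homs:
  fixes G :: "('g, 'b) monoid_scheme" and Q :: "('h, 'd) monoid_scheme"
  assumes G: "group G" and Q: "group Q" and fin: "finite (carrier Q)" and \<theta>: "\<theta> \<in> hom G Q"
  defines "m \<equiv> card (rcosets\<^bsub>Q\<^esub> (\<theta> ` carrier G))"
  shows "card (cocycles G Q \<theta>) =
    card (homs (G\<lparr>carrier := kernel G Q \<theta>\<rparr>)) ^ m * p ^ (card (carrier Q) - m)"
proof -
  interpret group_hom G Q \<theta> using G Q \<theta> by (simp add: group_hom_def group_hom_axioms_def)
  define I where "I = \<theta> ` carrier G"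
  have I: "subgroup I Q" unfolding I_def by (rule img_is_subgroup)
  define U where "U = kernel G Q \<theta>"
  have U: "u \<in> carrier G" "\<theta> u = \<one>\<^bsub>Q\<^esub>" if "u \<in> U" for u using that by (auto simp: U_def kernel_def)
  \<comment> \<open>The choice depends on the coset only as a set, so \<open>b\<close> picks one
    base point for each orbit of the image.\<close>
  define b where "b x = (SOME y. y \<in> I #>\<^bsub>Q\<^esub> x)" for x
  have b_mem: "b x \<in> I #>\<^bsub>Q\<^esub> x" if "x \<in> carrier Q" for x
    unfolding b_def using H.rcos_self[OF that I] by (rule someI)
  have bc: "b x \<in> carrier Q" if "x \<in> carrier Q" for x
    using b_mem[OF that] H.r_coset_subset_G[OF subgroup.subset[OF I] that] by blast
  have b_coset: "I #>\<^bsub>Q\<^esub> b x = I #>\<^bsub>Q\<^esub> x" if "x \<in> carrier Q" for x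
    using H.repr_independence[OF b_mem[OF that] that I] by simp
  have bb: "b (b x) = b x" if "x \<in> carrier Q" for x
    using b_coset[OF that] by (simp add: b_def)
  have b_act: "b (\<theta> g \<otimes>\<^bsub>Q\<^esub> x) = b x" if "g \<in> carrier G" "x \<in> carrier Q" for g x
  proof -
    have "\<theta> g \<otimes>\<^bsub>Q\<^esub> x \<in> I #>\<^bsub>Q\<^esub> x" using that by (auto simp: I_def r_coset_def)
    then show ?thesis using H.repr_independence[OF _ that(2) I] by (simp add: b_def)
  qed
  define B where "B = b ` carrier Q"
  have Bc: "B \<subseteq> carrier Q" using bc by (auto simp: B_def)
  have bB: "b \<beta> = \<beta>" if "\<beta> \<in> B" for \<beta> using that bb by (auto simp: B_def)
  have cardB: "card B = m"
  proof -
    have "bij_betw (\<lambda>\<beta>. I #>\<^bsub>Q\<^esub> \<beta>) B (rcosets\<^bsub>Q\<^esub> I)"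
    proof (rule bij_betwI')
      fix x y assume "x \<in> B" "y \<in> B"
      then show "(I #>\<^bsub>Q\<^esub> x = I #>\<^bsub>Q\<^esub> y) = (x = y)" using bB by (metis b_def)
    next
      fix x assume "x \<in> B"
      then show "I #>\<^bsub>Q\<^esub> x \<in> rcosets\<^bsub>Q\<^esub> I" using Bc by (auto simp: RCOSETS_def)
    next
      fix C assume "C \<in> rcosets\<^bsub>Q\<^esub> I"
      then obtain x where "x \<in> carrier Q" "C = I #>\<^bsub>Q\<^esub> x" by (auto simp: RCOSETS_def)
      then show "\<exists>\<beta>\<in>B. C = I #>\<^bsub>Q\<^esub> \<beta>" using b_coset by (auto simp: B_def)
    qed
    then show ?thesis unfolding m_def I_def by (rule bij_betw_same_card)
  qed
  \<comment> \<open>\<open>r x\<close> carries the base point to \<open>x\<close>; being the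
    identity at base points, it gives potentials that vanish there.\<close>
  define r where "r x = (if b x = x then \<one>\<^bsub>G\<^esub> else SOME g. g \<in> carrier G \<and> \<theta> g \<otimes>\<^bsub>Q\<^esub> b x = x)" for x
  have r: "r x \<in> carrier G \<and> \<theta> (r x) \<otimes>\<^bsub>Q\<^esub> b x = x" if x: "x \<in> carrier Q" for x
  proof (cases "b x = x")
    case True
    then show ?thesis using x by (simp add: r_def)
  next
    case False
    have "x \<in> I #>\<^bsub>Q\<^esub> b x" using H.rcos_self[OF x I] b_coset[OF x] by simp
    then have "\<exists>g. g \<in> carrier G \<and> \<theta> g \<otimes>\<^bsub>Q\<^esub> b x = x" by (auto simp: I_def r_coset_def)
    from someI_ex[OF this] show ?thesis using False by (simp add: r_def)
  qed
  have rc: "r x \<in> carrier G" and r_act: "\<theta> (r x) \<otimes>\<^bsub>Q\<^esub> b x = x" if "x \<in> carrier Q" for x using r[OF that] by auto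
  have rB: "r \<beta> = \<one>\<^bsub>G\<^esub>" if "\<beta> \<in> B" for \<beta> using bB[OF that] by (simp add: r_def)
  \<comment> \<open>The loop at the base point that goes out to \<open>x\<close>, along
    \<open>g\<close>, and back. It fixes the base point under left translation, and such stabilizers
    are all equal to the kernel.\<close>
  define k where "k g x = inv\<^bsub>G\<^esub> (r (\<theta> g \<otimes>\<^bsub>Q\<^esub> x)) \<otimes>\<^bsub>G\<^esub> g \<otimes>\<^bsub>G\<^esub> r x" for g x
  have kU: "k g x \<in> U" if g: "g \<in> carrier G" and x: "x \<in> carrier Q" for g x
  proof -
    let ?y = "\<theta> g \<otimes>\<^bsub>Q\<^esub> x"
    have y: "?y \<in> carrier Q" using g x by simp
    have "\<theta> (r ?y) \<otimes>\<^bsub>Q\<^esub> b x = \<theta> g \<otimes>\<^bsub>Q\<^esub> (\<theta> (r x) \<otimes>\<^bsub>Q\<^esub> b x)"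
      using r_act[OF y] r_act[OF x] b_act[OF g x] by simp
    then have "\<theta> (r ?y) = \<theta> g \<otimes>\<^bsub>Q\<^esub> \<theta> (r x)"
      using g x rc[OF y] rc[OF x] bc[OF x] by (simp flip: H.m_assoc)
    then have "\<theta> (k g x) = \<one>\<^bsub>Q\<^esub>"
      using g rc[OF y] rc[OF x] x by (simp add: k_def H.m_assoc)
    then show ?thesis using g rc[OF y] rc[OF x] by (simp add: U_def kernel_def k_def)
  qed
  have k_mult: "k (g \<otimes>\<^bsub>G\<^esub> h) x = k g (\<theta> h \<otimes>\<^bsub>Q\<^esub> x) \<otimes>\<^bsub>G\<^esub> k h x"
    if "g \<in> carrier G" "h \<in> carrier G" "x \<in> carrier Q" for g h x
    using that rc[of x] rc[of "\<theta> h \<otimes>\<^bsub>Q\<^esub> x"] rc[of "\<theta> g \<otimes>\<^bsub>Q\<^esub> (\<theta> h \<otimes>\<^bsub>Q\<^esub> x)"]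
    by (simp add: k_def H.m_assoc G.m_assoc G.inv_mult_cancel)
  let ?GU = "G\<lparr>carrier := U\<rparr>"
  define \<Psi> where "\<Psi> c = (\<lambda>\<beta>\<in>B. \<lambda>u. if u \<in> U then c (u, \<beta>) else 0, \<lambda>x\<in>carrier Q - B. c (r x, b x))"
    for c :: "'g \<times> 'h \<Rightarrow> 'f"
  define pot where "pot v x = (if x \<in> B then 0 else v x)" for v :: "'h \<Rightarrow> 'f" and x
  \<comment> \<open>The inverse of \<open>\<Psi>\<close>: the label of an arrow is the difference of
    the potentials at its ends plus the value of the loop that it closes.\<close>
  define \<Xi> where "\<Xi> = (\<lambda>(\<chi>, v). \<lambda>(g, x). if g \<in> carrier G \<and> x \<in> carrier Q
      then pot v (\<theta> g \<otimes>\<^bsub>Q\<^esub> x) + \<chi> (b x) (k g x) - pot v x else 0)"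
  let ?T = "PiE B (\<lambda>_. homs ?GU) \<times> PiE (carrier Q - B) (\<lambda>_. F)"
  have "bij_betw \<Psi> (cocycles G Q \<theta>) ?T"
  proof (rule bij_betw_byWitness[where f' = \<Xi>])
    show "\<forall>c\<in>cocycles G Q \<theta>. \<Xi> (\<Psi> c) = c"
    proof
      fix c assume c: "c \<in> cocycles G Q \<theta>"
      have pot: "pot (\<lambda>x\<in>carrier Q - B. c (r x, b x)) x = c (r x, b x)" if "x \<in> carrier Q" for x
        using that rB cocycles_one[OF G Q \<theta> c] by (simp add: pot_def)
      have "\<Xi> (\<Psi> c) (g, x) = c (g, x)" for g x
      proof (cases "g \<in> carrier G \<and> x \<in> carrier Q")
        case True
        let ?y = "\<theta> g \<otimes>\<^bsub>Q\<^esub> x"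
        have y: "?y \<in> carrier Q" using True by simp
        have kc: "k g x \<in> carrier G" "\<theta> (k g x) = \<one>\<^bsub>Q\<^esub>" using U kU True by auto
        have "c (r ?y \<otimes>\<^bsub>G\<^esub> k g x, b x) = c (r ?y, b x) + c (k g x, b x)"
          using cocycles_mult[OF c rc[OF y] kc(1), of "b x"] kc bc True by simp
        moreover have "r ?y \<otimes>\<^bsub>G\<^esub> k g x = g \<otimes>\<^bsub>G\<^esub> r x"
          using True rc[OF y] rc[of x] by (simp add: k_def flip: G.m_assoc)
        moreover have "c (g \<otimes>\<^bsub>G\<^esub> r x, b x) = c (g, x) + c (r x, b x)"
          using cocycles_mult[OF c, of g "r x" "b x"] True rc[of x] bc[of x] r_act[of x] by simp
        ultimately have "c (r ?y, b x) + c (k g x, b x) - c (r x, b x) = c (g, x)"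
          by (simp add: algebra_simps)
        moreover have "b x \<in> B" using True by (simp add: B_def)
        ultimately show ?thesis
          using True kU pot[of x] pot[OF y] b_act by (simp add: \<Xi>_def \<Psi>_def)
      next
        case False
        then have "c (g, x) = 0" using cocycles_outside[OF c] by blast
        then show ?thesis using False by (auto simp: \<Xi>_def \<Psi>_def)
      qed
      then show "\<Xi> (\<Psi> c) = c" by (intro ext) auto
    qed
    show "\<forall>a\<in>?T. \<Psi> (\<Xi> a) = a"
    proof
      fix a assume "a \<in> ?T"
      then obtain \<chi> v where a: "a = (\<chi>, v)" "\<chi> \<in> PiE B (\<lambda>_. homs ?GU)" "v \<in> PiE (carrier Q - B) (\<lambda>_. F)"
        by blast
      have \<chi>: "\<chi> \<beta> \<in> homs ?GU" if "\<beta> \<in> B" for \<beta> using PiE_mem[OF a(2) that] .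
      have 1: "(\<lambda>\<beta>\<in>B. \<lambda>u. if u \<in> U then \<Xi> a (u, \<beta>) else 0) = \<chi>"
      proof
        fix \<beta>
        show "(\<lambda>\<beta>\<in>B. \<lambda>u. if u \<in> U then \<Xi> a (u, \<beta>) else 0) \<beta> = \<chi> \<beta>"
        proof (cases "\<beta> \<in> B")
          case True
          have "(if u \<in> U then \<Xi> a (u, \<beta>) else 0) = \<chi> \<beta> u" for u
          proof (cases "u \<in> U")
            case uU: True
            have "\<beta> \<in> carrier Q" using True Bc by auto
            then have "k u \<beta> = u" using U[OF uU] rB[OF True] by (simp add: k_def)
            then show ?thesis
              using uU U[OF uU] True \<open>\<beta> \<in> carrier Q\<close> bB[OF True] by (simp add: a(1) \<Xi>_def pot_def)
          next
            case False
            then show ?thesis using homs_outside[OF \<chi>[OF True], of u] by simp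
          qed
          then show ?thesis using True by auto
        next
          case False
          then show ?thesis using PiE_arb[OF a(2) False] by simp
        qed
      qed
      have 2: "(\<lambda>x\<in>carrier Q - B. \<Xi> a (r x, b x)) = v"
      proof
        fix x
        show "(\<lambda>x\<in>carrier Q - B. \<Xi> a (r x, b x)) x = v x"
        proof (cases "x \<in> carrier Q - B")
          case True
          then have x: "x \<in> carrier Q" by auto
          have bxB: "b x \<in> B" using x by (simp add: B_def)
          have "k (r x) (b x) = \<one>\<^bsub>G\<^esub>" using rc[OF x] r_act[OF x] rB[OF bxB] by (simp add: k_def)
          moreover have "\<chi> (b x) \<one>\<^bsub>G\<^esub> = 0"
            using homs_one[OF _ \<chi>[OF bxB]] G.subgroup_imp_group[OF subgroup_kernel] by (simp add: U_def)
          ultimately show ?thesis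
            using True rc[OF x] bc[OF x] r_act[OF x] bxB bB[OF bxB] by (simp add: a(1) \<Xi>_def pot_def)
        next
          case False
          then show ?thesis using PiE_arb[OF a(3) False] by auto
        qed
      qed
      show "\<Psi> (\<Xi> a) = a" unfolding \<Psi>_def 1 2 a(1)[symmetric] using a(1) by simp
    qed
    show "\<Psi> ` cocycles G Q \<theta> \<subseteq> ?T"
    proof (rule image_subsetI)
      fix c assume c: "c \<in> cocycles G Q \<theta>"
      have "(\<lambda>u. if u \<in> U then c (u, \<beta>) else 0) \<in> homs ?GU" if "\<beta> \<in> B" for \<beta>
        unfolding homs_def using U Bc that cocycles_mult[OF c] G.subgroup_imp_group subgroup.m_closed[OF subgroup_kernel]
        by (auto simp: cocycles_F[OF c] zero_F U_def[symmetric])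
      moreover have "c (r x, b x) \<in> F" for x by (rule cocycles_F[OF c])
      ultimately show "\<Psi> c \<in> ?T" by (simp add: \<Psi>_def restrict_PiE_iff)
    qed
    show "\<Xi> ` ?T \<subseteq> cocycles G Q \<theta>"
    proof (rule image_subsetI)
      fix a assume "a \<in> ?T"
      then obtain \<chi> v where a: "a = (\<chi>, v)" "\<chi> \<in> PiE B (\<lambda>_. homs ?GU)" "v \<in> PiE (carrier Q - B) (\<lambda>_. F)"
        by blast
      have bxB: "b x \<in> B" if "x \<in> carrier Q" for x using that by (simp add: B_def)
      have \<chi>: "\<chi> \<beta> \<in> homs ?GU" if "\<beta> \<in> B" for \<beta> using PiE_mem[OF a(2) that] .
      have potF: "pot v x \<in> F" if "x \<in> carrier Q" for x
        using PiE_mem[OF a(3), of x] that zero_F by (simp add: pot_def)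
      show "\<Xi> a \<in> cocycles G Q \<theta>"
        unfolding cocycles_def
      proof (intro CollectI conjI allI ballI impI)
        fix y :: "'g \<times> 'h"
        obtain g x where y: "y = (g, x)" by force
        show "\<Xi> a y \<in> F"
          using potF homs_F[OF \<chi>[OF bxB]] zero_F unfolding y a(1) \<Xi>_def
          by (auto intro!: diff_F add_F)
      next
        fix g x assume "g \<notin> carrier G \<or> x \<notin> carrier Q"
        then show "\<Xi> a (g, x) = 0" by (auto simp: a(1) \<Xi>_def)
      next
        fix g h x assume *: "g \<in> carrier G" "h \<in> carrier G" "x \<in> carrier Q"
        have "\<chi> (b x) (k g (\<theta> h \<otimes>\<^bsub>Q\<^esub> x) \<otimes>\<^bsub>G\<^esub> k h x) = \<chi> (b x) (k g (\<theta> h \<otimes>\<^bsub>Q\<^esub> x)) + \<chi> (b x) (k h x)"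
          using homs_mult[OF \<chi>[OF bxB[OF *(3)]], of "k g (\<theta> h \<otimes>\<^bsub>Q\<^esub> x)" "k h x"] kU * by simp
        then show "\<Xi> a (g \<otimes>\<^bsub>G\<^esub> h, x) = \<Xi> a (g, \<theta> h \<otimes>\<^bsub>Q\<^esub> x) + \<Xi> a (h, x)"
          using * k_mult[OF *] b_act[OF *(2,3)] by (simp add: a(1) \<Xi>_def H.m_assoc)
      qed
    qed
  qed
  then have "card (cocycles G Q \<theta>) = card ?T" by (rule bij_betw_same_card)
  also have "\<dots> = card (homs ?GU) ^ card B * p ^ card (carrier Q - B)"
    using finite_subset[OF Bc fin] fin by (simp add: card_cartesian_product card_PiE card_F)
  also have "card (carrier Q - B) = card (carrier Q) - m"
    using card_Diff_subset[OF finite_subset[OF Bc fin] Bc] cardB by simp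
  finally show ?thesis by (simp add: cardB U_def)
qed

end

lemma (in group_hom) group_index_kernel:
  "group_index G (kernel G H h) = card (h ` carrier G)"
proof -
  have "bij_betw (\<lambda>X. the_elem (h ` X)) (rcosets (kernel G H h)) (h ` carrier G)"
  proof (rule bij_betw_imageI)
    show "inj_on (\<lambda>X. the_elem (h ` X)) (rcosets (kernel G H h))"
      using FactGroup_inj_on by (simp add: FactGroup_def)
    have *: "the_elem (h ` (kernel G H h #> g)) = h g" if "g \<in> carrier G" for g
    proof -
      have "h ` (kernel G H h #> g) = {h g}"
        using that by (auto simp: kernel_def r_coset_def intro!: imageI)
      then show ?thesis by simp
    qed
    show "(\<lambda>X. the_elem (h ` X)) ` (rcosets (kernel G H h)) = h ` carrier G"
      unfolding RCOSETS_def using * by force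
  qed
  then show ?thesis unfolding group_index_def by (rule bij_betw_same_card)
qed

lemma (in group) rcosets_card_mult:
  assumes "finite (carrier G)" "subgroup I G"
  shows "card (rcosets I) * card I = card (carrier G)"
  using lagrange_finite[OF assms] by (simp add: order_def)

section \<open>Gradient quotients as normalised cocycle counts, and their monotonicity\<close>

context prime_coeff
begin

text \<open>If the image I of G has m cosets in Q, the logarithm equals d m + |Q| - m, where |Q| = m
  |I|. Division by |Q| gives (d - 1) / |I| + 1, and |I| is the index of the kernel. Since m cancels,
  the formula serves K and the HNN extension over the same Q.\<close>

lemma log_card_cocycles:
  assumes G: "group G" and Q: "group Q" and fin: "finite (carrier Q)" and \<theta>: "\<theta> \<in> hom G Q"
    and fg: "finitely_generated G"
  defines "U \<equiv> kernel G Q \<theta>"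
  shows "(real (d_p p (G\<lparr>carrier := U\<rparr>)) - 1) / real (group_index G U) =
    log p (card (cocycles G Q \<theta>)) / card (carrier Q) - 1"
proof -
  interpret group_hom G Q \<theta> using G Q \<theta> by (simp add: group_hom_def group_hom_axioms_def)
  let ?I = "\<theta> ` carrier G"
  define m where "m = card (rcosets\<^bsub>Q\<^esub> ?I)"
  have I: "subgroup ?I Q" by (rule img_is_subgroup)
  have mI: "m * card ?I = card (carrier Q)" unfolding m_def by (rule H.rcosets_card_mult[OF fin I])
  have "card (carrier Q) > 0" using fin H.one_closed by (auto simp: card_gt_0_iff)
  then have pos: "m > 0" "card ?I > 0" by (metis mI mult_0 not_gr_zero, metis mI mult_0_right not_gr_zero)
  have gU: "group (G\<lparr>carrier := U\<rparr>)" unfolding U_def by (rule G.subgroup_imp_group[OF subgroup_kernel])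
  define d where "d = d_p p (G\<lparr>carrier := U\<rparr>)"
  have "card (homs (G\<lparr>carrier := U\<rparr>)) = p ^ d"
    unfolding d_def by (rule card_homs[OF gU]) (unfold U_def, rule finitely_generated_kernel[OF G Q fin \<theta> fg])
  then have "card (cocycles G Q \<theta>) = p ^ (d * m + (card (carrier Q) - m))"
    using card_cocycles_homs[OF G Q fin \<theta>] by (simp add: U_def m_def power_mult power_add)
  then have "log p (card (cocycles G Q \<theta>)) = real (d * m + (card (carrier Q) - m))"
    using p_gt_1 by (simp add: log_nat_power)
  also have "\<dots> = real d * real m + real m * real (card ?I) - real m"
    using pos unfolding mI[symmetric] by (subst of_nat_add, subst of_nat_diff) auto
  finally have L: "log p (card (cocycles G Q \<theta>)) = real d * real m + real m * real (card ?I) - real m" .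
  have "log p (card (cocycles G Q \<theta>)) / card (carrier Q) - 1 = (real d - 1) / real (card ?I)"
    unfolding L mI[symmetric] using pos by (simp add: field_simps)
  then show ?thesis unfolding d_def[symmetric] using group_index_kernel by (simp add: U_def)
qed

text \<open>A coefficient module of functions on \<open>Q'\<close> has the functions on the quotient \<open>Q\<close> by a normal \<open>p\<close>-subgroup as
  its fixed points under right translations.\<close>

lemma card_le_quotient:
  fixes V' :: "('l \<times> 'q \<Rightarrow> 'f) set" and V :: "('l \<times> 'r \<Rightarrow> 'f) set"
  assumes Q': "group Q'" and Q: "group Q" and fin: "finite (carrier Q')"
    and r: "r \<in> hom Q' Q" "r ` carrier Q' = carrier Q" and P: "card (kernel Q' Q r) = p ^ k"
    and V': "finite V'" "add_subgroup V'" "\<forall>v\<in>V'. \<forall>y. v y \<in> F"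
      "\<forall>v\<in>V'. \<forall>l x. x \<notin> carrier Q' \<longrightarrow> v (l, x) = 0"
    and V: "finite V"
    and closed: "\<And>v z. v \<in> V' \<Longrightarrow> z \<in> kernel Q' Q r \<Longrightarrow>
      (\<lambda>(l, x). if x \<in> carrier Q' then v (l, x \<otimes>\<^bsub>Q'\<^esub> z) else 0) \<in> V'"
    and descend: "\<And>v \<sigma>. v \<in> V' \<Longrightarrow> (\<And>l x y. x \<in> carrier Q' \<Longrightarrow> y \<in> carrier Q' \<Longrightarrow> r x = r y \<Longrightarrow> v (l, x) = v (l, y)) \<Longrightarrow>
      (\<And>y. y \<in> carrier Q \<Longrightarrow> \<sigma> y \<in> carrier Q' \<and> r (\<sigma> y) = y) \<Longrightarrow>
      (\<lambda>(l, y). if y \<in> carrier Q then v (l, \<sigma> y) else 0) \<in> V"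
  shows "card V' \<le> card V ^ card (kernel Q' Q r)"
proof -
  interpret group_hom Q' Q r using Q' Q r by (simp add: group_hom_def group_hom_axioms_def)
  define N where "N = kernel Q' Q r"
  \<comment> \<open>Only \<open>x\<close> is moved. The label \<open>l\<close> is inert, so that the
    same argument covers cocycles of a group and of an HNN extension.\<close>
  define \<rho> where "\<rho> z v = (\<lambda>(l, x). if x \<in> carrier Q' then v (l, x \<otimes>\<^bsub>Q'\<^esub> z) else 0)"
    for z :: 'q and v :: "'l \<times> 'q \<Rightarrow> 'f"
  have N: "subgroup N Q'" unfolding N_def by (rule subgroup_kernel)
  have Nc: "z \<in> carrier Q'" if "z \<in> N" for z using subgroup.mem_carrier[OF N that] .
  let ?P = "Q'\<lparr>carrier := N\<rparr>"
  let ?X = "{v\<in>V'. \<forall>z\<in>carrier ?P. \<rho> z v = v}"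
  have "card V' \<le> card ?X ^ order ?P"
  proof (rule card_le_fixed_points[where k = k])
    show "group ?P" by (rule G.subgroup_imp_group[OF N])
    show "order ?P = p ^ k" using P by (simp add: order_def N_def)
    show "\<rho> g v \<in> V'" if "g \<in> carrier ?P" "v \<in> V'" for g v
      unfolding \<rho>_def using that(1) by (intro closed[OF that(2)]) (simp add: N_def)
    show "\<rho> (g \<otimes>\<^bsub>?P\<^esub> h) v = \<rho> g (\<rho> h v)" if gh: "g \<in> carrier ?P" "h \<in> carrier ?P" for g h v
    proof -
      have "g \<in> carrier Q'" "h \<in> carrier Q'" using gh Nc by auto
      then show ?thesis unfolding \<rho>_def by (intro ext) (simp add: G.m_assoc split: prod.split)
    qed
    show "\<rho> \<one>\<^bsub>?P\<^esub> v = v" if "v \<in> V'" for v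
    proof
      fix y :: "'l \<times> 'q"
      obtain l x where y: "y = (l, x)" by force
      show "\<rho> \<one>\<^bsub>?P\<^esub> v y = v y"
        using V'(4)[rule_format, OF that, of x l] by (cases "x \<in> carrier Q'") (simp_all add: \<rho>_def y)
    qed
    show "\<rho> g (u - v) = \<rho> g u - \<rho> g v" for g u v
      unfolding \<rho>_def by (intro ext) (simp split: prod.split)
  qed (use V' in auto)
  also have "card ?X \<le> card V"
  proof -
    define \<sigma> where "\<sigma> y = (SOME x. x \<in> carrier Q' \<and> r x = y)" for y
    have \<sigma>: "\<sigma> y \<in> carrier Q' \<and> r (\<sigma> y) = y" if "y \<in> carrier Q" for y
    proof -
      have "y \<in> r ` carrier Q'" unfolding r(2) by (rule that)
      then have "\<exists>x. x \<in> carrier Q' \<and> r x = y" by (elim imageE) metis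
      from someI_ex[OF this] show ?thesis unfolding \<sigma>_def .
    qed
    \<comment> \<open>Two points in a fibre of \<open>r\<close> differ by a right factor in the
      kernel, so a fixed vector is constant on fibres and descends along any section.\<close>
    have inv: "v (l, x) = v (l, y)" if v: "v \<in> ?X" and xy: "x \<in> carrier Q'" "y \<in> carrier Q'" "r x = r y" for v l x y
    proof -
      define z where "z = inv\<^bsub>Q'\<^esub> x \<otimes>\<^bsub>Q'\<^esub> y"
      have z: "z \<in> N" using xy by (simp add: N_def kernel_def z_def)
      have "x \<otimes>\<^bsub>Q'\<^esub> z = y" using xy by (simp add: z_def G.inv_mult_cancel)
      moreover have "\<rho> z v = v" using v z by simp
      then have "\<rho> z v (l, x) = v (l, x)" by simp
      ultimately show ?thesis using xy by (simp add: \<rho>_def)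
    qed
    let ?d = "\<lambda>v. \<lambda>(l, y). if y \<in> carrier Q then v (l, \<sigma> y) else 0"
    have "inj_on ?d ?X"
    proof (rule inj_onI)
      fix v w assume vw: "v \<in> ?X" "w \<in> ?X" "?d v = ?d w"
      have "v (l, x) = w (l, x)" for l x
      proof (cases "x \<in> carrier Q'")
        case True
        then have rx: "r x \<in> carrier Q" by simp
        have "v (l, \<sigma> (r x)) = w (l, \<sigma> (r x))" using fun_cong[OF vw(3), of "(l, r x)"] rx by simp
        then show ?thesis using inv[OF vw(1) True, of "\<sigma> (r x)" l] inv[OF vw(2) True, of "\<sigma> (r x)" l] \<sigma>[OF rx] by simp
      next
        case False
        then have "u (l, x) = 0" if "u \<in> V'" for u using V'(4) that by blast
        from this[of v] this[of w] show ?thesis using vw(1,2) by simp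
      qed
      then show "v = w" by (intro ext) auto
    qed
    moreover have "?d ` ?X \<subseteq> V"
    proof (rule image_subsetI)
      fix v assume v: "v \<in> ?X"
      then have "v \<in> V'" by simp
      then show "?d v \<in> V" using inv[OF v] \<sigma> by (rule descend)
    qed
    ultimately show ?thesis by (rule card_inj_on_le[OF _ _ V])
  qed
  finally show ?thesis by (simp add: order_def N_def power_mono)
qed

lemma cocyclesI:
  assumes "\<And>g x. g \<in> carrier G \<Longrightarrow> x \<in> carrier Q \<Longrightarrow> c (g, x) \<in> F"
    and "\<And>g x. g \<notin> carrier G \<or> x \<notin> carrier Q \<Longrightarrow> c (g, x) = 0"
    and "\<And>g h x. g \<in> carrier G \<Longrightarrow> h \<in> carrier G \<Longrightarrow> x \<in> carrier Q \<Longrightarrow>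
      c (g \<otimes>\<^bsub>G\<^esub> h, x) = c (g, \<theta> h \<otimes>\<^bsub>Q\<^esub> x) + c (h, x)"
  shows "c \<in> cocycles G Q \<theta>"
proof -
  have "c (g, x) \<in> F" for g x
    using assms(1)[of g x] assms(2)[of g x] zero_F by (cases "g \<in> carrier G \<and> x \<in> carrier Q") auto
  then show ?thesis unfolding cocycles_def using assms(2,3) by auto
qed

text \<open>The cocycle identity involves left translations only, so right translation by the kernel
  preserves it, and the invariant cocycles come from Q.\<close>

lemma card_cocycles_quotient:
  assumes G: "group G" and fg: "finitely_generated G"
    and Q': "group Q'" and Q: "group Q" and fin: "finite (carrier Q')"
    and r: "r \<in> hom Q' Q" "r ` carrier Q' = carrier Q" and P: "card (kernel Q' Q r) = p ^ k"
    and \<theta>': "\<theta>' \<in> hom G Q'" and \<theta>: "\<theta> \<in> hom G Q" "\<And>g. g \<in> carrier G \<Longrightarrow> r (\<theta>' g) = \<theta> g"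
  shows "card (cocycles G Q' \<theta>') \<le> card (cocycles G Q \<theta>) ^ card (kernel Q' Q r)"
proof (rule card_le_quotient[OF Q' Q fin r P])
  interpret r: group_hom Q' Q r using Q' Q r by (simp add: group_hom_def group_hom_axioms_def)
  interpret t: group_hom G Q' \<theta>' using Q' G \<theta>' by (simp add: group_hom_def group_hom_axioms_def)
  interpret u: group_hom G Q \<theta> using Q G \<theta> by (simp add: group_hom_def group_hom_axioms_def)
  show "finite (cocycles G Q' \<theta>')" by (rule finite_cocycles[OF G Q' \<theta>' fg fin])
  have "finite (carrier Q)" using fin r(2) by (metis finite_imageI)
  then show "finite (cocycles G Q \<theta>)" by (rule finite_cocycles[OF G Q \<theta>(1) fg])
  show "add_subgroup (cocycles G Q' \<theta>')" by (rule cocycles_subgroup)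
  show "\<forall>v\<in>cocycles G Q' \<theta>'. \<forall>y. v y \<in> F" using cocycles_F by blast
  show "\<forall>v\<in>cocycles G Q' \<theta>'. \<forall>l x. x \<notin> carrier Q' \<longrightarrow> v (l, x) = 0"
    by (intro ballI allI impI cocycles_outside disjI2)
  show "(\<lambda>(l, x). if x \<in> carrier Q' then v (l, x \<otimes>\<^bsub>Q'\<^esub> z) else 0) \<in> cocycles G Q' \<theta>'"
    if v: "v \<in> cocycles G Q' \<theta>'" and z: "z \<in> kernel Q' Q r" for v z
  proof -
    have zc: "z \<in> carrier Q'" using z by (simp add: kernel_def)
    show ?thesis
    proof (rule cocyclesI)
      show "(case (g, x) of (l, x) \<Rightarrow> if x \<in> carrier Q' then v (l, x \<otimes>\<^bsub>Q'\<^esub> z) else 0) = 0"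
        if "g \<notin> carrier G \<or> x \<notin> carrier Q'" for g x
        using that cocycles_outside[OF v, of g "x \<otimes>\<^bsub>Q'\<^esub> z"] by auto
    qed (use zc in \<open>simp_all add: cocycles_F[OF v] cocycles_mult[OF v] r.G.m_assoc\<close>)
  qed
  fix v \<sigma>
  assume v: "v \<in> cocycles G Q' \<theta>'"
    and inv: "\<And>l x y. x \<in> carrier Q' \<Longrightarrow> y \<in> carrier Q' \<Longrightarrow> r x = r y \<Longrightarrow> v (l, x) = v (l, y)"
    and \<sigma>: "\<And>y. y \<in> carrier Q \<Longrightarrow> \<sigma> y \<in> carrier Q' \<and> r (\<sigma> y) = y"
  have "v (g, \<theta>' h \<otimes>\<^bsub>Q'\<^esub> \<sigma> y) = v (g, \<sigma> (\<theta> h \<otimes>\<^bsub>Q\<^esub> y))"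
    if "g \<in> carrier G" "h \<in> carrier G" "y \<in> carrier Q" for g h y
    using that \<sigma>[of y] \<sigma>[of "\<theta> h \<otimes>\<^bsub>Q\<^esub> y"] \<theta>(2)[of h] by (intro inv) auto
  then show "(\<lambda>(l, y). if y \<in> carrier Q then v (l, \<sigma> y) else 0) \<in> cocycles G Q \<theta>"
    using \<sigma> cocycles_outside[OF v]
    by (intro cocyclesI) (auto simp: cocycles_F[OF v] cocycles_mult[OF v])
qed

end

section \<open>Cocycles of HNN extensions\<close>

context prime_coeff
begin

text \<open>Cocycles of the HNN extension with values in functions on \<open>Q\<close>, given by their restriction to the base group
  (at \<open>Some\<close>) and their value on the stable letter (at \<open>None\<close>), with the HNN relation only imposed for elements
  of \<open>S\<close>.\<close>

definition hcocycles ::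
  "('g, 'b) monoid_scheme \<Rightarrow> 'g set \<Rightarrow> ('g \<Rightarrow> 'g) \<Rightarrow> ('q, 'c) monoid_scheme \<Rightarrow> ('g \<Rightarrow> 'q) \<Rightarrow> 'q \<Rightarrow>
    ('g option \<times> 'q \<Rightarrow> 'f) set" where
  "hcocycles K S \<phi> Q \<theta> t = {c. (\<lambda>(g, x). c (Some g, x)) \<in> cocycles K Q \<theta> \<and>
     (\<forall>x. c (None, x) \<in> F) \<and> (\<forall>x. x \<notin> carrier Q \<longrightarrow> c (None, x) = 0) \<and>
     (\<forall>a\<in>S. \<forall>x\<in>carrier Q. c (None, \<theta> a \<otimes>\<^bsub>Q\<^esub> x) + c (Some a, x) - c (None, x) = c (Some (\<phi> a), t \<otimes>\<^bsub>Q\<^esub> x))}"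

lemma hcocyclesD:
  assumes "c \<in> hcocycles K S \<phi> Q \<theta> t"
  shows "(\<lambda>(g, x). c (Some g, x)) \<in> cocycles K Q \<theta>" "c (None, x) \<in> F" "x \<notin> carrier Q \<Longrightarrow> c (None, x) = 0"
    "a \<in> S \<Longrightarrow> x \<in> carrier Q \<Longrightarrow>
      c (None, \<theta> a \<otimes>\<^bsub>Q\<^esub> x) + c (Some a, x) - c (None, x) = c (Some (\<phi> a), t \<otimes>\<^bsub>Q\<^esub> x)"
  using assms unfolding hcocycles_def by blast+

lemma hcocyclesI:
  assumes "(\<lambda>(g, x). c (Some g, x)) \<in> cocycles K Q \<theta>" "\<And>x. c (None, x) \<in> F"
    "\<And>x. x \<notin> carrier Q \<Longrightarrow> c (None, x) = 0"
    "\<And>a x. a \<in> S \<Longrightarrow> x \<in> carrier Q \<Longrightarrow>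
      c (None, \<theta> a \<otimes>\<^bsub>Q\<^esub> x) + c (Some a, x) - c (None, x) = c (Some (\<phi> a), t \<otimes>\<^bsub>Q\<^esub> x)"
  shows "c \<in> hcocycles K S \<phi> Q \<theta> t"
  unfolding hcocycles_def using assms by (simp only: mem_Collect_eq simp_thms ball_simps) simp

lemma hcocycles_F: assumes "c \<in> hcocycles K S \<phi> Q \<theta> t" shows "c y \<in> F"
proof -
  obtain l x where y: "y = (l, x)" by force
  show ?thesis
    using cocycles_F[OF hcocyclesD(1)[OF assms], of "(the l, x)"] hcocyclesD(2)[OF assms]
    by (cases l) (auto simp: y)
qed

lemma hcocycles_outside:
  assumes "c \<in> hcocycles K S \<phi> Q \<theta> t" "x \<notin> carrier Q" shows "c (l, x) = 0"
  using cocycles_outside[OF hcocyclesD(1)[OF assms(1)], of "the l" x] hcocyclesD(3)[OF assms] assms(2)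
  by (cases l) auto

lemma hcocycles_mono: "S \<subseteq> S' \<Longrightarrow> hcocycles K S' \<phi> Q \<theta> t \<subseteq> hcocycles K S \<phi> Q \<theta> t"
  unfolding hcocycles_def by blast

lemma hcocycles_subgroup:
  fixes K :: "('g, 'b) monoid_scheme" and Q :: "('q, 'c) monoid_scheme"
  shows "add_subgroup (hcocycles K S \<phi> Q \<theta> t)"
  unfolding add_subgroup_def
proof (intro conjI ballI)
  have "(\<lambda>(g, x). (0 :: 'g option \<times> 'q \<Rightarrow> 'f) (Some g, x)) = 0" by (simp add: fun_eq_iff)
  also have "\<dots> \<in> cocycles K Q \<theta>" by (rule add_subgroup_zero[OF cocycles_subgroup])
  finally show "0 \<in> hcocycles K S \<phi> Q \<theta> t"
    using zero_F by (simp add: hcocycles_def)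
next
  fix u v assume uv: "u \<in> hcocycles K S \<phi> Q \<theta> t" "v \<in> hcocycles K S \<phi> Q \<theta> t"
  have "(\<lambda>(g, x). (u - v) (Some g, x)) = (\<lambda>(g, x). u (Some g, x)) - (\<lambda>(g, x). v (Some g, x))"
    by (simp add: fun_eq_iff)
  also have "\<dots> \<in> cocycles K Q \<theta>"
    by (rule add_subgroup_diff[OF cocycles_subgroup hcocyclesD(1)[OF uv(1)] hcocyclesD(1)[OF uv(2)]])
  finally have "(\<lambda>(g, x). (u - v) (Some g, x)) \<in> cocycles K Q \<theta>" .
  moreover have "(u - v) (None, x) \<in> F" for x
    using diff_F[OF hcocyclesD(2)[OF uv(1)] hcocyclesD(2)[OF uv(2)]] by simp
  moreover have "(u - v) (None, x) = 0" if "x \<notin> carrier Q" for x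
    using hcocyclesD(3)[OF uv(1) that] hcocyclesD(3)[OF uv(2) that] by simp
  moreover have "(u - v) (None, \<theta> a \<otimes>\<^bsub>Q\<^esub> x) + (u - v) (Some a, x) - (u - v) (None, x) = (u - v) (Some (\<phi> a), t \<otimes>\<^bsub>Q\<^esub> x)"
    if "a \<in> S" "x \<in> carrier Q" for a x
    using hcocyclesD(4)[OF uv(1) that, symmetric] hcocyclesD(4)[OF uv(2) that, symmetric] by simp
  ultimately show "u - v \<in> hcocycles K S \<phi> Q \<theta> t" by (rule hcocyclesI)
qed

text \<open>With no relation imposed these are cocycles of the free product of K with an infinite
  cyclic group: the value on the stable letter is an arbitrary function on Q, contributing |Q| to
  the dimension.\<close>

lemma card_hcocycles_empty:
  fixes K :: "('g, 'b) monoid_scheme" and Q :: "('q, 'c) monoid_scheme"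
  assumes "group K" "group Q" "\<theta> \<in> hom K Q" "finitely_generated K" "finite (carrier Q)"
  shows "finite (hcocycles K {} \<phi> Q \<theta> t)"
    and "card (hcocycles K {} \<phi> Q \<theta> t) = card (cocycles K Q \<theta>) * p ^ card (carrier Q)"
proof -
  let ?R = "{f. (\<forall>x. f x \<in> F) \<and> (\<forall>x. x \<notin> carrier Q \<longrightarrow> f x = 0)}"
  let ?h = "\<lambda>c::'g option \<times> 'q \<Rightarrow> 'f. (\<lambda>(g, x). c (Some g, x), \<lambda>x. c (None, x))"
  have bij: "bij_betw ?h (hcocycles K {} \<phi> Q \<theta> t) (cocycles K Q \<theta> \<times> ?R)"
  proof (rule bij_betw_byWitness[where f' = "\<lambda>(c, f). \<lambda>(l, x). (case l of None \<Rightarrow> f x | Some g \<Rightarrow> c (g, x))"])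
    show "\<forall>c\<in>hcocycles K {} \<phi> Q \<theta> t. (case ?h c of (c, f) \<Rightarrow> \<lambda>(l, x). (case l of None \<Rightarrow> f x | Some g \<Rightarrow> c (g, x))) = c"
      by (auto simp: fun_eq_iff split: option.split)
    show "\<forall>d\<in>cocycles K Q \<theta> \<times> ?R. ?h (case d of (c, f) \<Rightarrow> \<lambda>(l, x). (case l of None \<Rightarrow> f x | Some g \<Rightarrow> c (g, x))) = d"
      by (auto simp: fun_eq_iff)
    show "?h ` hcocycles K {} \<phi> Q \<theta> t \<subseteq> cocycles K Q \<theta> \<times> ?R"
      by (intro image_subsetI) (simp add: hcocycles_def)
    show "(\<lambda>(c, f). \<lambda>(l, x). (case l of None \<Rightarrow> f x | Some g \<Rightarrow> c (g, x))) ` (cocycles K Q \<theta> \<times> ?R) \<subseteq> hcocycles K {} \<phi> Q \<theta> t"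
      by (intro image_subsetI) (auto simp: hcocycles_def)
  qed
  have R: "card ?R = p ^ card (carrier Q)" by (rule card_vanishing_functions[OF assms(5)])
  then have "finite ?R" using p_gt_1 by (intro card_ge_0_finite) simp
  moreover have "finite (cocycles K Q \<theta>)" by (rule finite_cocycles[OF assms])
  ultimately show "finite (hcocycles K {} \<phi> Q \<theta> t)" using bij_betw_finite[OF bij] by simp
  show "card (hcocycles K {} \<phi> Q \<theta> t) = card (cocycles K Q \<theta>) * p ^ card (carrier Q)"
    using bij_betw_same_card[OF bij] R by (simp add: card_cartesian_product)
qed

lemma finite_hcocycles:
  assumes "group K" "group Q" "\<theta> \<in> hom K Q" "finitely_generated K" "finite (carrier Q)"
  shows "finite (hcocycles K S \<phi> Q \<theta> t)"
  by (rule finite_subset[OF hcocycles_mono[OF empty_subsetI] card_hcocycles_empty(1)[OF assms]])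

text \<open>Take a finite \<open>S\<close> with the fewest solutions. Adjoining one more element of
  \<open>A\<close> cannot lower the count, so its relation already follows from those in
  \<open>S\<close>.\<close>

lemma hcocycles_finite_relations:
  assumes "group K" "group Q" "\<theta> \<in> hom K Q" "finitely_generated K" "finite (carrier Q)"
  obtains S where "finite S" "S \<subseteq> A" "hcocycles K S \<phi> Q \<theta> t = hcocycles K A \<phi> Q \<theta> t"
proof -
  let ?H = "\<lambda>S. hcocycles K S \<phi> Q \<theta> t"
  have "\<exists>S. (finite S \<and> S \<subseteq> A) \<and> (\<forall>S'. finite S' \<and> S' \<subseteq> A \<longrightarrow> card (?H S) \<le> card (?H S'))"
    by (rule ex_has_least_nat[of _ "{}"]) simp
  then obtain S where S: "finite S" "S \<subseteq> A" "\<forall>S'. finite S' \<and> S' \<subseteq> A \<longrightarrow> card (?H S) \<le> card (?H S')"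
    by blast
  have "?H S \<subseteq> ?H A"
  proof
    fix c assume c: "c \<in> ?H S"
    have "c \<in> ?H {a}" if "a \<in> A" for a
    proof -
      have sub: "?H (insert a S) \<subseteq> ?H S" by (rule hcocycles_mono) auto
      have "card (?H S) \<le> card (?H (insert a S))" using S that by simp
      then have "?H (insert a S) = ?H S" by (rule card_seteq[OF finite_hcocycles[OF assms] sub])
      moreover have "?H (insert a S) \<subseteq> ?H {a}" by (rule hcocycles_mono) auto
      ultimately show ?thesis using c by auto
    qed
    then show "c \<in> ?H A" using c by (intro hcocyclesI) (auto dest: hcocyclesD)
  qed
  then have "?H S = ?H A" using hcocycles_mono[OF S(2)] by (rule subset_antisym)
  with S(1,2) show ?thesis by (rule that)
qed

text \<open>The HNN relation, like the cocycle identity, involves left translations only. The set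
  \<open>S\<close> is the same on both sides: a finite set chosen for one quotient has to be carried
  to deeper ones.\<close>

lemma card_hcocycles_quotient:
  fixes K :: "('g, 'b) monoid_scheme"
  assumes G: "group K" and fg: "finitely_generated K"
    and Q': "group Q'" and Q: "group Q" and fin: "finite (carrier Q')"
    and r: "r \<in> hom Q' Q" "r ` carrier Q' = carrier Q" and P: "card (kernel Q' Q r) = p ^ k"
    and \<theta>': "\<theta>' \<in> hom K Q'" and \<theta>: "\<theta> \<in> hom K Q" "\<And>g. g \<in> carrier K \<Longrightarrow> r (\<theta>' g) = \<theta> g"
    and t': "t' \<in> carrier Q'" and t: "r t' = t" and S: "S \<subseteq> carrier K"
  shows "card (hcocycles K S \<phi> Q' \<theta>' t') \<le> card (hcocycles K S \<phi> Q \<theta> t) ^ card (kernel Q' Q r)"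
proof (rule card_le_quotient[OF Q' Q fin r P])
  interpret r: group_hom Q' Q r using Q' Q r by (simp add: group_hom_def group_hom_axioms_def)
  interpret t: group_hom K Q' \<theta>' using Q' G \<theta>' by (simp add: group_hom_def group_hom_axioms_def)
  interpret u: group_hom K Q \<theta> using Q G \<theta> by (simp add: group_hom_def group_hom_axioms_def)
  let ?H = "hcocycles K S \<phi> Q' \<theta>' t'"
  show "finite ?H" by (rule finite_hcocycles[OF G Q' \<theta>' fg fin])
  have "finite (carrier Q)" using fin r(2) by (metis finite_imageI)
  then show "finite (hcocycles K S \<phi> Q \<theta> t)" by (rule finite_hcocycles[OF G Q \<theta>(1) fg])
  show "add_subgroup ?H" by (rule hcocycles_subgroup)
  show "\<forall>v\<in>?H. \<forall>y. v y \<in> F" by (intro ballI allI hcocycles_F)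
  show "\<forall>v\<in>?H. \<forall>l x. x \<notin> carrier Q' \<longrightarrow> v (l, x) = 0"
    by (intro ballI allI impI hcocycles_outside)
  show "(\<lambda>(l, x). if x \<in> carrier Q' then v (l, x \<otimes>\<^bsub>Q'\<^esub> z) else 0) \<in> ?H"
    if v: "v \<in> ?H" and z: "z \<in> kernel Q' Q r" for v z
  proof -
    let ?w = "\<lambda>(l, x). if x \<in> carrier Q' then v (l, x \<otimes>\<^bsub>Q'\<^esub> z) else 0"
    have zc: "z \<in> carrier Q'" using z by (simp add: kernel_def)
    note c = hcocyclesD(1)[OF v]
    have "(\<lambda>(g, x). ?w (Some g, x)) \<in> cocycles K Q' \<theta>'"
    proof (rule cocyclesI)
      show "(case (g, x) of (g, x) \<Rightarrow> ?w (Some g, x)) = 0"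
        if "g \<notin> carrier K \<or> x \<notin> carrier Q'" for g x
        using that cocycles_outside[OF c, of g "x \<otimes>\<^bsub>Q'\<^esub> z"] by auto
      show "(case (g, x) of (g, x) \<Rightarrow> ?w (Some g, x)) \<in> F" for g x
        using hcocycles_F[OF v] zero_F by simp
      show "(case (g \<otimes>\<^bsub>K\<^esub> h, x) of (g, x) \<Rightarrow> ?w (Some g, x)) =
          (case (g, \<theta>' h \<otimes>\<^bsub>Q'\<^esub> x) of (g, x) \<Rightarrow> ?w (Some g, x)) + (case (h, x) of (g, x) \<Rightarrow> ?w (Some g, x))"
        if "g \<in> carrier K" "h \<in> carrier K" "x \<in> carrier Q'" for g h x
        using cocycles_mult[OF c that(1,2), of "x \<otimes>\<^bsub>Q'\<^esub> z"] that zc by (simp add: r.G.m_assoc)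
    qed
    moreover have "?w (None, x) \<in> F" for x using hcocycles_F[OF v] zero_F by simp
    moreover have "?w (None, \<theta>' a \<otimes>\<^bsub>Q'\<^esub> x) + ?w (Some a, x) - ?w (None, x) = ?w (Some (\<phi> a), t' \<otimes>\<^bsub>Q'\<^esub> x)"
      if "a \<in> S" "x \<in> carrier Q'" for a x
      using hcocyclesD(4)[OF v that(1), of "x \<otimes>\<^bsub>Q'\<^esub> z"] that S zc t' subsetD[OF S that(1)]
      by (simp add: r.G.m_assoc)
    ultimately show ?thesis by (intro hcocyclesI) auto
  qed
  fix v \<sigma>
  assume v: "v \<in> ?H"
    and inv: "\<And>l x y. x \<in> carrier Q' \<Longrightarrow> y \<in> carrier Q' \<Longrightarrow> r x = r y \<Longrightarrow> v (l, x) = v (l, y)"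
    and \<sigma>: "\<And>y. y \<in> carrier Q \<Longrightarrow> \<sigma> y \<in> carrier Q' \<and> r (\<sigma> y) = y"
  let ?w = "\<lambda>(l, y). if y \<in> carrier Q then v (l, \<sigma> y) else 0"
  note c = hcocyclesD(1)[OF v]
  have th: "v (l, \<theta>' h \<otimes>\<^bsub>Q'\<^esub> \<sigma> y) = v (l, \<sigma> (\<theta> h \<otimes>\<^bsub>Q\<^esub> y))"
    if "h \<in> carrier K" "y \<in> carrier Q" for l h y
    using that \<sigma>[of y] \<sigma>[of "\<theta> h \<otimes>\<^bsub>Q\<^esub> y"] \<theta>(2)[of h] by (intro inv) auto
  have tc: "t \<in> carrier Q" using t t' by auto
  have tt: "v (l, t' \<otimes>\<^bsub>Q'\<^esub> \<sigma> y) = v (l, \<sigma> (t \<otimes>\<^bsub>Q\<^esub> y))" if "y \<in> carrier Q" for l y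
    using that \<sigma>[of y] \<sigma>[of "t \<otimes>\<^bsub>Q\<^esub> y"] t t' tc by (intro inv) auto
  have "(\<lambda>(g, x). ?w (Some g, x)) \<in> cocycles K Q \<theta>"
  proof (rule cocyclesI)
    show "(case (g, x) of (g, x) \<Rightarrow> ?w (Some g, x)) = 0"
      if "g \<notin> carrier K \<or> x \<notin> carrier Q" for g x
      using that cocycles_outside[OF c, of g "\<sigma> x"] by auto
    show "(case (g, x) of (g, x) \<Rightarrow> ?w (Some g, x)) \<in> F" for g x
      using hcocycles_F[OF v] zero_F by simp
    show "(case (g \<otimes>\<^bsub>K\<^esub> h, x) of (g, x) \<Rightarrow> ?w (Some g, x)) =
        (case (g, \<theta> h \<otimes>\<^bsub>Q\<^esub> x) of (g, x) \<Rightarrow> ?w (Some g, x)) + (case (h, x) of (g, x) \<Rightarrow> ?w (Some g, x))"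
      if "g \<in> carrier K" "h \<in> carrier K" "x \<in> carrier Q" for g h x
      using cocycles_mult[OF c that(1,2), of "\<sigma> x"] that \<sigma>[of x] th[of h x "Some g"] by simp
  qed
  moreover have "?w (None, x) \<in> F" for x using hcocycles_F[OF v] zero_F by simp
  moreover have "?w (None, \<theta> a \<otimes>\<^bsub>Q\<^esub> x) + ?w (Some a, x) - ?w (None, x) = ?w (Some (\<phi> a), t \<otimes>\<^bsub>Q\<^esub> x)"
    if "a \<in> S" "x \<in> carrier Q" for a x
    using hcocyclesD(4)[OF v that(1), of "\<sigma> x"] that \<sigma>[of x] th[of a x None] tt[of x] tc subsetD[OF S that(1)] by simp
  ultimately show "?w \<in> hcocycles K S \<phi> Q \<theta> t" by (intro hcocyclesI) auto
qed

text \<open>Two solutions with the same restriction to K differ, on the stable letter, by a function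
  invariant under left translation by \<theta>(A). It is given by one value per coset, which bounds
  the fibres of restriction to K.\<close>

lemma card_hcocycles_le:
  fixes K :: "('g, 'b) monoid_scheme" and Q :: "('q, 'c) monoid_scheme"
  assumes G: "group K" and fg: "finitely_generated K" and Q: "group Q" and fin: "finite (carrier Q)"
    and \<theta>: "\<theta> \<in> hom K Q" and A: "subgroup A K"
  shows "card (hcocycles K A \<phi> Q \<theta> t) \<le> card (cocycles K Q \<theta>) * p ^ card (rcosets\<^bsub>Q\<^esub> (\<theta> ` A))"
proof (rule card_le_fibres[where h = "\<lambda>c. \<lambda>(g, x). c (Some g, x)"])
  interpret group_hom K Q \<theta> using G Q \<theta> by (simp add: group_hom_def group_hom_axioms_def)
  show "finite (hcocycles K A \<phi> Q \<theta> t)" by (rule finite_hcocycles[OF G Q \<theta> fg fin])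
  show "finite (cocycles K Q \<theta>)" by (rule finite_cocycles[OF G Q \<theta> fg fin])
  show "(\<lambda>c. \<lambda>(g, x). c (Some g, x)) ` hcocycles K A \<phi> Q \<theta> t \<subseteq> cocycles K Q \<theta>"
    by (intro image_subsetI hcocyclesD(1))
  let ?I = "\<theta> ` A"
  have I: "subgroup ?I Q" by (rule subgroup_img_is_subgroup[OF A])
  have Ac: "A \<subseteq> carrier K" by (rule subgroup.subset[OF A])
  have finR: "finite (rcosets\<^bsub>Q\<^esub> ?I)" using fin by (simp add: RCOSETS_def)
  fix w assume "w \<in> cocycles K Q \<theta>"
  let ?V = "{c \<in> hcocycles K A \<phi> Q \<theta> t. (\<lambda>(g, x). c (Some g, x)) = w}"
  let ?e = "\<lambda>c. \<lambda>C\<in>rcosets\<^bsub>Q\<^esub> ?I. c (None, SOME x. x \<in> C)"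
  have "inj_on ?e ?V"
  proof (rule inj_onI)
    fix c d assume c: "c \<in> ?V" and d: "d \<in> ?V" and eq: "?e c = ?e d"
    have Some: "c (Some g, x) = d (Some g, x)" for g x
      using c d by (auto dest!: fun_cong[where x = "(g, x)"])
    define \<delta> where "\<delta> x = c (None, x) - d (None, x)" for x
    have \<delta>: "\<delta> (\<theta> a \<otimes>\<^bsub>Q\<^esub> x) = \<delta> x" if "a \<in> A" "x \<in> carrier Q" for a x
    proof -
      have "c (None, \<theta> a \<otimes>\<^bsub>Q\<^esub> x) + c (Some a, x) - c (None, x) = d (None, \<theta> a \<otimes>\<^bsub>Q\<^esub> x) + d (Some a, x) - d (None, x)"
        using hcocyclesD(4)[of c K A \<phi> Q \<theta> t a x] hcocyclesD(4)[of d K A \<phi> Q \<theta> t a x] c d that Some by simp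
      then show ?thesis unfolding \<delta>_def Some by (simp add: algebra_simps)
    qed
    have "c (None, x) = d (None, x)" for x
    proof (cases "x \<in> carrier Q")
      case True
      let ?C = "?I #>\<^bsub>Q\<^esub> x"
      have C: "?C \<in> rcosets\<^bsub>Q\<^esub> ?I" using True by (auto simp: RCOSETS_def)
      have "(SOME y. y \<in> ?C) \<in> ?C" by (rule someI[of "\<lambda>y. y \<in> ?C" x]) (rule H.rcos_self[OF True I])
      then obtain a where a: "a \<in> A" "(SOME y. y \<in> ?C) = \<theta> a \<otimes>\<^bsub>Q\<^esub> x" by (auto simp: r_coset_def)
      have "\<delta> (SOME y. y \<in> ?C) = 0" using fun_cong[OF eq, of ?C] C by (simp add: \<delta>_def)
      then have "\<delta> x = 0" using \<delta>[OF a(1) True] a(2) by simp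
      then show ?thesis by (simp add: \<delta>_def)
    next
      case False
      then show ?thesis
        using c d hcocyclesD(3)[of c K A \<phi> Q \<theta> t x] hcocyclesD(3)[of d K A \<phi> Q \<theta> t x] by simp
    qed
    then have "c (l, x) = d (l, x)" for l x using Some by (cases l) auto
    then show "c = d" by (intro ext) auto
  qed
  moreover have "?e ` ?V \<subseteq> PiE (rcosets\<^bsub>Q\<^esub> ?I) (\<lambda>_. F)"
    by (intro image_subsetI restrict_PiE_iff[THEN iffD2] ballI hcocyclesD(2)[of _ K A \<phi> Q \<theta> t]) simp
  moreover have "finite (PiE (rcosets\<^bsub>Q\<^esub> ?I) (\<lambda>_. F))" using finR finite_F by (intro finite_PiE) auto
  ultimately have "card ?V \<le> card (PiE (rcosets\<^bsub>Q\<^esub> ?I) (\<lambda>_. F))" by (rule card_inj_on_le)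
  then show "card ?V \<le> p ^ card (rcosets\<^bsub>Q\<^esub> ?I)" using finR by (simp add: card_PiE card_F)
qed


text \<open>The amount by which the HNN relation fails: imposing the relations in a set means that
  the defect vanishes there.\<close>

definition defect ::
  "'g set \<Rightarrow> ('g \<Rightarrow> 'g) \<Rightarrow> ('q, 'c) monoid_scheme \<Rightarrow> ('g \<Rightarrow> 'q) \<Rightarrow> 'q \<Rightarrow> ('g option \<times> 'q \<Rightarrow> 'f) \<Rightarrow> 'g \<times> 'q \<Rightarrow> 'f" where
  "defect A \<phi> Q \<theta> t c = (\<lambda>(a, x). if a \<in> A \<and> x \<in> carrier Q
     then c (Some (\<phi> a), t \<otimes>\<^bsub>Q\<^esub> x) - c (Some a, x) - c (None, \<theta> a \<otimes>\<^bsub>Q\<^esub> x) + c (None, x) else 0)"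

lemma defect_diff: "defect A \<phi> Q \<theta> t (c - d) = defect A \<phi> Q \<theta> t c - defect A \<phi> Q \<theta> t d"
  by (simp add: defect_def fun_eq_iff)

text \<open>The defect is a combination of three cocycles of A: the pullback of \<open>c\<close>
  along \<open>\<phi>\<close> translated by \<open>t\<close>, the restriction of \<open>c\<close> to
  A, and the coboundary of the value on the stable letter. The first one is a cocycle because
  \<open>t\<close> conjugates \<theta>(a) to \<theta>(\<phi>(a)).\<close>

lemma defect_cocycle:
  assumes K: "group K" and Q: "group Q" and \<theta>: "\<theta> \<in> hom K Q" and A: "subgroup A K"
    and \<phi>: "\<And>a. a \<in> A \<Longrightarrow> \<phi> a \<in> carrier K" "\<And>a b. a \<in> A \<Longrightarrow> b \<in> A \<Longrightarrow> \<phi> (a \<otimes>\<^bsub>K\<^esub> b) = \<phi> a \<otimes>\<^bsub>K\<^esub> \<phi> b"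
    and t: "t \<in> carrier Q" "\<And>a. a \<in> A \<Longrightarrow> t \<otimes>\<^bsub>Q\<^esub> \<theta> a = \<theta> (\<phi> a) \<otimes>\<^bsub>Q\<^esub> t"
    and c: "c \<in> hcocycles K S \<phi> Q \<theta> t"
  shows "defect A \<phi> Q \<theta> t c \<in> cocycles (K\<lparr>carrier := A\<rparr>) Q \<theta>"
proof (rule cocyclesI)
  interpret group_hom K Q \<theta> using K Q \<theta> by (simp add: group_hom_def group_hom_axioms_def)
  note cF = hcocycles_F[OF c] and c1 = hcocyclesD(1)[OF c]
  have Ac: "a \<in> carrier K" if "a \<in> A" for a using subgroup.mem_carrier[OF A that] .
  show "defect A \<phi> Q \<theta> t c (a, x) \<in> F" for a x
    using cF zero_F by (auto simp: defect_def intro!: diff_F add_F)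
  show "defect A \<phi> Q \<theta> t c (a, x) = 0" if "a \<notin> carrier (K\<lparr>carrier := A\<rparr>) \<or> x \<notin> carrier Q" for a x
    using that by (auto simp: defect_def)
  fix a b x assume "a \<in> carrier (K\<lparr>carrier := A\<rparr>)" "b \<in> carrier (K\<lparr>carrier := A\<rparr>)" and x: "x \<in> carrier Q"
  then have ab: "a \<in> A" "b \<in> A" "a \<otimes>\<^bsub>K\<^esub> b \<in> A" using subgroup.m_closed[OF A] by auto
  have "c (Some (a \<otimes>\<^bsub>K\<^esub> b), x) = c (Some a, \<theta> b \<otimes>\<^bsub>Q\<^esub> x) + c (Some b, x)"
    using cocycles_mult[OF c1 Ac[OF ab(1)] Ac[OF ab(2)] x] by simp
  moreover have "c (Some (\<phi> (a \<otimes>\<^bsub>K\<^esub> b)), t \<otimes>\<^bsub>Q\<^esub> x) = c (Some (\<phi> a), t \<otimes>\<^bsub>Q\<^esub> (\<theta> b \<otimes>\<^bsub>Q\<^esub> x)) + c (Some (\<phi> b), t \<otimes>\<^bsub>Q\<^esub> x)"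
  proof -
    have "\<theta> (\<phi> b) \<otimes>\<^bsub>Q\<^esub> (t \<otimes>\<^bsub>Q\<^esub> x) = t \<otimes>\<^bsub>Q\<^esub> (\<theta> b \<otimes>\<^bsub>Q\<^esub> x)"
      using t \<phi>(1)[OF ab(2)] Ac[OF ab(2)] ab x by (simp flip: H.m_assoc)
    then show ?thesis
      using cocycles_mult[OF c1 \<phi>(1)[OF ab(1)] \<phi>(1)[OF ab(2)], of "t \<otimes>\<^bsub>Q\<^esub> x"] x t(1) \<phi>(2)[OF ab(1,2)] by simp
  qed
  ultimately show "defect A \<phi> Q \<theta> t c (a \<otimes>\<^bsub>K\<lparr>carrier := A\<rparr>\<^esub> b, x) =
      defect A \<phi> Q \<theta> t c (a, \<theta> b \<otimes>\<^bsub>Q\<^esub> x) + defect A \<phi> Q \<theta> t c (b, x)"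
    using ab x Ac[OF ab(1)] Ac[OF ab(2)] by (simp add: defect_def H.m_assoc)
qed

text \<open>The last property says that \<open>\<Theta>\<close> is a set of independent coordinates for the cocycles of \<open>A\<close>.\<close>

lemma hcocycles_lower_bound:
  fixes K :: "('g, 'b) monoid_scheme" and Q :: "('q, 'c) monoid_scheme"
  assumes K: "group K" and fg: "finitely_generated K" and Q: "group Q" and fin: "finite (carrier Q)"
    and \<theta>: "\<theta> \<in> hom K Q" and A: "subgroup A K"
    and \<phi>: "\<And>a. a \<in> A \<Longrightarrow> \<phi> a \<in> carrier K" "\<And>a b. a \<in> A \<Longrightarrow> b \<in> A \<Longrightarrow> \<phi> (a \<otimes>\<^bsub>K\<^esub> b) = \<phi> a \<otimes>\<^bsub>K\<^esub> \<phi> b"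
    and t: "t \<in> carrier Q" "\<And>a. a \<in> A \<Longrightarrow> t \<otimes>\<^bsub>Q\<^esub> \<theta> a = \<theta> (\<phi> a) \<otimes>\<^bsub>Q\<^esub> t"
    and S: "S \<subseteq> A"
  obtains \<Theta> where "finite \<Theta>" "\<Theta> \<subseteq> S \<times> carrier Q"
    "card (cocycles K Q \<theta>) * p ^ card (carrier Q) \<le> p ^ card \<Theta> * card (hcocycles K S \<phi> Q \<theta> t)"
    "\<forall>f. (\<forall>e\<in>\<Theta>. f e \<in> F) \<longrightarrow> (\<exists>w\<in>cocycles (K\<lparr>carrier := A\<rparr>) Q \<theta>. \<forall>e\<in>\<Theta>. w e = f e)"
proof -
  interpret group_hom K Q \<theta> using K Q \<theta> by (simp add: group_hom_def group_hom_axioms_def)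
  let ?V = "hcocycles K {} \<phi> Q \<theta> t" and ?HS = "hcocycles K S \<phi> Q \<theta> t"
  have finV: "finite ?V" and cardV: "card ?V = card (cocycles K Q \<theta>) * p ^ card (carrier Q)"
    using card_hcocycles_empty[OF K Q \<theta> fg fin] by auto
  define D where "D = defect S \<phi> Q \<theta> t"
  have D_eq: "D c (s, x) = defect A \<phi> Q \<theta> t c (s, x)" if "s \<in> S" for c s x
    using that S by (auto simp: D_def defect_def)
  \<comment> \<open>The space of all defects on \<open>S\<close>; its dimension, the number of its
    pivots, is the rank of the relations.\<close>
  define W where "W = D ` ?V"
  have finW: "finite W" using finV by (simp add: W_def)
  have subW: "add_subgroup W"
    unfolding add_subgroup_def
  proof (intro conjI ballI)
    have "D 0 = 0" using defect_diff[of S \<phi> Q \<theta> t 0 0] by (simp add: D_def)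
    then show "0 \<in> W" unfolding W_def using add_subgroup_zero[OF hcocycles_subgroup] by (metis image_eqI)
    fix u v assume "u \<in> W" "v \<in> W"
    then obtain c d where cd: "u = D c" "v = D d" "c \<in> ?V" "d \<in> ?V" by (auto simp: W_def)
    have "u - v = D (c - d)" using cd by (simp add: D_def defect_diff)
    moreover have "c - d \<in> ?V" by (rule add_subgroup_diff[OF hcocycles_subgroup cd(3,4)])
    ultimately show "u - v \<in> W" unfolding W_def by blast
  qed
  have WF: "\<forall>w\<in>W. \<forall>e. w e \<in> F"
  proof (intro ballI allI)
    fix w e assume "w \<in> W"
    then obtain c where c: "c \<in> ?V" "w = D c" by (auto simp: W_def)
    show "w e \<in> F"
      unfolding c(2) D_def defect_def
      using hcocycles_F[OF c(1)] zero_F by (cases e) (auto intro!: diff_F add_F)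
  qed
  obtain \<Theta> where \<Theta>: "finite \<Theta>" "\<forall>v\<in>W. (\<forall>e\<in>\<Theta>. v e = 0) \<longrightarrow> v = 0"
    "\<forall>f. (\<forall>e\<in>\<Theta>. f e \<in> F) \<longrightarrow> (\<exists>v\<in>W. \<forall>e\<in>\<Theta>. v e = f e)" "card W = p ^ card \<Theta>"
    by (rule pivots[OF finW subW WF])
  \<comment> \<open>Some defect takes the nonzero value \<open>\<iota> 1\<close> at a given pivot,
    so pivots lie where defects are not zero by convention.\<close>
  have sub: "\<Theta> \<subseteq> S \<times> carrier Q"
  proof
    fix e assume e: "e \<in> \<Theta>"
    obtain v where v: "v \<in> W" "v e = \<iota> 1" using \<Theta>(3)[rule_format, of "\<lambda>_. \<iota> 1"] e by auto
    have "\<iota> 1 \<noteq> 0" using p_gt_1 by (simp add: iota_eq_0)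
    then show "e \<in> S \<times> carrier Q"
      using v by (cases e) (auto simp: W_def D_def defect_def split: if_splits)
  qed
  have "card ?V \<le> card W * card ?HS"
  proof (rule card_le_fibres[OF finV, where h = D])
    show "D ` ?V \<subseteq> W" "finite W" using finW by (auto simp: W_def)
    fix w assume "w \<in> W"
    then obtain c where c: "c \<in> ?V" "w = D c" by (auto simp: W_def)
    \<comment> \<open>A nonempty fibre of \<open>D\<close> is a translate of its kernel, and the
      kernel consists of the solutions of the relations in \<open>S\<close>.\<close>
    show "card {v\<in>?V. D v = w} \<le> card ?HS"
    proof (rule card_inj_on_le[where f = "\<lambda>v. v - c"])
      show "inj_on (\<lambda>v. v - c) {v\<in>?V. D v = w}" by (rule inj_onI) simp
      show "finite ?HS" by (rule finite_hcocycles[OF K Q \<theta> fg fin])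
      show "(\<lambda>v. v - c) ` {v\<in>?V. D v = w} \<subseteq> ?HS"
      proof (rule image_subsetI)
        fix v assume v: "v \<in> {v\<in>?V. D v = w}"
        have vc: "v - c \<in> ?V" using v by (intro add_subgroup_diff[OF hcocycles_subgroup _ c(1)]) simp
        have D0: "D (v - c) = 0" using v c by (simp add: D_def defect_diff)
        show "v - c \<in> ?HS"
        proof (rule hcocyclesI)
          fix a x assume "a \<in> S" "x \<in> carrier Q"
          then show "(v - c) (None, \<theta> a \<otimes>\<^bsub>Q\<^esub> x) + (v - c) (Some a, x) - (v - c) (None, x) = (v - c) (Some (\<phi> a), t \<otimes>\<^bsub>Q\<^esub> x)"
            using fun_cong[OF D0, of "(a, x)"] by (simp add: D_def defect_def algebra_simps)
        qed (rule hcocyclesD[OF vc], assumption?)+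
      qed
    qed
  qed
  moreover have "\<forall>f. (\<forall>e\<in>\<Theta>. f e \<in> F) \<longrightarrow> (\<exists>w\<in>cocycles (K\<lparr>carrier := A\<rparr>) Q \<theta>. \<forall>e\<in>\<Theta>. w e = f e)"
  proof (intro allI impI)
    fix f assume "\<forall>e\<in>\<Theta>. f e \<in> F"
    then obtain w where w: "w \<in> W" "\<forall>e\<in>\<Theta>. w e = f e" using \<Theta>(3) by blast
    then obtain c where c: "c \<in> ?V" "\<forall>e\<in>\<Theta>. D c e = f e" by (auto simp: W_def)
    \<comment> \<open>On the pivots the defect over \<open>S\<close> agrees with the defect over
      \<open>A\<close>, which is a cocycle of A; this transfers the independence.\<close>
    have "\<forall>e\<in>\<Theta>. defect A \<phi> Q \<theta> t c e = f e"
    proof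
      fix e assume "e \<in> \<Theta>"
      then show "defect A \<phi> Q \<theta> t c e = f e" using c(2) sub D_eq by (cases e) force
    qed
    then show "\<exists>w\<in>cocycles (K\<lparr>carrier := A\<rparr>) Q \<theta>. \<forall>e\<in>\<Theta>. w e = f e"
      using defect_cocycle[OF K Q \<theta> A \<phi> t c(1)] by blast
  qed
  ultimately show ?thesis using that[OF \<Theta>(1) sub] cardV \<Theta>(4) by simp
qed

text \<open>Independent coordinates, pulled back to the Cayley graph of \<open>A\<close> along \<open>a \<mapsto> \<theta>(a) y\<close>, form a forest: on a finite vertex set
  \<open>X\<close> a cocycle is the coboundary of a potential, and potentials modulo constants have dimension \<open>|X| - 1\<close>.\<close>

lemma independent_coordinates_forest:
  fixes A :: "('g, 'b) monoid_scheme" and Q :: "('q, 'c) monoid_scheme"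
  assumes A: "group A" and Q: "group Q" and \<theta>: "\<theta> \<in> hom A Q"
    and \<Theta>: "finite \<Theta>"
    "\<forall>f. (\<forall>e\<in>\<Theta>. f e \<in> F) \<longrightarrow> (\<exists>w\<in>cocycles A Q \<theta>. \<forall>e\<in>\<Theta>. w e = f e)"
    and X: "finite X" "X \<noteq> {}" "X \<subseteq> carrier A" "inj_on \<theta> X" and S: "S \<subseteq> carrier A" and y: "y \<in> carrier Q"
  shows "card {(s, x). s \<in> S \<and> x \<in> X \<and> s \<otimes>\<^bsub>A\<^esub> x \<in> X \<and> (s, \<theta> x \<otimes>\<^bsub>Q\<^esub> y) \<in> \<Theta>} < card X"
proof -
  interpret group_hom A Q \<theta> using A Q \<theta> by (simp add: group_hom_def group_hom_axioms_def)
  let ?E = "{(s, x). s \<in> S \<and> x \<in> X \<and> s \<otimes>\<^bsub>A\<^esub> x \<in> X \<and> (s, \<theta> x \<otimes>\<^bsub>Q\<^esub> y) \<in> \<Theta>}"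
  let ?q = "\<lambda>(s, x). (s, \<theta> x \<otimes>\<^bsub>Q\<^esub> y)"
  \<comment> \<open>As \<open>\<theta>\<close> is injective on \<open>X\<close>, distinct edges
    carry distinct coordinates, so their labels can be prescribed independently.\<close>
  have inj: "inj_on ?q ?E"
  proof (rule inj_onI)
    fix e e' assume "e \<in> ?E" "e' \<in> ?E" "?q e = ?q e'"
    then obtain s x x' where *: "e = (s, x)" "e' = (s, x')" "x \<in> X" "x' \<in> X" "\<theta> x \<otimes>\<^bsub>Q\<^esub> y = \<theta> x' \<otimes>\<^bsub>Q\<^esub> y"
      by (cases e, cases e') auto
    moreover have "\<theta> x \<in> carrier Q" "\<theta> x' \<in> carrier Q" using *(3,4) X(3) by auto
    ultimately have "\<theta> x = \<theta> x'" using y by simp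
    then show "e = e'" using inj_onD[OF X(4) _ *(3,4)] *(1,2) by simp
  qed
  have finE: "finite ?E"
    by (rule inj_on_finite[OF inj _ \<Theta>(1)]) auto
  obtain x0 where x0: "x0 \<in> X" using X(2) by blast
  let ?P = "PiE (X - {x0}) (\<lambda>_. F)" and ?T = "PiE ?E (\<lambda>_. F)"
  \<comment> \<open>The coboundary of the potential \<open>u\<close>, normalised to vanish at
    \<open>x0\<close>. This normalisation is what makes the final inequality strict.\<close>
  define g where "g u = (\<lambda>(s, x)\<in>?E. (if s \<otimes>\<^bsub>A\<^esub> x = x0 then 0 else u (s \<otimes>\<^bsub>A\<^esub> x)) - (if x = x0 then 0 else u x))"
    for u :: "'g \<Rightarrow> 'f"
  have "?T \<subseteq> g ` ?P"
  proof
    fix f assume f: "f \<in> ?T"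
    define f' where "f' e = (if e \<in> ?q ` ?E then f (inv_into ?E ?q e) else 0)" for e
    have f'q: "f' (?q e) = f e" if "e \<in> ?E" for e
      using that inv_into_f_f[OF inj that] by (simp add: f'_def)
    have "f' e \<in> F" for e
      using PiE_mem[OF f] zero_F inv_into_into[of e ?q ?E] by (auto simp: f'_def simp del: split_paired_All)
    then obtain w where w: "w \<in> cocycles A Q \<theta>" "\<forall>e\<in>\<Theta>. w e = f' e" using \<Theta>(2)[rule_format, of f'] by blast
    define u where "u = (\<lambda>x\<in>X - {x0}. w (x, y) - w (x0, y))"
    have "u \<in> ?P" unfolding u_def using cocycles_F[OF w(1)] by (auto intro!: diff_F)
    moreover have "g u = f"
    proof
      fix e
      show "g u e = f e"
      proof (cases "e \<in> ?E")
        case True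
        then obtain s x where e: "e = (s, x)" "s \<in> S" "x \<in> X" "s \<otimes>\<^bsub>A\<^esub> x \<in> X" "(s, \<theta> x \<otimes>\<^bsub>Q\<^esub> y) \<in> \<Theta>" by auto
        have u': "(if z = x0 then 0 else u z) = w (z, y) - w (x0, y)" if "z \<in> X" for z
          using that by (simp add: u_def)
        have "g u e = (w (s \<otimes>\<^bsub>A\<^esub> x, y) - w (x0, y)) - (w (x, y) - w (x0, y))"
          using True e(1) u'[OF e(4)] u'[OF e(3)] by (simp add: g_def)
        also have "w (s \<otimes>\<^bsub>A\<^esub> x, y) = w (s, \<theta> x \<otimes>\<^bsub>Q\<^esub> y) + w (x, y)"
          using cocycles_mult[OF w(1), of s x y] e S X(3) y by auto
        finally have "g u e = w (s, \<theta> x \<otimes>\<^bsub>Q\<^esub> y)" by simp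
        also have "\<dots> = f' (?q e)" using w(2) e by simp
        finally show ?thesis using f'q[OF True] by simp
      next
        case False
        then have "g u e = undefined" by (simp add: g_def restrict_def)
        then show ?thesis using PiE_arb[OF f False] by simp
      qed
    qed
    ultimately show "f \<in> g ` ?P" by blast
  qed
  then have "card ?T \<le> card ?P"
    using X(1) finite_F by (intro surj_card_le[of ?P]) (auto intro!: finite_PiE)
  then have "p ^ card ?E \<le> p ^ card (X - {x0})"
    using finE X(1) by (simp add: card_PiE card_F)
  then have "card ?E \<le> card (X - {x0})" using p_gt_1 by simp
  also have "\<dots> < card X" by (rule card_Diff1_less[OF X(1) x0])
  finally show ?thesis .
qed

end

section \<open>Forests in amenable groups\<close>

text \<open>If every nonempty set of vertices spans fewer edges than it has vertices, some vertex has degree at most one;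
  removing it gives an orientation of the edges in which every vertex is the tail of at most one edge.\<close>

lemma forest_orientation:
  assumes "finite V" "finite E" "\<alpha> ` E \<subseteq> V" "\<beta> ` E \<subseteq> V"
    and "\<And>X. X \<subseteq> V \<Longrightarrow> X \<noteq> {} \<Longrightarrow> card {e\<in>E. \<alpha> e \<in> X \<and> \<beta> e \<in> X} < card X"
  shows "\<exists>\<tau>. inj_on \<tau> E \<and> (\<forall>e\<in>E. \<tau> e = \<alpha> e \<or> \<tau> e = \<beta> e)"
  using assms
proof (induction "card V" arbitrary: V E)
  case 0
  then have "E = {}" by auto
  then show ?case by auto
next
  case (Suc n)
  define D where "D v = {e\<in>E. \<alpha> e = v \<or> \<beta> e = v}" for v
  \<comment> \<open>The degrees add up to at most 2 |E|, which is less than 2 |V| by the hypothesis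
    for the full vertex set.\<close>
  have "\<exists>v\<in>V. card (D v) \<le> 1"
  proof (rule ccontr)
    assume "\<not> ?thesis"
    then have "2 \<le> card (D v)" if "v \<in> V" for v using that by force
    then have "card V * 2 \<le> (\<Sum>v\<in>V. card (D v))" using sum_bounded_below[of V 2 "\<lambda>v. card (D v)"] by simp
    also have "\<dots> \<le> (\<Sum>v\<in>V. card {e\<in>E. \<alpha> e = v} + card {e\<in>E. \<beta> e = v})"
    proof (rule sum_mono)
      fix v
      have "D v = {e\<in>E. \<alpha> e = v} \<union> {e\<in>E. \<beta> e = v}" by (auto simp: D_def)
      then show "card (D v) \<le> card {e\<in>E. \<alpha> e = v} + card {e\<in>E. \<beta> e = v}"
        using card_Un_le[of "{e\<in>E. \<alpha> e = v}" "{e\<in>E. \<beta> e = v}"] by simp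
    qed
    also have "\<dots> = card E + card E"
    proof -
      have fib: "(\<Sum>v\<in>V. card {e\<in>E. \<gamma> e = v}) = card E" if "\<gamma> ` E \<subseteq> V" for \<gamma>
        using sum.group[OF Suc.prems(2,1) that, of "\<lambda>_. 1::nat"] by simp
      show ?thesis using fib[OF Suc.prems(3)] fib[OF Suc.prems(4)] by (simp add: sum.distrib)
    qed
    finally have "card V \<le> card E" by simp
    moreover have "{e\<in>E. \<alpha> e \<in> V \<and> \<beta> e \<in> V} = E" using Suc.prems(3,4) by auto
    moreover have "V \<noteq> {}" using Suc.hyps(2) by auto
    ultimately show False using Suc.prems(5)[of V] by simp
  qed
  then obtain v where v: "v \<in> V" "card (D v) \<le> 1" by blast
  define E' where "E' = E - D v"
  have "\<exists>\<tau>. inj_on \<tau> E' \<and> (\<forall>e\<in>E'. \<tau> e = \<alpha> e \<or> \<tau> e = \<beta> e)"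
  proof (rule Suc.hyps(1)[of "V - {v}"])
    show "n = card (V - {v})" using Suc.hyps(2) v(1) by simp
    show "finite (V - {v})" "finite E'" using Suc.prems by (auto simp: E'_def)
    show "\<alpha> ` E' \<subseteq> V - {v}" "\<beta> ` E' \<subseteq> V - {v}" using Suc.prems(3,4) by (auto simp: E'_def D_def)
    fix X assume X: "X \<subseteq> V - {v}" "X \<noteq> {}"
    have "card {e\<in>E'. \<alpha> e \<in> X \<and> \<beta> e \<in> X} \<le> card {e\<in>E. \<alpha> e \<in> X \<and> \<beta> e \<in> X}"
      using Suc.prems(2) by (intro card_mono) (auto simp: E'_def)
    also have "\<dots> < card X" using X by (intro Suc.prems(5)) auto
    finally show "card {e\<in>E'. \<alpha> e \<in> X \<and> \<beta> e \<in> X} < card X" .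
  qed
  then obtain \<tau> where \<tau>: "inj_on \<tau> E'" "\<forall>e\<in>E'. \<tau> e = \<alpha> e \<or> \<tau> e = \<beta> e" by blast
  have finD: "finite (D v)" using Suc.prems(2) by (simp add: D_def)
  \<comment> \<open>The removed vertex takes the only edge at it, if there is one. No other edge
    touches \<open>v\<close>, so injectivity survives.\<close>
  define \<tau>' where "\<tau>' e = (if e \<in> D v then v else \<tau> e)" for e
  have "inj_on \<tau>' E"
  proof (rule inj_onI)
    fix e e' assume e: "e \<in> E" "e' \<in> E" "\<tau>' e = \<tau>' e'"
    have ne: "\<tau> d \<noteq> v" if "d \<in> E" "d \<notin> D v" for d
    proof -
      have "d \<in> E'" using that by (simp add: E'_def)
      then have "\<tau> d = \<alpha> d \<or> \<tau> d = \<beta> d" using \<tau>(2) by blast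
      then show ?thesis using that by (auto simp: D_def)
    qed
    show "e = e'"
    proof (cases "e \<in> D v")
      case True
      then have "e' \<in> D v" using e ne[of e'] by (auto simp: \<tau>'_def split: if_splits)
      then show ?thesis using True v(2) finD card_le_Suc0_iff_eq[OF finD] by auto
    next
      case False
      then have "e' \<notin> D v" using e ne[of e] by (auto simp: \<tau>'_def split: if_splits)
      then show ?thesis using False e \<tau>(1) by (auto simp: \<tau>'_def E'_def dest: inj_onD)
    qed
  qed
  moreover have "\<forall>e\<in>E. \<tau>' e = \<alpha> e \<or> \<tau>' e = \<beta> e" using \<tau>(2) by (auto simp: \<tau>'_def D_def E'_def)
  ultimately show ?case by blast
qed

text \<open>A mean kills every sum \<open>\<psi>\<^sub>s(x) - \<psi>\<^sub>s(s x)\<close>; by Tychonoff's theorem it suffices to find such sums that are bounded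
  below on finite sets.\<close>

lemma amenable_no_flow:
  fixes G :: "('g, 'b) monoid_scheme"
  assumes G: "group G" and am: "amenable G" and S: "finite S" "S \<subseteq> carrier G" and \<epsilon>: "\<epsilon> > 0"
    and flow: "\<And>B. finite B \<Longrightarrow> B \<subseteq> carrier G \<Longrightarrow>
      \<exists>\<psi>::'g \<times> 'g \<Rightarrow> real. (\<forall>e. -1 \<le> \<psi> e \<and> \<psi> e \<le> 0) \<and> (\<forall>b\<in>B. \<epsilon> \<le> (\<Sum>s\<in>S. \<psi> (s, b) - \<psi> (s, s \<otimes>\<^bsub>G\<^esub> b)))"
  shows False
proof -
  interpret group G by (fact G)
  let ?I = "S \<times> carrier G"
  let ?X = "product_topology (\<lambda>_. euclideanreal) ?I"
  let ?C = "PiE ?I (\<lambda>_. {-1..0::real})"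
  \<comment> \<open>Each summand, as a function of \<open>b\<close>, is a bounded function minus its
    left translate by \<open>s\<close>; an invariant mean annihilates it.\<close>
  define L where "L b \<psi> = (\<Sum>s\<in>S. \<psi> (s, b) - \<psi> (s, s \<otimes>\<^bsub>G\<^esub> b))" for b and \<psi> :: "'g \<times> 'g \<Rightarrow> real"
  define Z where "Z b = {\<psi> \<in> topspace ?X. L b \<psi> \<in> {\<epsilon>..}}" for b
  have comp: "compactin ?X ?C" by (simp add: compactin_PiE)
  have clos: "closedin ?X (Z b)" if b: "b \<in> carrier G" for b
    unfolding Z_def
  proof (rule closedin_continuous_map_preimage[where Y = euclideanreal])
    show "continuous_map ?X euclideanreal (L b)"
      unfolding L_def
      by (intro continuous_map_sum continuous_map_diff continuous_map_product_projection S(1))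
        (use S b in auto)
  qed simp
  \<comment> \<open>Finitely many of the conditions \<open>Z b\<close> are compatible by
    \<open>flow\<close>; compactness of the cube \<open>?C\<close> yields one function satisfying
    all of them.\<close>
  have "?C \<inter> \<Inter> (Z ` carrier G) \<noteq> {}"
  proof -
    have "\<forall>\<F>. finite \<F> \<and> \<F> \<subseteq> Z ` carrier G \<longrightarrow> ?C \<inter> \<Inter>\<F> \<noteq> {}"
    proof (intro allI impI)
      fix \<F> assume "finite \<F> \<and> \<F> \<subseteq> Z ` carrier G"
      then have "\<exists>B\<subseteq>carrier G. finite B \<and> \<F> = Z ` B" by (intro finite_subset_image) auto
      then obtain B where B: "finite B" "B \<subseteq> carrier G" "\<F> = Z ` B" by blast
      from flow[OF B(1,2)] obtain \<psi> :: "'g \<times> 'g \<Rightarrow> real" where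
        \<psi>: "\<And>e. -1 \<le> \<psi> e \<and> \<psi> e \<le> 0" "\<And>b. b \<in> B \<Longrightarrow> \<epsilon> \<le> L b \<psi>" unfolding L_def by blast
      have "L b (restrict \<psi> ?I) = L b \<psi>" if "b \<in> B" for b
        unfolding L_def using that B(2) S(2) by (intro sum.cong HOL.refl) auto
      then have "restrict \<psi> ?I \<in> ?C \<inter> \<Inter>\<F>" using \<psi> by (auto simp: B(3) Z_def)
      then show "?C \<inter> \<Inter>\<F> \<noteq> {}" by blast
    qed
    moreover have "\<forall>\<U>. Ball \<U> (closedin ?X) \<and> (\<forall>\<F>. finite \<F> \<and> \<F> \<subseteq> \<U> \<longrightarrow> ?C \<inter> \<Inter>\<F> \<noteq> {}) \<longrightarrow> ?C \<inter> \<Inter>\<U> \<noteq> {}"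
      using comp unfolding compactin_fip by (rule conjunct2)
    moreover have "Ball (Z ` carrier G) (closedin ?X)" using clos by simp
    ultimately show ?thesis by simp
  qed
  then obtain \<psi> where \<psi>: "\<psi> \<in> ?C" "\<And>b. b \<in> carrier G \<Longrightarrow> \<epsilon> \<le> L b \<psi>" by (auto simp: Z_def)
  have bd: "\<bar>\<psi> (s, x)\<bar> \<le> 1" if "s \<in> S" "x \<in> carrier G" for s x
    using PiE_mem[OF \<psi>(1), of "(s, x)"] that by auto
  obtain m :: "('g \<Rightarrow> real) \<Rightarrow> real" where
    m: "\<forall>f g. bounded_fun_on (carrier G) f \<longrightarrow> bounded_fun_on (carrier G) g \<longrightarrow> m (\<lambda>x. f x + g x) = m f + m g"
      "\<forall>c f. bounded_fun_on (carrier G) f \<longrightarrow> m (\<lambda>x. c * f x) = c * m f"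
      "\<forall>f. bounded_fun_on (carrier G) f \<longrightarrow> (\<forall>x\<in>carrier G. 0 \<le> f x) \<longrightarrow> 0 \<le> m f"
      "m (\<lambda>_. 1) = 1"
      "\<forall>f. \<forall>g\<in>carrier G. bounded_fun_on (carrier G) f \<longrightarrow> m (\<lambda>x. f (g \<otimes>\<^bsub>G\<^esub> x)) = m f"
    using am unfolding amenable_def by (elim exE conjE)
  have add: "m (\<lambda>x. f x + g x) = m f + m g" if "bounded_fun_on (carrier G) f" "bounded_fun_on (carrier G) g" for f g
    using m(1) that by simp
  have scale: "m (\<lambda>x. c * f x) = c * m f" if "bounded_fun_on (carrier G) f" for c f
    using m(2) that by simp
  have pos: "0 \<le> m f" if "bounded_fun_on (carrier G) f" "\<forall>x\<in>carrier G. 0 \<le> f x" for f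
    using m(3) that by simp
  note one = m(4)
  have inv: "m (\<lambda>x. f (g \<otimes>\<^bsub>G\<^esub> x)) = m f" if "g \<in> carrier G" "bounded_fun_on (carrier G) f" for f g
    using m(5) that by simp
  have b_diff: "bounded_fun_on (carrier G) (\<lambda>x. \<psi> (s, x) - \<psi> (s, s \<otimes>\<^bsub>G\<^esub> x))" if s: "s \<in> S" for s
    unfolding bounded_fun_on_def
  proof (intro exI[of _ 2] ballI)
    fix x assume "x \<in> carrier G"
    then show "\<bar>\<psi> (s, x) - \<psi> (s, s \<otimes>\<^bsub>G\<^esub> x)\<bar> \<le> 2" using bd[OF s, of x] bd[OF s, of "s \<otimes>\<^bsub>G\<^esub> x"] s S by auto
  qed
  have m_diff: "m (\<lambda>x. \<psi> (s, x) - \<psi> (s, s \<otimes>\<^bsub>G\<^esub> x)) = 0" if s: "s \<in> S" for s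
  proof -
    have b1: "bounded_fun_on (carrier G) (\<lambda>x. \<psi> (s, x))"
      unfolding bounded_fun_on_def using bd[OF s] by blast
    have b2: "bounded_fun_on (carrier G) (\<lambda>x. \<psi> (s, s \<otimes>\<^bsub>G\<^esub> x))"
      unfolding bounded_fun_on_def by (intro exI[of _ 1] ballI bd[OF s]) (use s S in auto)
    have "m (\<lambda>x. \<psi> (s, x) - \<psi> (s, s \<otimes>\<^bsub>G\<^esub> x)) + m (\<lambda>x. \<psi> (s, s \<otimes>\<^bsub>G\<^esub> x)) = m (\<lambda>x. \<psi> (s, x))"
      using add[OF b_diff[OF s] b2] by simp
    moreover have "m (\<lambda>x. \<psi> (s, s \<otimes>\<^bsub>G\<^esub> x)) = m (\<lambda>x. \<psi> (s, x))"
      using inv[of s "\<lambda>x. \<psi> (s, x)"] b1 s S by auto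
    ultimately show ?thesis by simp
  qed
  have b0: "bounded_fun_on (carrier G) (\<lambda>x. c)" for c
    unfolding bounded_fun_on_def by blast
  have "bounded_fun_on (carrier G) (\<lambda>x. \<Sum>s\<in>T. \<psi> (s, x) - \<psi> (s, s \<otimes>\<^bsub>G\<^esub> x)) \<and>
      m (\<lambda>x. \<Sum>s\<in>T. \<psi> (s, x) - \<psi> (s, s \<otimes>\<^bsub>G\<^esub> x)) = 0" if "T \<subseteq> S" for T
    using finite_subset[OF that S(1)] that
  proof (induction T rule: finite_induct)
    case empty
    then show ?case using scale[OF b0, of 0 1] b0 by simp
  next
    case (insert s T)
    then have s: "s \<in> S" and IH: "bounded_fun_on (carrier G) (\<lambda>x. \<Sum>s\<in>T. \<psi> (s, x) - \<psi> (s, s \<otimes>\<^bsub>G\<^esub> x))"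
      "m (\<lambda>x. \<Sum>s\<in>T. \<psi> (s, x) - \<psi> (s, s \<otimes>\<^bsub>G\<^esub> x)) = 0" by auto
    obtain C C' where C: "\<And>x. x \<in> carrier G \<Longrightarrow> \<bar>\<Sum>s\<in>T. \<psi> (s, x) - \<psi> (s, s \<otimes>\<^bsub>G\<^esub> x)\<bar> \<le> C"
      "\<And>x. x \<in> carrier G \<Longrightarrow> \<bar>\<psi> (s, x) - \<psi> (s, s \<otimes>\<^bsub>G\<^esub> x)\<bar> \<le> C'"
      using IH(1) b_diff[OF s] unfolding bounded_fun_on_def by blast
    have "bounded_fun_on (carrier G) (\<lambda>x. \<Sum>s\<in>insert s T. \<psi> (s, x) - \<psi> (s, s \<otimes>\<^bsub>G\<^esub> x))"
      unfolding bounded_fun_on_def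
    proof (intro exI[of _ "C' + C"] ballI)
      fix x assume "x \<in> carrier G"
      from C(1)[OF this] C(2)[OF this]
      show "\<bar>\<Sum>s\<in>insert s T. \<psi> (s, x) - \<psi> (s, s \<otimes>\<^bsub>G\<^esub> x)\<bar> \<le> C' + C" using insert.hyps by simp
    qed
    moreover have "m (\<lambda>x. \<Sum>s\<in>insert s T. \<psi> (s, x) - \<psi> (s, s \<otimes>\<^bsub>G\<^esub> x)) = 0"
      using add[OF b_diff[OF s] IH(1)] m_diff[OF s] IH(2) insert.hyps by simp
    ultimately show ?case by blast
  qed
  from this[of S] have bL: "bounded_fun_on (carrier G) (\<lambda>x. L x \<psi>)" and mL: "m (\<lambda>x. L x \<psi>) = 0"
    by (auto simp: L_def)
  have m\<epsilon>: "m (\<lambda>x. - \<epsilon>) = - \<epsilon>" using scale[OF b0, of "- \<epsilon>" 1] one by simp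
  have "bounded_fun_on (carrier G) (\<lambda>x. L x \<psi> + - \<epsilon>)"
  proof -
    obtain C where C: "\<And>x. x \<in> carrier G \<Longrightarrow> \<bar>L x \<psi>\<bar> \<le> C" using bL unfolding bounded_fun_on_def by blast
    show ?thesis
      unfolding bounded_fun_on_def
    proof (intro exI[of _ "C + \<epsilon>"] ballI)
      fix x assume "x \<in> carrier G"
      from C[OF this] show "\<bar>L x \<psi> + - \<epsilon>\<bar> \<le> C + \<epsilon>" using \<epsilon> by arith
    qed
  qed
  \<comment> \<open>Positivity would give 0 \<le> m(L - \<epsilon>), whereas m(L) = 0 makes this
    mean equal to - \<epsilon>.\<close>
  then have "0 \<le> m (\<lambda>x. L x \<psi> + - \<epsilon>)" using \<psi>(2) by (intro pos) auto
  then show False using add[OF bL b0, of "- \<epsilon>"] mL m\<epsilon> \<epsilon> by simp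
qed

text \<open>A pair (s, x) is the edge from x to s x of the Cayley graph, kept if its image
  coordinate lies in \<open>\<Theta>\<close>. The strict bound on every admissible vertex set
  excludes cycles. Cycles that close up only because \<open>\<theta>\<close> identifies vertices are
  not excluded, hence the condition \<open>inj_on \<theta> X\<close>.\<close>

definition forest_coordinates ::
  "('g, 'b) monoid_scheme \<Rightarrow> ('q, 'c) monoid_scheme \<Rightarrow> ('g \<Rightarrow> 'q) \<Rightarrow> 'g set \<Rightarrow> ('g \<times> 'q) set \<Rightarrow> bool" where
  "forest_coordinates G Q \<theta> S \<Theta> \<longleftrightarrow> finite \<Theta> \<and> \<Theta> \<subseteq> S \<times> carrier Q \<and>
     (\<forall>X. \<forall>y\<in>carrier Q. finite X \<and> X \<noteq> {} \<and> X \<subseteq> carrier G \<and> inj_on \<theta> X \<longrightarrow>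
        card {(s, x). s \<in> S \<and> x \<in> X \<and> s \<otimes>\<^bsub>G\<^esub> x \<in> X \<and> (s, \<theta> x \<otimes>\<^bsub>Q\<^esub> y) \<in> \<Theta>} < card X)"

lemma card_pairs: "finite S \<Longrightarrow> finite X \<Longrightarrow> card {(s, x). s \<in> S \<and> x \<in> X \<and> P s x} = (\<Sum>x\<in>X. card {s\<in>S. P s x})"
proof -
  assume fin: "finite S" "finite X"
  have "{(s, x). s \<in> S \<and> x \<in> X \<and> P s x} = prod.swap ` (SIGMA x:X. {s\<in>S. P s x})" by force
  then have "card {(s, x). s \<in> S \<and> x \<in> X \<and> P s x} = card (SIGMA x:X. {s\<in>S. P s x})"
    by (simp add: card_image)
  then show ?thesis using fin by (simp add: card_SigmaI)
qed

text \<open>Left translation by \<theta>(g) permutes Q, so while the base point y runs through Q,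
  the vertex \<open>g\<close> meets every coordinate in \<open>\<Theta>\<close> exactly once.
  Averages over y are therefore the same at all vertices.\<close>

lemma sum_degrees:
  assumes G: "group G" and Q: "group Q" and \<theta>: "\<theta> \<in> hom G Q" and fin: "finite (carrier Q)" "finite S"
    and \<Theta>: "\<Theta> \<subseteq> S \<times> carrier Q" and g: "g \<in> carrier G"
  shows "(\<Sum>y\<in>carrier Q. card {s\<in>S. (s, \<theta> g \<otimes>\<^bsub>Q\<^esub> y) \<in> \<Theta>}) = card \<Theta>"
proof -
  interpret group_hom G Q \<theta> using G Q \<theta> by (simp add: group_hom_def group_hom_axioms_def)
  have "bij_betw (\<lambda>y. \<theta> g \<otimes>\<^bsub>Q\<^esub> y) (carrier Q) (carrier Q)"
    by (rule bij_betw_byWitness[where f' = "\<lambda>y. inv\<^bsub>Q\<^esub> \<theta> g \<otimes>\<^bsub>Q\<^esub> y"]) (use g in \<open>auto simp: H.inv_mult_cancel\<close>)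
  from sum.reindex_bij_betw[OF this, of "\<lambda>z. card {s\<in>S. (s, z) \<in> \<Theta>}"]
  have "(\<Sum>y\<in>carrier Q. card {s\<in>S. (s, \<theta> g \<otimes>\<^bsub>Q\<^esub> y) \<in> \<Theta>}) = (\<Sum>z\<in>carrier Q. card {s\<in>S. (s, z) \<in> \<Theta>})" .
  also have "\<dots> = card {(s, z). s \<in> S \<and> z \<in> carrier Q \<and> (s, z) \<in> \<Theta>}"
    using card_pairs[OF fin(2,1), of "\<lambda>s z. (s, z) \<in> \<Theta>"] by simp
  also have "{(s, z). s \<in> S \<and> z \<in> carrier Q \<and> (s, z) \<in> \<Theta>} = \<Theta>" using \<Theta> by auto
  finally show ?thesis .
qed

text \<open>The whole group is an admissible vertex set, so each pulled back graph has at most |G| -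
  1 edges. Summed over the |Q| base points, every coordinate is counted |G| times.\<close>

lemma forest_coordinates_finite:
  assumes G: "group G" and Q: "group Q" and \<theta>: "\<theta> \<in> hom G Q" and fin: "finite (carrier Q)" "finite S"
    and S: "S \<subseteq> carrier G"
    and fc: "forest_coordinates G Q \<theta> S \<Theta>" and finG: "finite (carrier G)" and inj: "inj_on \<theta> (carrier G)"
  shows "real (card \<Theta>) \<le> (1 - 1 / card (carrier G)) * card (carrier Q)"
proof -
  interpret group_hom G Q \<theta> using G Q \<theta> by (simp add: group_hom_def group_hom_axioms_def)
  let ?E = "\<lambda>y. {(s, x). s \<in> S \<and> x \<in> carrier G \<and> (s, \<theta> x \<otimes>\<^bsub>Q\<^esub> y) \<in> \<Theta>}"
  have ne: "carrier G \<noteq> {}" using G.one_closed by blast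
  have "card (carrier G) * card \<Theta> = (\<Sum>x\<in>carrier G. \<Sum>y\<in>carrier Q. card {s\<in>S. (s, \<theta> x \<otimes>\<^bsub>Q\<^esub> y) \<in> \<Theta>})"
    using sum_degrees[OF G Q \<theta> fin] fc by (simp add: forest_coordinates_def)
  also have "\<dots> = (\<Sum>y\<in>carrier Q. \<Sum>x\<in>carrier G. card {s\<in>S. (s, \<theta> x \<otimes>\<^bsub>Q\<^esub> y) \<in> \<Theta>})" by (rule sum.swap)
  also have "\<dots> = (\<Sum>y\<in>carrier Q. card (?E y))" using card_pairs[OF fin(2) finG] by simp
  also have "\<dots> \<le> (\<Sum>y\<in>carrier Q. card (carrier G) - 1)"
  proof (rule sum_mono)
    fix y assume y: "y \<in> carrier Q"
    have "{(s, x). s \<in> S \<and> x \<in> carrier G \<and> s \<otimes>\<^bsub>G\<^esub> x \<in> carrier G \<and> (s, \<theta> x \<otimes>\<^bsub>Q\<^esub> y) \<in> \<Theta>} = ?E y" using S by auto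
    then have "card (?E y) < card (carrier G)"
      using fc[unfolded forest_coordinates_def, THEN conjunct2, THEN conjunct2, rule_format, OF y, of "carrier G"]
        finG ne inj by simp
    then show "card (?E y) \<le> card (carrier G) - 1" by simp
  qed
  finally have "card (carrier G) * card \<Theta> \<le> card (carrier Q) * (card (carrier G) - 1)" by simp
  then have "real (card (carrier G) * card \<Theta>) \<le> real (card (carrier Q) * (card (carrier G) - 1))"
    by (simp only: of_nat_le_iff)
  moreover have pos: "card (carrier G) > 0" using finG ne by (simp add: card_gt_0_iff)
  ultimately show ?thesis by (simp add: field_simps of_nat_diff)
qed

text \<open>Averaging the orientations of the pulled back forests over all base points \<open>y\<close> gives the sums excluded by
  amenability, unless the average degree is at most \<open>1 + \<epsilon>\<close>.\<close>

lemma forest_coordinates_amenable: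
  fixes G :: "('g, 'b) monoid_scheme" and \<epsilon> :: real
  assumes G: "group G" and am: "amenable G" and S: "finite S" "S \<subseteq> carrier G" and \<epsilon>: "\<epsilon> > 0"
  obtains B where "finite B" "B \<subseteq> carrier G"
    "\<forall>(Q :: 'q monoid) \<theta> \<Theta>. group Q \<longrightarrow> finite (carrier Q) \<longrightarrow> \<theta> \<in> hom G Q \<longrightarrow> inj_on \<theta> B \<longrightarrow>
       forest_coordinates G Q \<theta> S \<Theta> \<longrightarrow> real (card \<Theta>) \<le> (1 + \<epsilon>) * card (carrier Q)"
proof (rule ccontr)
  note that0 = that
  interpret group G by (fact G)
  assume no: "\<not> thesis"
  \<comment> \<open>If no finite set works, each \<open>B\<close> has its own bad quotient. These
    quotients, one for every \<open>B\<close>, feed the compactness argument.\<close>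
  have neg: "\<exists>(Q :: 'q monoid) \<theta> \<Theta>. group Q \<and> finite (carrier Q) \<and> \<theta> \<in> hom G Q \<and> inj_on \<theta> B \<and>
       forest_coordinates G Q \<theta> S \<Theta> \<and> \<not> real (card \<Theta>) \<le> (1 + \<epsilon>) * card (carrier Q)"
    if "finite B" "B \<subseteq> carrier G" for B
  proof (rule ccontr)
    assume "\<not> ?thesis"
    then have "\<forall>(Q :: 'q monoid) \<theta> \<Theta>. group Q \<longrightarrow> finite (carrier Q) \<longrightarrow> \<theta> \<in> hom G Q \<longrightarrow> inj_on \<theta> B \<longrightarrow>
       forest_coordinates G Q \<theta> S \<Theta> \<longrightarrow> real (card \<Theta>) \<le> (1 + \<epsilon>) * card (carrier Q)" by blast
    from that(1,2) this have thesis by (rule that0)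
    with no show False by simp
  qed
  show False
  proof (rule amenable_no_flow[OF G am S \<epsilon>])
    fix B assume B: "finite B" "B \<subseteq> carrier G"
    \<comment> \<open>\<open>B\<close> with all its neighbours, so that every edge with an end in
      \<open>B\<close> is visible inside \<open>V\<close>.\<close>
    define V where "V = B \<union> (\<Union>s\<in>S. (\<lambda>b. s \<otimes>\<^bsub>G\<^esub> b) ` B) \<union> (\<Union>s\<in>S. (\<lambda>b. inv\<^bsub>G\<^esub> s \<otimes>\<^bsub>G\<^esub> b) ` B)"
    have finV: "finite V" using B S by (simp add: V_def)
    have VG: "V \<subseteq> carrier G" using B S by (auto simp: V_def)
    obtain Q :: "'q monoid" and \<theta> \<Theta> where Q: "group Q" "finite (carrier Q)" "\<theta> \<in> hom G Q" "inj_on \<theta> V"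
      "forest_coordinates G Q \<theta> S \<Theta>" "\<not> real (card \<Theta>) \<le> (1 + \<epsilon>) * card (carrier Q)"
      using neg[OF finV VG] by blast
    define E where "E y = {(s, x). s \<in> S \<and> x \<in> V \<and> s \<otimes>\<^bsub>G\<^esub> x \<in> V \<and> (s, \<theta> x \<otimes>\<^bsub>Q\<^esub> y) \<in> \<Theta>}" for y
    have "\<exists>\<tau>. inj_on \<tau> (E y) \<and> (\<forall>e\<in>E y. \<tau> e = snd e \<or> \<tau> e = fst e \<otimes>\<^bsub>G\<^esub> snd e)" if y: "y \<in> carrier Q" for y
    proof (rule forest_orientation[OF finV])
      show "finite (E y)" by (rule finite_subset[of _ "S \<times> V"]) (use S finV in \<open>auto simp: E_def\<close>)
      show "snd ` E y \<subseteq> V" "(\<lambda>e. fst e \<otimes>\<^bsub>G\<^esub> snd e) ` E y \<subseteq> V" by (auto simp: E_def)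
      fix X assume X: "X \<subseteq> V" "X \<noteq> {}"
      have "{e \<in> E y. snd e \<in> X \<and> fst e \<otimes>\<^bsub>G\<^esub> snd e \<in> X} = {(s, x). s \<in> S \<and> x \<in> X \<and> s \<otimes>\<^bsub>G\<^esub> x \<in> X \<and> (s, \<theta> x \<otimes>\<^bsub>Q\<^esub> y) \<in> \<Theta>}"
        using X(1) by (auto simp: E_def)
      moreover have "finite X" "X \<subseteq> carrier G" "inj_on \<theta> X"
        using X(1) finV VG Q(4) by (auto intro: finite_subset inj_on_subset)
      ultimately show "card {e \<in> E y. snd e \<in> X \<and> fst e \<otimes>\<^bsub>G\<^esub> snd e \<in> X} < card X"
        using Q(5)[unfolded forest_coordinates_def, THEN conjunct2, THEN conjunct2, rule_format, OF y, of X] X(2) by simp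
    qed
    then obtain \<tau> where \<tau>: "\<And>y. y \<in> carrier Q \<Longrightarrow> inj_on (\<tau> y) (E y)"
      "\<And>y e. y \<in> carrier Q \<Longrightarrow> e \<in> E y \<Longrightarrow> \<tau> y e = snd e \<or> \<tau> y e = fst e \<otimes>\<^bsub>G\<^esub> snd e" by metis
    \<comment> \<open>Marks the edges charged by the orientation to the end \<open>s x\<close>; the
      remaining ones are charged to \<open>x\<close>.\<close>
    define \<eta> where "\<eta> y s x = (if (s, x) \<in> E y \<and> \<tau> y (s, x) = s \<otimes>\<^bsub>G\<^esub> x then 1 else 0 :: real)" for y s x
    \<comment> \<open>At most one edge is charged to \<open>b\<close>, either a leaving one (counted
      by \<open>?X1\<close>) or an arriving one (counted by \<open>?X2\<close>). The leaving edges
      are those charged to their other end together with \<open>?X1\<close>, and |X1| is at most 1 -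
      |X2|.\<close>
    have deg: "real (card {s\<in>S. (s, \<theta> b \<otimes>\<^bsub>Q\<^esub> y) \<in> \<Theta>}) - 1 \<le> (\<Sum>s\<in>S. \<eta> y s b - \<eta> y s (inv\<^bsub>G\<^esub> s \<otimes>\<^bsub>G\<^esub> b))"
      if y: "y \<in> carrier Q" and b: "b \<in> B" for y b
    proof -
      have bG: "b \<in> carrier G" using b B by auto
      have E_b: "(s, b) \<in> E y \<longleftrightarrow> (s, \<theta> b \<otimes>\<^bsub>Q\<^esub> y) \<in> \<Theta>" if "s \<in> S" for s
        using that b by (auto simp: E_def V_def)
      let ?X1 = "{s\<in>S. (s, b) \<in> E y \<and> \<tau> y (s, b) \<noteq> s \<otimes>\<^bsub>G\<^esub> b}"
      let ?X2 = "{s\<in>S. (s, inv\<^bsub>G\<^esub> s \<otimes>\<^bsub>G\<^esub> b) \<in> E y \<and> \<tau> y (s, inv\<^bsub>G\<^esub> s \<otimes>\<^bsub>G\<^esub> b) = b}"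
      let ?Y1 = "(\<lambda>s. (s, b)) ` ?X1" and ?Y2 = "(\<lambda>s. (s, inv\<^bsub>G\<^esub> s \<otimes>\<^bsub>G\<^esub> b)) ` ?X2"
      have tail: "e \<in> E y \<and> \<tau> y e = b" if "e \<in> ?Y1 \<union> ?Y2" for e
        using that \<tau>(2)[OF y] by fastforce
      have "?Y1 \<inter> ?Y2 = {}"
        using S(2) bG by (auto simp: inv_mult_cancel)
      then have "card (?Y1 \<union> ?Y2) = card ?X1 + card ?X2"
        using S(1) by (subst card_Un_disjoint) (auto simp: card_image inj_on_def)
      moreover have "card (?Y1 \<union> ?Y2) \<le> Suc 0"
      proof (subst card_le_Suc0_iff_eq)
        show "finite (?Y1 \<union> ?Y2)" using S(1) by simp
        show "\<forall>e\<in>?Y1 \<union> ?Y2. \<forall>e'\<in>?Y1 \<union> ?Y2. e = e'"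
          using tail inj_onD[OF \<tau>(1)[OF y]] by (metis (no_types, lifting))
      qed
      ultimately have le1: "real (card ?X1) + real (card ?X2) \<le> 1" by linarith
      have ind: "(\<Sum>s\<in>S. if P s then 1 else 0 :: real) = card {s\<in>S. P s}" for P
        using S(1) by (simp add: sum.If_cases Int_def conj_commute)
      have "card {s\<in>S. (s, \<theta> b \<otimes>\<^bsub>Q\<^esub> y) \<in> \<Theta>} = card ({s\<in>S. (s, b) \<in> E y \<and> \<tau> y (s, b) = s \<otimes>\<^bsub>G\<^esub> b} \<union> ?X1)"
        using E_b by (intro arg_cong[of _ _ card]) auto
      also have "\<dots> = card {s\<in>S. (s, b) \<in> E y \<and> \<tau> y (s, b) = s \<otimes>\<^bsub>G\<^esub> b} + card ?X1"
        using S(1) by (intro card_Un_disjoint) auto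
      finally have d: "card {s\<in>S. (s, \<theta> b \<otimes>\<^bsub>Q\<^esub> y) \<in> \<Theta>} = card {s\<in>S. (s, b) \<in> E y \<and> \<tau> y (s, b) = s \<otimes>\<^bsub>G\<^esub> b} + card ?X1" .
      have "(\<Sum>s\<in>S. \<eta> y s b) = card {s\<in>S. (s, b) \<in> E y \<and> \<tau> y (s, b) = s \<otimes>\<^bsub>G\<^esub> b}"
        unfolding \<eta>_def by (rule ind)
      moreover have "(\<Sum>s\<in>S. \<eta> y s (inv\<^bsub>G\<^esub> s \<otimes>\<^bsub>G\<^esub> b)) = card ?X2"
        unfolding ind[symmetric] \<eta>_def using S(2) bG by (intro sum.cong HOL.refl) (auto simp: inv_mult_cancel)
      ultimately show ?thesis using le1 d by (simp add: sum_subtractf)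
    qed
    let ?n = "real (card (carrier Q))"
    have n: "?n > 0" using Q(1,2) group.is_monoid monoid.one_closed by (fastforce simp: card_gt_0_iff)
    \<comment> \<open>The averages of \<open>\<eta>\<close> over all base points, with the shift by
      the inverse of \<open>s\<close> and the sign chosen so that \<psi>(s, b) - \<psi>(s, s b)
      becomes the averaged right-hand side of \<open>deg\<close>. Averages of 0 and 1 keep \<psi>
      between -1 and 0.\<close>
    define \<psi> where "\<psi> = (\<lambda>(s, x). - (\<Sum>y\<in>carrier Q. \<eta> y s (inv\<^bsub>G\<^esub> s \<otimes>\<^bsub>G\<^esub> x)) / ?n)"
    have "-1 \<le> \<psi> e \<and> \<psi> e \<le> 0" for e
    proof -
      obtain s x where e: "e = (s, x)" by force
      have "(\<Sum>y\<in>carrier Q. \<eta> y s (inv\<^bsub>G\<^esub> s \<otimes>\<^bsub>G\<^esub> x)) \<le> (\<Sum>y\<in>carrier Q. 1)"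
        by (intro sum_mono) (simp add: \<eta>_def)
      moreover have "0 \<le> (\<Sum>y\<in>carrier Q. \<eta> y s (inv\<^bsub>G\<^esub> s \<otimes>\<^bsub>G\<^esub> x))"
        by (intro sum_nonneg) (simp add: \<eta>_def)
      ultimately show ?thesis using n by (simp add: e \<psi>_def field_simps)
    qed
    moreover have "\<epsilon> \<le> (\<Sum>s\<in>S. \<psi> (s, b) - \<psi> (s, s \<otimes>\<^bsub>G\<^esub> b))" if b: "b \<in> B" for b
    proof -
      have bG: "b \<in> carrier G" using b B by auto
      have "real (card \<Theta>) - ?n = (\<Sum>y\<in>carrier Q. real (card {s\<in>S. (s, \<theta> b \<otimes>\<^bsub>Q\<^esub> y) \<in> \<Theta>}) - 1)"
        using sum_degrees[OF G Q(1,3,2) S(1) _ bG, of \<Theta>] Q(5)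
        by (simp add: forest_coordinates_def sum_subtractf flip: of_nat_sum)
      also have "\<dots> \<le> (\<Sum>y\<in>carrier Q. \<Sum>s\<in>S. \<eta> y s b - \<eta> y s (inv\<^bsub>G\<^esub> s \<otimes>\<^bsub>G\<^esub> b))"
        by (intro sum_mono deg b)
      also have "\<dots> = (\<Sum>s\<in>S. \<Sum>y\<in>carrier Q. \<eta> y s b - \<eta> y s (inv\<^bsub>G\<^esub> s \<otimes>\<^bsub>G\<^esub> b))" by (rule sum.swap)
      also have "\<dots> = (\<Sum>s\<in>S. (\<psi> (s, b) - \<psi> (s, s \<otimes>\<^bsub>G\<^esub> b)) * ?n)"
      proof (intro sum.cong HOL.refl)
        fix s assume "s \<in> S"
        then have "inv\<^bsub>G\<^esub> s \<otimes>\<^bsub>G\<^esub> (s \<otimes>\<^bsub>G\<^esub> b) = b" using S(2) bG by (auto simp: inv_mult_cancel)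
        then show "(\<Sum>y\<in>carrier Q. \<eta> y s b - \<eta> y s (inv\<^bsub>G\<^esub> s \<otimes>\<^bsub>G\<^esub> b)) = (\<psi> (s, b) - \<psi> (s, s \<otimes>\<^bsub>G\<^esub> b)) * ?n"
          using n by (simp add: \<psi>_def sum_subtractf field_simps)
      qed
      also have "\<dots> = (\<Sum>s\<in>S. \<psi> (s, b) - \<psi> (s, s \<otimes>\<^bsub>G\<^esub> b)) * ?n" by (simp add: sum_distrib_right)
      finally have "real (card \<Theta>) - ?n \<le> (\<Sum>s\<in>S. \<psi> (s, b) - \<psi> (s, s \<otimes>\<^bsub>G\<^esub> b)) * ?n" .
      moreover have "\<epsilon> * ?n \<le> real (card \<Theta>) - ?n" using Q(6) by (simp add: algebra_simps)
      ultimately have "\<epsilon> * ?n \<le> (\<Sum>s\<in>S. \<psi> (s, b) - \<psi> (s, s \<otimes>\<^bsub>G\<^esub> b)) * ?n" by linarith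
      then show ?thesis using n by simp
    qed
    ultimately show "\<exists>\<psi>::'g \<times> 'g \<Rightarrow> real. (\<forall>e. -1 \<le> \<psi> e \<and> \<psi> e \<le> 0) \<and>
        (\<forall>b\<in>B. \<epsilon> \<le> (\<Sum>s\<in>S. \<psi> (s, b) - \<psi> (s, s \<otimes>\<^bsub>G\<^esub> b)))" by blast
  qed
qed

section \<open>The HNN extension as a group\<close>

locale hnn =
  fixes K :: "('a, 'b) monoid_scheme" and A B :: "'a set" and \<phi> :: "'a \<Rightarrow> 'a"
  assumes K: "group K" and A: "subgroup A K" and B: "subgroup B K"
    and iso: "\<phi> \<in> iso (K\<lparr>carrier := A\<rparr>) (K\<lparr>carrier := B\<rparr>)"
begin

sublocale K: group K by (fact K)

definition \<Gamma> where "\<Gamma> = hnn_extension K A \<phi>"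
definition base where "base = hnn_base K A \<phi>"
definition cls where "cls = hnn_class K A \<phi>"
definition st where "st = cls [Stable]"

lemma Ac: "a \<in> A \<Longrightarrow> a \<in> carrier K"
  by (rule subgroup.mem_carrier[OF A])

lemma bij_\<phi>: "bij_betw \<phi> A B"
  using iso by (simp add: iso_def)

lemma \<phi>B: "a \<in> A \<Longrightarrow> \<phi> a \<in> B"
  using bij_\<phi> by (rule bij_betwE[rule_format])

lemma \<phi>_carrier: "a \<in> A \<Longrightarrow> \<phi> a \<in> carrier K"
  using \<phi>B subgroup.mem_carrier[OF B] by blast

lemma \<phi>_mult: "a \<in> A \<Longrightarrow> b \<in> A \<Longrightarrow> \<phi> (a \<otimes>\<^bsub>K\<^esub> b) = \<phi> a \<otimes>\<^bsub>K\<^esub> \<phi> b"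
  using iso by (simp add: iso_def hom_def)

lemma A_subset: "A \<subseteq> carrier K" and \<phi>_subset: "\<phi> ` A \<subseteq> carrier K"
  using Ac \<phi>_carrier by auto

lemmas pre = K A_subset \<phi>_subset

sublocale \<Gamma>: group \<Gamma>
  unfolding \<Gamma>_def by (rule group_hnn_extension[OF pre])

lemma cong_words: "hnn_cong K A \<phi> u v \<Longrightarrow> u \<in> hnn_words K \<and> v \<in> hnn_words K"
  by (rule hnn_cong_words[OF pre])

lemma cls_eq_iff: "u \<in> hnn_words K \<Longrightarrow> cls u = cls v \<longleftrightarrow> hnn_cong K A \<phi> u v"
  unfolding cls_def by (rule hnn_class_eq_iff[OF pre])

lemma cls_mult: "u \<in> hnn_words K \<Longrightarrow> v \<in> hnn_words K \<Longrightarrow> cls u \<otimes>\<^bsub>\<Gamma>\<^esub> cls v = cls (u @ v)"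
  unfolding cls_def \<Gamma>_def by (rule hnn_mult_class[OF pre])

lemma carrier_\<Gamma>: "carrier \<Gamma> = cls ` hnn_words K"
  unfolding cls_def \<Gamma>_def by (rule hnn_carrier[OF pre])

lemma one_\<Gamma>: "\<one>\<^bsub>\<Gamma>\<^esub> = cls []"
  unfolding cls_def \<Gamma>_def by (rule hnn_one[OF pre])

lemma base_cls: "base x = cls [Elem x]"
  by (simp add: base_def cls_def hnn_base_def)

lemma base_hom: "base \<in> hom K \<Gamma>"
  unfolding base_def \<Gamma>_def by (rule hnn_base_hom[OF pre])

lemma st_carrier: "st \<in> carrier \<Gamma>"
  by (auto simp: st_def carrier_\<Gamma> hnn_words_def)

lemma st_base: "a \<in> A \<Longrightarrow> st \<otimes>\<^bsub>\<Gamma>\<^esub> base a = base (\<phi> a) \<otimes>\<^bsub>\<Gamma>\<^esub> st"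
proof -
  assume a: "a \<in> A"
  interpret h: group_hom K \<Gamma> base using base_hom K by (simp add: group_hom_def group_hom_axioms_def)
  have "st \<otimes>\<^bsub>\<Gamma>\<^esub> base a \<otimes>\<^bsub>\<Gamma>\<^esub> inv\<^bsub>\<Gamma>\<^esub> st = base (\<phi> a)"
    using hnn_conj[OF pre a] by (simp add: st_def cls_def base_def \<Gamma>_def)
  then show ?thesis
    using \<Gamma>.inv_solve_right'[of "base (\<phi> a)" "st \<otimes>\<^bsub>\<Gamma>\<^esub> base a" st] st_carrier Ac[OF a] \<phi>_carrier[OF a] by simp
qed

lemma \<Gamma>_generated: "generate \<Gamma> (insert st (base ` carrier K)) = carrier \<Gamma>" (is "generate \<Gamma> ?S = _")
proof
  interpret h: group_hom K \<Gamma> base using base_hom K by (simp add: group_hom_def group_hom_axioms_def)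
  have S: "?S \<subseteq> carrier \<Gamma>" using st_carrier by auto
  show "generate \<Gamma> ?S \<subseteq> carrier \<Gamma>" using \<Gamma>.generate_incl[OF S] .
  have "w \<in> hnn_words K \<Longrightarrow> cls w \<in> generate \<Gamma> ?S" for w
  proof (induction w)
    case Nil
    then show ?case by (metis generate.one one_\<Gamma>)
  next
    case (Cons l w)
    then have w: "w \<in> hnn_words K" "cls w \<in> generate \<Gamma> ?S" and l: "[l] \<in> hnn_words K"
      by (auto simp: hnn_words_def)
    have "cls [l] \<in> generate \<Gamma> ?S"
    proof (cases l)
      case (Elem x)
      then have "x \<in> carrier K" using l by (auto simp: hnn_words_def)
      then show ?thesis using Elem by (auto simp: base_cls[symmetric] intro!: generate.incl)
    next
      case Stable
      then show ?thesis by (auto simp: st_def[symmetric] intro!: generate.incl)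
    next
      case Stable_inv
      have s: "[Stable] \<in> hnn_words K" "[Stable_inv] \<in> hnn_words K" "[Stable_inv, Stable] \<in> hnn_words K"
        by (auto simp: hnn_words_def)
      have "cls [Stable_inv] \<otimes>\<^bsub>\<Gamma>\<^esub> st = \<one>\<^bsub>\<Gamma>\<^esub>"
        unfolding st_def one_\<Gamma> using s by (simp add: cls_mult cls_eq_iff hnn_cong.stable_left)
      then have "inv\<^bsub>\<Gamma>\<^esub> st = cls [Stable_inv]"
        using s st_carrier by (intro \<Gamma>.inv_equality) (auto simp: carrier_\<Gamma>)
      then show ?thesis using Stable_inv generate.inv[of st ?S \<Gamma>] by simp
    qed
    then have "cls [l] \<otimes>\<^bsub>\<Gamma>\<^esub> cls w \<in> generate \<Gamma> ?S" using w(2) by (rule generate.eng)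
    then show ?case using cls_mult[OF l w(1)] by simp
  qed
  then show "carrier \<Gamma> \<subseteq> generate \<Gamma> ?S" by (auto simp: carrier_\<Gamma>)
qed

text \<open>To see that \<open>K\<close> embeds, let \<open>K\<close> act on \<open>K \<times> I\<close>. If \<open>I\<close> is infinite and at least as large as \<open>K\<close>, then \<open>K \<times> I\<close> has equally many
  (regular) orbits under \<open>A\<close> and under \<open>B\<close>, so the stable letter can act by a \<open>\<phi>\<close>-equivariant permutation.\<close>

lemma equivariant_permutation:
  obtains T :: "'a \<times> 'a list \<Rightarrow> 'a \<times> 'a list" where
    "bij_betw T (carrier K \<times> UNIV) (carrier K \<times> UNIV)"
    "\<And>a k i. a \<in> A \<Longrightarrow> k \<in> carrier K \<Longrightarrow> T (a \<otimes>\<^bsub>K\<^esub> k, i) = (\<phi> a \<otimes>\<^bsub>K\<^esub> fst (T (k, i)), snd (T (k, i)))"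
proof -
  define r where "r C k = (SOME y. y \<in> C #>\<^bsub>K\<^esub> k)" for C k
  have r_mem: "r C k \<in> C #>\<^bsub>K\<^esub> k" if "subgroup C K" "k \<in> carrier K" for C k
    unfolding r_def using K.rcos_self[OF that(2,1)] by (rule someI)
  have rc: "r C k \<in> carrier K" if "subgroup C K" "k \<in> carrier K" for C k
    using r_mem[OF that] K.r_coset_subset_G[OF subgroup.subset[OF that(1)] that(2)] by blast
  have r_mult: "r C (c \<otimes>\<^bsub>K\<^esub> k) = r C k" if "subgroup C K" "k \<in> carrier K" "c \<in> C" for C c k
  proof -
    have "c \<otimes>\<^bsub>K\<^esub> k \<in> C #>\<^bsub>K\<^esub> k" using that by (auto simp: r_coset_def)
    then show ?thesis using K.repr_independence[OF _ that(2,1)] by (simp add: r_def)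
  qed
  have r_split: "\<exists>c\<in>C. k = c \<otimes>\<^bsub>K\<^esub> r C k" if C: "subgroup C K" and k: "k \<in> carrier K" for C k
  proof -
    obtain c where c: "c \<in> C" "r C k = c \<otimes>\<^bsub>K\<^esub> k" using r_mem[OF C k] by (auto simp: r_coset_def)
    have "k = inv\<^bsub>K\<^esub> c \<otimes>\<^bsub>K\<^esub> r C k" using c k subgroup.mem_carrier[OF C c(1)] by (simp add: K.inv_mult_cancel)
    then show ?thesis using subgroup.m_inv_closed[OF C c(1)] by blast
  qed
  have rr: "r C (r C k) = r C k" if C: "subgroup C K" and k: "k \<in> carrier K" for C k
  proof -
    obtain c where c: "c \<in> C" "k = c \<otimes>\<^bsub>K\<^esub> r C k" using r_split[OF C k] by blast
    have "r C k = r C (c \<otimes>\<^bsub>K\<^esub> r C k)" using c(2) by simp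
    also have "\<dots> = r C (r C k)" by (rule r_mult[OF C rc[OF C k] c(1)])
    finally show ?thesis by simp
  qed
  define R where "R C = r C ` carrier K" for C
  have Rc: "x \<in> carrier K \<and> r C x = x" if "subgroup C K" "x \<in> R C" for C x
    using that rr rc by (auto simp: R_def)
  \<comment> \<open>The lists over the element type of K are infinite even when K is finite, and
    they contain a copy of every transversal \<open>R C\<close>; so both transversals times lists
    have the cardinality of the lists.\<close>
  have card: "(card_of (R C \<times> (UNIV :: 'a list set)), card_of (UNIV :: 'a list set)) \<in> ordIso" if C: "subgroup C K" for C
  proof -
    have "infinite (UNIV :: 'a list set)" by (rule infinite_UNIV_listI)
    moreover have "R C \<noteq> {}" using K.one_closed by (auto simp: R_def)
    moreover have "(card_of (R C), card_of (UNIV :: 'a list set)) \<in> ordLeq"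
    proof -
      have "inj_on (\<lambda>x. [x]) (R C)" by (rule inj_onI) simp
      then show ?thesis unfolding card_of_ordLeq[symmetric] by blast
    qed
    ultimately show ?thesis by (rule card_of_Times_infinite[THEN conjunct2])
  qed
  have "(card_of (R A \<times> (UNIV :: 'a list set)), card_of (R B \<times> (UNIV :: 'a list set))) \<in> ordIso"
    by (rule ordIso_transitive[OF card[OF A] ordIso_symmetric[OF card[OF B]]])
  then obtain f where f: "bij_betw f (R A \<times> (UNIV :: 'a list set)) (R B \<times> (UNIV :: 'a list set))"
    unfolding card_of_ordIso[symmetric] by (elim exE)
  define \<alpha> where "\<alpha> k = k \<otimes>\<^bsub>K\<^esub> inv\<^bsub>K\<^esub> r A k" for k
  have \<alpha>: "\<alpha> (a \<otimes>\<^bsub>K\<^esub> x) = a" if "a \<in> A" "x \<in> R A" for a x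
    using that Rc[OF A] Ac r_mult[OF A, of x a] by (simp add: \<alpha>_def K.m_assoc)
  have split: "\<alpha> k \<in> A \<and> k = \<alpha> k \<otimes>\<^bsub>K\<^esub> r A k" if k: "k \<in> carrier K" for k
  proof -
    obtain a where a: "a \<in> A" "k = a \<otimes>\<^bsub>K\<^esub> r A k" using r_split[OF A k] by blast
    have "\<alpha> (a \<otimes>\<^bsub>K\<^esub> r A k) = a" using k by (intro \<alpha> a) (simp add: R_def)
    then have "\<alpha> k = a" using a(2) by simp
    then show ?thesis using a by simp
  qed
  \<comment> \<open>\<open>f\<close> matches the orbits of A with those of B, one representative for
    another; the factor in A is then transported by \<open>\<phi>\<close>.\<close>
  define T where "T = (\<lambda>(k, i). (\<phi> (\<alpha> k) \<otimes>\<^bsub>K\<^esub> fst (f (r A k, i)), snd (f (r A k, i))))"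
  have fR: "fst (f (r A k, i)) \<in> R B" if "k \<in> carrier K" for k i
    using bij_betwE[OF f, rule_format, of "(r A k, i)"] that by (auto simp: R_def)
  have "bij_betw T (carrier K \<times> UNIV) (carrier K \<times> UNIV)"
  proof (rule bij_betwI')
    fix y y' :: "'a \<times> 'a list" assume y: "y \<in> carrier K \<times> UNIV" "y' \<in> carrier K \<times> UNIV"
    obtain k i k' i' where yk: "y = (k, i)" "y' = (k', i')" by force
    have k: "k \<in> carrier K" "k' \<in> carrier K" using y yk by auto
    show "(T y = T y') = (y = y')"
    proof
      assume eq: "T y = T y'"
      let ?x = "fst (f (r A k, i))" and ?x' = "fst (f (r A k', i'))"
      have x: "?x \<in> R B" "?x' \<in> R B" using fR k by auto
      have e1: "\<phi> (\<alpha> k) \<otimes>\<^bsub>K\<^esub> ?x = \<phi> (\<alpha> k') \<otimes>\<^bsub>K\<^esub> ?x'" and e2: "snd (f (r A k, i)) = snd (f (r A k', i'))"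
        using eq by (auto simp: T_def yk)
      have "r B (\<phi> (\<alpha> k) \<otimes>\<^bsub>K\<^esub> ?x) = ?x" "r B (\<phi> (\<alpha> k') \<otimes>\<^bsub>K\<^esub> ?x') = ?x'"
        using r_mult[OF B] \<phi>B split k x Rc[OF B] by auto
      then have xx: "?x = ?x'" using e1 by simp
      then have "\<phi> (\<alpha> k) = \<phi> (\<alpha> k')"
        using e1 x(2) Rc[OF B x(2)] \<phi>_carrier split[OF k(1)] split[OF k(2)] by simp
      then have aa: "\<alpha> k = \<alpha> k'" using inj_onD[OF bij_betw_imp_inj_on[OF bij_\<phi>], of "\<alpha> k" "\<alpha> k'"] split[OF k(1)] split[OF k(2)] by blast
      have "f (r A k, i) = f (r A k', i')" using xx e2 by (rule prod_eqI)
      then have "(r A k, i) = (r A k', i')"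
        by (rule inj_onD[OF bij_betw_imp_inj_on[OF f]]) (use k in \<open>auto simp: R_def\<close>)
      then show "y = y'" using aa split[OF k(1)] split[OF k(2)] yk by simp
    qed simp
  next
    fix y :: "'a \<times> 'a list" assume "y \<in> carrier K \<times> UNIV"
    then obtain k i where "y = (k, i)" "k \<in> carrier K" by auto
    then show "T y \<in> carrier K \<times> UNIV"
      using Rc[OF B fR[of k i]] \<phi>_carrier split[of k] by (simp add: T_def)
  next
    fix y :: "'a \<times> 'a list" assume "y \<in> carrier K \<times> UNIV"
    then obtain k' i' where y: "y = (k', i')" "k' \<in> carrier K" by auto
    obtain b where b: "b \<in> B" "k' = b \<otimes>\<^bsub>K\<^esub> r B k'" using r_split[OF B y(2)] by blast
    obtain a where a: "a \<in> A" "b = \<phi> a" using bij_\<phi> b(1) by (auto simp: bij_betw_def)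
    have "(r B k', i') \<in> f ` (R A \<times> UNIV)" using f y(2) by (auto simp: bij_betw_def R_def)
    then obtain x i where x: "x \<in> R A" "f (x, i) = (r B k', i')" by auto
    have "r A (a \<otimes>\<^bsub>K\<^esub> x) = x" using r_mult[OF A _ a(1)] Rc[OF A x(1)] by simp
    then have "T (a \<otimes>\<^bsub>K\<^esub> x, i) = y" using \<alpha>[OF a(1) x(1)] x(2) a(2) b(2) y(1) by (simp add: T_def)
    moreover have "a \<otimes>\<^bsub>K\<^esub> x \<in> carrier K" using Ac[OF a(1)] Rc[OF A x(1)] by simp
    ultimately show "\<exists>x\<in>carrier K \<times> UNIV. y = T x" by blast
  qed
  moreover have "T (a \<otimes>\<^bsub>K\<^esub> k, i) = (\<phi> a \<otimes>\<^bsub>K\<^esub> fst (T (k, i)), snd (T (k, i)))" if a: "a \<in> A" and k: "k \<in> carrier K" for a k i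
  proof -
    have "\<alpha> (a \<otimes>\<^bsub>K\<^esub> k) = a \<otimes>\<^bsub>K\<^esub> \<alpha> k"
      using r_mult[OF A k a] Ac[OF a] k rc[OF A k] by (simp add: \<alpha>_def K.m_assoc)
    moreover have "fst (f (r A k, i)) \<in> carrier K" using fR[OF k] Rc[OF B] by blast
    ultimately show ?thesis
      using r_mult[OF A k a] \<phi>_mult[OF a, of "\<alpha> k"] \<phi>_carrier a split[OF k] by (simp add: T_def K.m_assoc)
  qed
  ultimately show ?thesis by (rule that)
qed

text \<open>Words act on the set with the permutation \<open>T\<close> for the stable letter, and
  congruent words act alike. An element x of K moves (1, []) to (x, []), so it can be read off from
  its action.\<close>

lemma base_eq_one: assumes x: "x \<in> carrier K" and eq: "base x = \<one>\<^bsub>\<Gamma>\<^esub>" shows "x = \<one>\<^bsub>K\<^esub>"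
proof -
  let ?Y = "carrier K \<times> (UNIV :: 'a list set)"
  obtain T :: "'a \<times> 'a list \<Rightarrow> 'a \<times> 'a list" where T: "bij_betw T ?Y ?Y"
    "\<And>a k i. a \<in> A \<Longrightarrow> k \<in> carrier K \<Longrightarrow> T (a \<otimes>\<^bsub>K\<^esub> k, i) = (\<phi> a \<otimes>\<^bsub>K\<^esub> fst (T (k, i)), snd (T (k, i)))"
    by (rule equivariant_permutation) blast
  define T' where "T' = inv_into ?Y T"
  have TY: "T y \<in> ?Y" if "y \<in> ?Y" for y using bij_betwE[OF T(1)] that by blast
  have T'Y: "T' y \<in> ?Y" if "y \<in> ?Y" for y
    using bij_betwE[OF bij_betw_inv_into[OF T(1)]] that unfolding T'_def by blast
  have TT': "T (T' y) = y" if "y \<in> ?Y" for y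
    unfolding T'_def using bij_betw_inv_into_right[OF T(1) that] .
  have T'T: "T' (T y) = y" if "y \<in> ?Y" for y
    unfolding T'_def using bij_betw_inv_into_left[OF T(1) that] .
  define act where "act l = (case l of Elem x \<Rightarrow> \<lambda>(k, i). (x \<otimes>\<^bsub>K\<^esub> k, i) | Stable \<Rightarrow> T | Stable_inv \<Rightarrow> T')" for l
  have act_simps: "act (Elem x) (k, i) = (x \<otimes>\<^bsub>K\<^esub> k, i)" "act Stable = T" "act Stable_inv = T'" for x k i
    by (auto simp: act_def)
  have act_mem: "act l y \<in> ?Y" if "[l] \<in> hnn_words K" "y \<in> ?Y" for l y
  proof (cases l)
    case (Elem x)
    then show ?thesis using that by (cases y) (auto simp: act_simps hnn_words_def)
  next
    case Stable
    then show ?thesis using TY[OF that(2)] by (simp only: act_simps)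
  next
    case Stable_inv
    then show ?thesis using T'Y[OF that(2)] by (simp only: act_simps)
  qed
  have mem: "foldr act w y \<in> ?Y" if "w \<in> hnn_words K" "y \<in> ?Y" for w y
    using that
  proof (induction w)
    case (Cons l w)
    then have "foldr act w y \<in> ?Y" "[l] \<in> hnn_words K" by (simp_all add: hnn_words_def)
    then show ?case using act_mem by (simp only: foldr.simps comp_apply)
  qed simp
  have inv: "\<forall>y\<in>?Y. foldr act u y = foldr act v y" if "hnn_cong K A \<phi> u v" for u v
    using that
  proof (induction rule: hnn_cong.induct)
    case (append u u' v v')
    then have v': "v' \<in> hnn_words K" using cong_words by blast
    show ?case
    proof
      fix y assume y: "y \<in> ?Y"
      then have "foldr act v y = foldr act v' y" using append.IH(2) by (rule bspec[rotated])
      moreover have "foldr act u (foldr act v' y) = foldr act u' (foldr act v' y)"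
        using mem[OF v' y] append.IH(1) by (rule bspec[rotated])
      ultimately show "foldr act (u @ v) y = foldr act (u' @ v') y" by simp
    qed
  next
    case (conj a)
    show ?case
    proof
      fix y assume y: "y \<in> ?Y"
      obtain k i where ki: "T' y = (k, i)" "k \<in> carrier K" using T'Y[OF y] by force
      \<comment> \<open>Equivariance of \<open>T\<close> is precisely the HNN relation for the
        action.\<close>
      have "T (a \<otimes>\<^bsub>K\<^esub> k, i) = (\<phi> a \<otimes>\<^bsub>K\<^esub> fst y, snd y)" using T(2)[OF conj ki(2)] TT'[OF y] ki(1) by simp
      then show "foldr act [Stable, Elem a, Stable_inv] y = foldr act [Elem (\<phi> a)] y"
        using ki by (cases y) (simp add: act_simps)
    qed
  qed (auto simp: act_simps TT' T'T K.m_assoc)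
  have "hnn_cong K A \<phi> [Elem x] []"
    using eq x cls_eq_iff[of "[Elem x]" "[]"] by (simp add: base_cls one_\<Gamma> hnn_words_def)
  from inv[OF this, rule_format, of "(\<one>\<^bsub>K\<^esub>, [])"] show ?thesis using x by (simp add: act_simps)
qed

end

text \<open>A cocycle is determined by its values on K and the stable letter. Conversely, a solution
  of the relations is evaluated letter by letter along words; every defining congruence preserves
  the result, so it descends to classes of words.\<close>

lemma (in prime_coeff) card_cocycles_hnn:
  fixes K :: "('a, 'b) monoid_scheme" and Q :: "('q, 'c) monoid_scheme"
  assumes hnn: "hnn K A B \<phi>" and Q: "group Q" and \<pi>: "\<pi> \<in> hom (hnn.\<Gamma> K A \<phi>) Q"
  shows "card (cocycles (hnn.\<Gamma> K A \<phi>) Q \<pi>) =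
    card (hcocycles K A \<phi> Q (\<lambda>x. \<pi> (hnn.base K A \<phi> x)) (\<pi> (hnn.st K A \<phi>)))"
proof -
  interpret hnn K A B \<phi> by (fact hnn)
  interpret \<pi>: group_hom \<Gamma> Q \<pi> using Q \<pi> \<Gamma>.group_axioms by (simp add: group_hom_def group_hom_axioms_def)
  interpret b: group_hom K \<Gamma> base using base_hom K by (simp add: group_hom_def group_hom_axioms_def)
  define \<theta> where "\<theta> x = \<pi> (base x)" for x
  define t where "t = \<pi> st"
  have tc: "t \<in> carrier Q" using st_carrier by (simp add: t_def)
  have \<theta>c: "\<theta> x \<in> carrier Q" if "x \<in> carrier K" for x using that by (simp add: \<theta>_def)
  define R where "R c = (\<lambda>(l, x). case l of Some g \<Rightarrow> if g \<in> carrier K then c (base g, x) else 0 | None \<Rightarrow> c (st, x))"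
    for c :: "'a hnn_letter list set \<times> 'q \<Rightarrow> 'f"
  have R_simps: "R c (None, x) = c (st, x)" "g \<in> carrier K \<Longrightarrow> R c (Some g, x) = c (base g, x)"
    "g \<notin> carrier K \<Longrightarrow> R c (Some g, x) = 0" for c x g
    by (auto simp: R_def)
  have "bij_betw R (cocycles \<Gamma> Q \<pi>) (hcocycles K A \<phi> Q \<theta> t)"
  proof (rule bij_betwI')
    fix c d assume cd: "c \<in> cocycles \<Gamma> Q \<pi>" "d \<in> cocycles \<Gamma> Q \<pi>"
    show "(R c = R d) = (c = d)"
    proof
      assume eq: "R c = R d"
      show "c = d"
      proof (rule cocycles_eqI[OF \<Gamma>.group_axioms Q \<pi> cd _ \<Gamma>_generated])
        show "insert st (base ` carrier K) \<subseteq> carrier \<Gamma>" using st_carrier by auto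
        fix s x assume "s \<in> insert st (base ` carrier K)"
        then consider "s = st" | g where "g \<in> carrier K" "s = base g" by auto
        then show "c (s, x) = d (s, x)"
        proof cases
          case 1
          then show ?thesis using fun_cong[OF eq, of "(None, x)"] by (simp add: R_simps)
        next
          case 2
          then show ?thesis using fun_cong[OF eq, of "(Some g, x)"] by (simp add: R_simps)
        qed
      qed
    qed (simp only:)
  next
    fix c assume c: "c \<in> cocycles \<Gamma> Q \<pi>"
    show "R c \<in> hcocycles K A \<phi> Q \<theta> t"
    proof (rule hcocyclesI)
      show "(\<lambda>(g, x). R c (Some g, x)) \<in> cocycles K Q \<theta>"
      proof (rule cocyclesI)
        fix g x assume "g \<notin> carrier K \<or> x \<notin> carrier Q"
        then show "(case (g, x) of (g, x) \<Rightarrow> R c (Some g, x)) = 0"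
          using cocycles_outside[OF c, of "base g" x] by (cases "g \<in> carrier K") (simp_all add: R_simps)
      qed (simp_all add: R_simps cocycles_F[OF c] cocycles_mult[OF c] \<theta>_def)
      show "R c (None, x) \<in> F" for x by (simp add: R_simps cocycles_F[OF c])
      show "R c (None, x) = 0" if "x \<notin> carrier Q" for x using that cocycles_outside[OF c] by (simp add: R_simps)
      fix a x assume a: "a \<in> A" and x: "x \<in> carrier Q"
      have "c (st \<otimes>\<^bsub>\<Gamma>\<^esub> base a, x) = c (st, \<theta> a \<otimes>\<^bsub>Q\<^esub> x) + c (base a, x)"
        using cocycles_mult[OF c st_carrier _ x, of "base a"] Ac[OF a] by (simp add: \<theta>_def)
      moreover have "c (base (\<phi> a) \<otimes>\<^bsub>\<Gamma>\<^esub> st, x) = c (base (\<phi> a), t \<otimes>\<^bsub>Q\<^esub> x) + c (st, x)"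
        using cocycles_mult[OF c _ st_carrier x, of "base (\<phi> a)"] \<phi>_carrier[OF a] by (simp add: t_def)
      ultimately show "R c (None, \<theta> a \<otimes>\<^bsub>Q\<^esub> x) + R c (Some a, x) - R c (None, x) = R c (Some (\<phi> a), t \<otimes>\<^bsub>Q\<^esub> x)"
        using st_base[OF a] Ac[OF a] \<phi>_carrier[OF a] by (simp add: R_simps algebra_simps)
    qed
  next
    fix c assume c: "c \<in> hcocycles K A \<phi> Q \<theta> t"
    note c1 = hcocyclesD(1)[OF c]
    \<comment> \<open>The value on the inverse letter is forced by the cocycle identity for the
      product of the stable letter with its inverse.\<close>
    define lval where "lval l x = (case l of Elem g \<Rightarrow> c (Some g, x) | Stable \<Rightarrow> c (None, x)
      | Stable_inv \<Rightarrow> - c (None, inv\<^bsub>Q\<^esub> t \<otimes>\<^bsub>Q\<^esub> x))" for l x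
    \<comment> \<open>Words act from the right end: the first letter is evaluated at the point to
      which the rest of the word has moved \<open>x\<close>.\<close>
    define wval where "wval = rec_list (\<lambda>x. 0) (\<lambda>l w v x. lval l (\<pi> (cls w) \<otimes>\<^bsub>Q\<^esub> x) + v x)"
    have wval_simps: "wval [] x = 0" "wval (l # w) x = lval l (\<pi> (cls w) \<otimes>\<^bsub>Q\<^esub> x) + wval w x" for l w x
      by (simp_all add: wval_def)
    have words: "w \<in> hnn_words K" "[l] \<in> hnn_words K" if "l # w \<in> hnn_words K" for l w
      using that by (auto simp: hnn_words_def)
    have cls_c: "cls w \<in> carrier \<Gamma>" if "w \<in> hnn_words K" for w using that by (simp add: carrier_\<Gamma>)
    have wval_append: "wval (u @ v) x = wval u (\<pi> (cls v) \<otimes>\<^bsub>Q\<^esub> x) + wval v x"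
      if "u \<in> hnn_words K" "v \<in> hnn_words K" "x \<in> carrier Q" for u v x
      using that(1)
    proof (induction u)
      case (Cons l u)
      note u = words(1)[OF Cons.prems]
      have "\<pi> (cls (u @ v)) \<otimes>\<^bsub>Q\<^esub> x = \<pi> (cls u) \<otimes>\<^bsub>Q\<^esub> (\<pi> (cls v) \<otimes>\<^bsub>Q\<^esub> x)"
        using cls_mult[OF u that(2), symmetric] cls_c[OF u] cls_c[OF that(2)] that(3)
        by (simp add: \<pi>.H.m_assoc)
      then show ?case using Cons.IH[OF u] by (simp add: wval_simps algebra_simps)
    qed (simp add: wval_simps)
    have \<pi>_nil: "\<pi> (cls []) = \<one>\<^bsub>Q\<^esub>" by (simp flip: one_\<Gamma>)
    have \<pi>_elem: "\<pi> (cls [Elem g]) = \<theta> g" for g by (simp add: \<theta>_def base_cls)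
    have sw: "[Stable] \<in> hnn_words K" "[Stable_inv] \<in> hnn_words K" "[Stable, Stable_inv] \<in> hnn_words K"
      "[Stable_inv, Stable] \<in> hnn_words K" by (auto simp: hnn_words_def)
    have "cls [Stable_inv] \<otimes>\<^bsub>\<Gamma>\<^esub> st = \<one>\<^bsub>\<Gamma>\<^esub>"
      unfolding st_def one_\<Gamma> using sw by (simp add: cls_mult cls_eq_iff hnn_cong.stable_left)
    then have "inv\<^bsub>\<Gamma>\<^esub> st = cls [Stable_inv]"
      using sw st_carrier cls_c by (intro \<Gamma>.inv_equality) auto
    then have \<pi>_inv: "\<pi> (cls [Stable_inv]) = inv\<^bsub>Q\<^esub> t" using st_carrier by (simp add: t_def flip: \<pi>.hom_inv)
    have \<pi>_st: "\<pi> (cls [Stable]) = t" by (simp add: t_def st_def)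
    have \<theta>_one: "\<theta> \<one>\<^bsub>K\<^esub> = \<one>\<^bsub>Q\<^esub>" by (simp add: \<theta>_def)
    have inv: "\<forall>x\<in>carrier Q. wval u x = wval v x" if "hnn_cong K A \<phi> u v" for u v
      using that
    proof (induction rule: hnn_cong.induct)
      case (append u u' v v')
      show ?case
      proof
        fix x assume x: "x \<in> carrier Q"
        have w: "u \<in> hnn_words K" "u' \<in> hnn_words K" "v \<in> hnn_words K" "v' \<in> hnn_words K"
          using cong_words append.hyps by blast+
        have "cls v = cls v'" using cls_eq_iff[OF w(3)] append.hyps(2) by blast
        moreover have "\<pi> (cls v) \<otimes>\<^bsub>Q\<^esub> x \<in> carrier Q" using cls_c[OF w(3)] x by simp
        ultimately show "wval (u @ v) x = wval (u' @ v') x"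
          using append.IH wval_append[OF w(1,3) x] wval_append[OF w(2,4) x] x by simp
      qed
    next
      case one
      have "\<theta> \<in> hom K Q" unfolding \<theta>_def using hom_compose[OF base_hom \<pi>] by (simp add: comp_def)
      from cocycles_one[OF K Q this c1] show ?case
        by (simp add: wval_simps lval_def \<pi>_nil)
    next
      case (mult g h)
      then show ?case
        using cocycles_mult[OF c1 mult(1,2)] by (auto simp: wval_simps lval_def \<pi>_nil \<pi>_elem)
    next
      case stable_right
      show ?case using tc by (simp add: wval_simps lval_def \<pi>_nil \<pi>_inv)
    next
      case stable_left
      show ?case using tc by (simp add: wval_simps lval_def \<pi>_nil \<pi>_st \<pi>.H.inv_mult_cancel)
    next
      case (conj a)
      show ?case
      proof
        fix x assume x: "x \<in> carrier Q"
        let ?y = "inv\<^bsub>Q\<^esub> t \<otimes>\<^bsub>Q\<^esub> x"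
        have y: "?y \<in> carrier Q" using x tc by simp
        have ae: "[Elem a] \<in> hnn_words K" using Ac[OF conj] by (auto simp: hnn_words_def)
        have "cls [Elem a, Stable_inv] = cls [Elem a] \<otimes>\<^bsub>\<Gamma>\<^esub> cls [Stable_inv]"
          using cls_mult[OF ae sw(2)] by simp
        then have "\<pi> (cls [Elem a, Stable_inv]) = \<theta> a \<otimes>\<^bsub>Q\<^esub> inv\<^bsub>Q\<^esub> t"
          using cls_c[OF ae] cls_c[OF sw(2)] by (simp add: \<pi>_elem \<pi>_inv)
        then have "wval [Stable, Elem a, Stable_inv] x = c (None, \<theta> a \<otimes>\<^bsub>Q\<^esub> ?y) + (c (Some a, ?y) - c (None, ?y))"
          using x tc \<theta>c[OF Ac[OF conj]] by (simp add: wval_simps lval_def \<pi>_nil \<pi>_inv \<pi>.H.m_assoc)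
        \<comment> \<open>The relation imposed on \<open>c\<close>, used at the point
          \<open>?y\<close>, so that \<open>t\<close> moves it back to \<open>x\<close>.\<close>
        also have "\<dots> = c (Some (\<phi> a), t \<otimes>\<^bsub>Q\<^esub> ?y)" using hcocyclesD(4)[OF c conj y] by (simp add: add_diff_eq)
        also have "\<dots> = wval [Elem (\<phi> a)] x"
          using x tc by (simp add: wval_simps lval_def \<pi>_nil \<pi>.H.inv_mult_cancel)
        finally show "wval [Stable, Elem a, Stable_inv] x = wval [Elem (\<phi> a)] x" .
      qed
    qed auto
    define rep where "rep X = (SOME w. w \<in> hnn_words K \<and> cls w = X)" for X
    have rep: "rep X \<in> hnn_words K \<and> cls (rep X) = X" if "X \<in> carrier \<Gamma>" for X
    proof -
      have "\<exists>w. w \<in> hnn_words K \<and> cls w = X" using that by (auto simp: carrier_\<Gamma>)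
      from someI_ex[OF this] show ?thesis by (simp add: rep_def)
    qed
    define C where "C = (\<lambda>(X, x). if X \<in> carrier \<Gamma> \<and> x \<in> carrier Q then wval (rep X) x else 0)"
    have C_cls: "C (cls w, x) = wval w x" if w: "w \<in> hnn_words K" and x: "x \<in> carrier Q" for w x
    proof -
      have "hnn_cong K A \<phi> w (rep (cls w))" using rep[OF cls_c[OF w]] cls_eq_iff[OF w] by metis
      then show ?thesis using inv x cls_c[OF w] by (simp add: C_def)
    qed
    have lF: "lval l x \<in> F" for l x
      using hcocycles_F[OF c] diff_F[OF zero_F hcocycles_F[OF c]] by (cases l) (simp_all add: lval_def)
    have wF: "wval w x \<in> F" for w x
      by (induction w arbitrary: x) (simp_all add: wval_simps zero_F add_F lF)
    have "C \<in> cocycles \<Gamma> Q \<pi>"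
    proof (rule cocyclesI)
      show "C (X, x) \<in> F" for X x by (simp add: C_def wF zero_F)
      show "C (X, x) = 0" if "X \<notin> carrier \<Gamma> \<or> x \<notin> carrier Q" for X x using that by (auto simp: C_def)
      fix X Y x assume XY: "X \<in> carrier \<Gamma>" "Y \<in> carrier \<Gamma>" and x: "x \<in> carrier Q"
      obtain u v where uv: "u \<in> hnn_words K" "v \<in> hnn_words K" "X = cls u" "Y = cls v"
        using rep[OF XY(1)] rep[OF XY(2)] by metis
      have "\<pi> (cls v) \<otimes>\<^bsub>Q\<^esub> x \<in> carrier Q" using cls_c[OF uv(2)] x by simp
      moreover have "u @ v \<in> hnn_words K" using uv by (auto simp: hnn_words_def)
      ultimately show "C (X \<otimes>\<^bsub>\<Gamma>\<^esub> Y, x) = C (X, \<pi> Y \<otimes>\<^bsub>Q\<^esub> x) + C (Y, x)"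
        unfolding uv(3,4) using uv x by (simp add: cls_mult C_cls wval_append)
    qed
    moreover have "c = R C"
    proof
      fix y :: "'a option \<times> 'q"
      obtain l x where y: "y = (l, x)" by force
      show "c y = R C y"
      proof (cases "x \<in> carrier Q")
        case x: True
        show ?thesis
        proof (cases l)
          case None
          then show ?thesis using C_cls[OF sw(1) x] x by (simp add: y R_simps st_def wval_simps lval_def \<pi>_nil)
        next
          case (Some g)
          show ?thesis
          proof (cases "g \<in> carrier K")
            case True
            then have "[Elem g] \<in> hnn_words K" by (simp add: hnn_words_def)
            from C_cls[OF this x] show ?thesis
              using x True by (simp add: y Some R_simps base_cls wval_simps lval_def \<pi>_nil)
          next
            case False
            then show ?thesis using cocycles_outside[OF c1, of g x] by (simp add: y Some R_simps)
          qed
        qed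
      next
        case False
        then have "C (X, x) = 0" for X by (simp add: C_def)
        then show ?thesis using hcocycles_outside[OF c False] by (simp add: y R_def split: option.split)
      qed
    qed
    ultimately show "\<exists>C\<in>cocycles \<Gamma> Q \<pi>. c = R C" by blast
  qed
  then show ?thesis unfolding \<theta>_def[symmetric] t_def[symmetric] by (rule bij_betw_same_card)
qed

section \<open>The gradient formula\<close>

lemma group_index_kernel_dvd:
  assumes "group G" "group Q" "\<theta> \<in> hom G Q" "finite (carrier Q)"
  shows "group_index G (kernel G Q \<theta>) dvd card (carrier Q)"
proof -
  interpret group_hom G Q \<theta> using assms by (simp add: group_hom_def group_hom_axioms_def)
  show ?thesis
    unfolding group_index_kernel using H.rcosets_card_mult[OF assms(4) img_is_subgroup] by (metis dvd_triv_right)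
qed

text \<open>Keeps all the infima below genuine. For \<open>n = 0\<close> the quotient is 0 by
  convention.\<close>

lemma gradient_quotient_ge: "-1 \<le> (real d - 1) / real n"
proof (cases "n = 0")
  case False
  then show ?thesis by (simp add: field_simps)
qed simp

section \<open>Normal subgroups of p-power index and their quotients\<close>

locale p_normal = group G for G (structure) + fixes p :: nat and H
  assumes prime: "Factorial_Ring.prime p" and H: "H \<in> p_normal_subgroups p G"
begin

sublocale normal H G
  using H by (simp add: p_normal_subgroups_def)

lemma group_Mod: "group (G Mod H)"
  by (rule factorgroup_is_group)

lemma proj_hom: "(\<lambda>g. H #> g) \<in> hom G (G Mod H)"
  by (rule r_coset_hom_Mod)

lemma card_Mod: obtains k where "card (carrier (G Mod H)) = p ^ k"
  using H by (auto simp: p_normal_subgroups_def group_index_def FactGroup_def)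

lemma finite_Mod: "finite (carrier (G Mod H))"
proof -
  obtain k where "card (carrier (G Mod H)) = p ^ k" by (rule card_Mod)
  then show ?thesis using prime by (intro card_ge_0_finite) (simp add: prime_gt_0_nat)
qed

lemma card_Mod_pos: "card (carrier (G Mod H)) > 0"
proof -
  obtain k where "card (carrier (G Mod H)) = p ^ k" by (rule card_Mod)
  then show ?thesis using prime by (simp add: prime_gt_0_nat)
qed

lemma kernel_proj: "kernel G (G Mod H) (\<lambda>g. H #> g) = H"
proof -
  have "H #> g = H \<longleftrightarrow> g \<in> H" if "g \<in> carrier G" for g
    using that coset_join1[OF _ that subgroup_axioms] coset_join2[OF that subgroup_axioms] subset by blast
  then show ?thesis using subset by (auto simp: kernel_def)
qed

end

lemma p_normal_kernel:
  assumes p: "Factorial_Ring.prime p" and "group G" "group Q" "\<theta> \<in> hom G Q" "card (carrier Q) = p ^ k"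
  shows "kernel G Q \<theta> \<in> p_normal_subgroups p G"
proof -
  interpret group_hom G Q \<theta> using assms by (simp add: group_hom_def group_hom_axioms_def)
  have "finite (carrier Q)" using assms(5) p by (intro card_ge_0_finite) (simp add: prime_gt_0_nat)
  then have "group_index G (kernel G Q \<theta>) dvd p ^ k"
    using group_index_kernel_dvd[OF assms(2-4)] assms(5) by simp
  then show ?thesis
    using normal_kernel divides_primepow_nat[OF p] by (auto simp: p_normal_subgroups_def)
qed

text \<open>The intersection is the kernel of the map into the product of the two quotients, whose
  order is again a power of p.\<close>

lemma p_normal_Int:
  assumes p: "Factorial_Ring.prime p" and G: "group G"
    and H: "H \<in> p_normal_subgroups p G" and N: "N \<in> p_normal_subgroups p G"
  shows "H \<inter> N \<in> p_normal_subgroups p G"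
proof -
  interpret H: p_normal G p H using G p H by (simp add: p_normal_def p_normal_axioms_def)
  interpret N: p_normal G p N using G p N by (simp add: p_normal_def p_normal_axioms_def)
  let ?Q = "(G Mod H) \<times>\<times> (G Mod N)" and ?h = "\<lambda>g. (H #>\<^bsub>G\<^esub> g, N #>\<^bsub>G\<^esub> g)"
  have h: "?h \<in> hom G ?Q"
    using H.proj_hom N.proj_hom by (auto simp: hom_def)
  have Q: "group ?Q" by (rule DirProd_group[OF H.group_Mod N.group_Mod])
  obtain k where k: "card (carrier (G Mod H)) = p ^ k" by (rule H.card_Mod)
  obtain l where l: "card (carrier (G Mod N)) = p ^ l" by (rule N.card_Mod)
  have "card (carrier ?Q) = p ^ (k + l)" using k l by (simp add: card_cartesian_product power_add)
  from p_normal_kernel[OF p G Q h this] have "kernel G ?Q ?h \<in> p_normal_subgroups p G" .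
  moreover have "kernel G ?Q ?h = kernel G (G Mod H) (\<lambda>g. H #>\<^bsub>G\<^esub> g) \<inter> kernel G (G Mod N) (\<lambda>g. N #>\<^bsub>G\<^esub> g)"
    by (auto simp: kernel_def)
  ultimately show ?thesis by (simp add: H.kernel_proj N.kernel_proj)
qed

text \<open>Makes the relative formula applicable to the absolute gradient of the HNN
  extension.\<close>

lemma p_normal_lattice:
  assumes p: "Factorial_Ring.prime p" and G: "group G"
  shows "subgroup_lattice G (p_normal_subgroups p G)"
proof -
  have "\<Inter>F \<in> p_normal_subgroups p G" if "finite F" "F \<noteq> {}" "F \<subseteq> p_normal_subgroups p G" for F
    using that by (induction rule: finite_ne_induct) (simp_all add: p_normal_Int[OF p G])
  then show ?thesis
    unfolding subgroup_lattice_def by (auto simp: p_normal_subgroups_def normal_imp_subgroup)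
qed

section \<open>Normalised rates along a lattice in the HNN extension, and the two
  inequalities\<close>

locale hnn_p = hnn K A B \<phi> + prime_coeff p \<iota>
  for K :: "('a, 'b) monoid_scheme" and A B \<phi> p and \<iota> :: "int \<Rightarrow> 'f::ab_group_add" +
  assumes fgK: "finitely_generated K" and fg\<Gamma>: "finitely_generated \<Gamma>"
begin

abbreviation PN where "PN \<equiv> p_normal_subgroups p \<Gamma>"

definition quo where "quo H = \<Gamma> Mod H"
definition proj where "proj H g = H #>\<^bsub>\<Gamma>\<^esub> g"
definition \<theta> where "\<theta> H x = proj H (base x)"
definition size where "size H = real (card (carrier (quo H)))"

lemma p_normal: "H \<in> PN \<Longrightarrow> p_normal \<Gamma> p H"
  using \<Gamma>.group_axioms prime by (simp add: p_normal_def p_normal_axioms_def)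

lemma quo: assumes "H \<in> PN"
  shows "group (quo H)" "finite (carrier (quo H))" "card (carrier (quo H)) > 0" "size H > 0"
    "proj H \<in> hom \<Gamma> (quo H)" "\<theta> H \<in> hom K (quo H)" "kernel \<Gamma> (quo H) (proj H) = H"
    "proj H ` carrier \<Gamma> = carrier (quo H)"
proof -
  interpret p_normal \<Gamma> p H by (rule p_normal[OF assms])
  have P: "proj H = (\<lambda>g. H #>\<^bsub>\<Gamma>\<^esub> g)" by (simp add: fun_eq_iff proj_def)
  show "group (quo H)" "finite (carrier (quo H))" "card (carrier (quo H)) > 0" "size H > 0"
    "kernel \<Gamma> (quo H) (proj H) = H"
    using group_Mod finite_Mod card_Mod_pos kernel_proj unfolding quo_def size_def P by auto
  show h: "proj H \<in> hom \<Gamma> (quo H)" unfolding P quo_def by (rule proj_hom)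
  show "\<theta> H \<in> hom K (quo H)"
    using hom_compose[OF base_hom h] by (simp add: \<theta>_def[abs_def] comp_def)
  show "proj H ` carrier \<Gamma> = carrier (quo H)" by (simp add: P quo_def carrier_FactGroup)
qed

lemma kernel_\<theta>: assumes "H \<in> PN" shows "kernel K (quo H) (\<theta> H) = hnn_base_inter K A \<phi> H"
proof -
  interpret b: group_hom K \<Gamma> base using base_hom K by (simp add: group_hom_def group_hom_axioms_def)
  have "x \<in> kernel \<Gamma> (quo H) (proj H) \<longleftrightarrow> x \<in> H" for x using quo(7)[OF assms] by simp
  then have "proj H (base x) = \<one>\<^bsub>quo H\<^esub> \<longleftrightarrow> base x \<in> H" if "x \<in> carrier K" for x
    using b.hom_closed[OF that] unfolding kernel_def by blast
  then show ?thesis by (auto simp: kernel_def hnn_base_inter_def \<theta>_def base_def)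
qed

definition cK where "cK H = card (cocycles K (quo H) (\<theta> H))"
text \<open>The set of imposed relations is a parameter because a finite set selected at one
  \<open>H\<close> is followed to smaller subgroups.\<close>

definition cS where "cS S H = card (hcocycles K S \<phi> (quo H) (\<theta> H) (proj H st))"

lemma cK_pos: assumes "H \<in> PN" shows "cK H > 0"
proof -
  have "cocycles K (quo H) (\<theta> H) \<noteq> {}" using add_subgroup_zero[OF cocycles_subgroup] by blast
  then show ?thesis
    unfolding cK_def using finite_cocycles[OF K quo(1)[OF assms] quo(6)[OF assms] fgK quo(2)[OF assms]]
    by (simp add: card_gt_0_iff)
qed

lemma cS_pos: assumes "H \<in> PN" shows "cS S H > 0"
proof -
  have "hcocycles K S \<phi> (quo H) (\<theta> H) (proj H st) \<noteq> {}"
    using add_subgroup_zero[OF hcocycles_subgroup[of K S \<phi> "quo H" "\<theta> H" "proj H st"]] by blast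
  then show ?thesis
    unfolding cS_def using finite_hcocycles[OF K quo(1)[OF assms] quo(6)[OF assms] fgK quo(2)[OF assms]]
    by (simp add: card_gt_0_iff)
qed

definition f where "f H = (real (d_p p (\<Gamma>\<lparr>carrier := H\<rparr>)) - 1) / real (group_index \<Gamma> H)"
definition g where "g H = (real (d_p p (K\<lparr>carrier := hnn_base_inter K A \<phi> H\<rparr>)) - 1) /
  real (group_index K (hnn_base_inter K A \<phi> H))"

lemma f_eq: assumes "H \<in> PN" shows "f H = log p (cS A H) / size H - 1"
proof -
  note q = quo[OF assms]
  have "f H = log p (card (cocycles \<Gamma> (quo H) (proj H))) / size H - 1"
    using log_card_cocycles[OF \<Gamma>.group_axioms q(1,2,5) fg\<Gamma>] q(7) by (simp add: f_def size_def)
  also have "card (cocycles \<Gamma> (quo H) (proj H)) = cS A H"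
    using card_cocycles_hnn[OF hnn_axioms q(1,5)] by (simp add: cS_def \<theta>_def[abs_def])
  finally show ?thesis .
qed

lemma g_eq: assumes "H \<in> PN" shows "g H = log p (cK H) / size H - 1"
  using log_card_cocycles[OF K quo(1,2,6)[OF assms] fgK] kernel_\<theta>[OF assms]
  by (simp add: g_def size_def cK_def)

text \<open>The fibre bound adds the number of cosets of \<theta>(A) in Q to the dimension for K;
  divided by |Q| this is the reciprocal of the order of \<theta>(A).\<close>

lemma f_le:
  assumes "H \<in> PN" shows "f H \<le> g H + 1 / card (\<theta> H ` A)"
proof -
  note q = quo[OF assms]
  interpret h: group_hom K "quo H" "\<theta> H" using q K by (simp add: group_hom_def group_hom_axioms_def)
  define r where "r = card (rcosets\<^bsub>quo H\<^esub> (\<theta> H ` A))"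
  have r: "r * card (\<theta> H ` A) = card (carrier (quo H))"
    unfolding r_def by (rule h.H.rcosets_card_mult[OF q(2) h.subgroup_img_is_subgroup[OF A]])
  then have pos: "r > 0" "card (\<theta> H ` A) > 0" using q(3) by (metis mult_0 not_gr_zero, metis mult_0_right not_gr_zero)
  have "cS A H \<le> cK H * p ^ r"
    unfolding cS_def cK_def r_def by (rule card_hcocycles_le[OF K fgK q(1,2,6) A])
  then have "log p (cS A H) \<le> log p (real (cK H * p ^ r))"
    using p_gt_1 cS_pos[OF assms, of A] by (subst log_le_cancel_iff) (auto intro: order_less_le_trans simp only: of_nat_le_iff of_nat_0_less_iff)
  also have "\<dots> = log p (cK H) + r"
    using p_gt_1 cK_pos[OF assms] by (simp add: log_mult log_nat_power)
  finally have "log p (cS A H) / size H \<le> log p (cK H) / size H + r / size H"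
    using q(4) by (simp add: field_simps)
  also have "r / size H = 1 / card (\<theta> H ` A)"
    using pos by (simp add: size_def r[symmetric])
  finally show ?thesis using f_eq[OF assms] g_eq[OF assms] by simp
qed

lemma quotient_map:
  assumes "H' \<in> PN" "H \<in> PN" "H' \<subseteq> H"
  obtains r k where "r \<in> hom (quo H') (quo H)" "r ` carrier (quo H') = carrier (quo H)"
    "\<And>x. x \<in> carrier \<Gamma> \<Longrightarrow> r (proj H' x) = proj H x" "card (kernel (quo H') (quo H) r) = p ^ k"
    "size H' = size H * card (kernel (quo H') (quo H) r)"
proof -
  note q = quo[OF assms(2)] and q' = quo[OF assms(1)]
  interpret P: p_normal \<Gamma> p H' by (rule p_normal[OF assms(1)])
  interpret h: group_hom \<Gamma> "quo H" "proj H" using q \<Gamma>.group_axioms by (simp add: group_hom_def group_hom_axioms_def)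
  obtain r where r: "r \<in> hom (\<Gamma> Mod H') (quo H)" "\<And>x. x \<in> carrier \<Gamma> \<Longrightarrow> r (H' #>\<^bsub>\<Gamma>\<^esub> x) = proj H x"
    using h.FactGroup_universal_kernel[OF P.normal_axioms] assms(3) q(7) by metis
  have r1: "r \<in> hom (quo H') (quo H)" using r(1) by (simp add: quo_def)
  have r2: "r (proj H' x) = proj H x" if "x \<in> carrier \<Gamma>" for x using r(2)[OF that] by (simp add: proj_def)
  have r3: "r ` carrier (quo H') = carrier (quo H)"
    unfolding q(8)[symmetric] q'(8)[symmetric] image_image using r2 by (intro image_cong HOL.refl) auto
  interpret r: group_hom "quo H'" "quo H" r using q q' r1 by (simp add: group_hom_def group_hom_axioms_def)
  let ?N = "kernel (quo H') (quo H) r"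
  have "card (rcosets\<^bsub>quo H'\<^esub> ?N) * card ?N = card (carrier (quo H'))"
    by (rule r.G.rcosets_card_mult[OF q'(2) r.subgroup_kernel])
  moreover have "card (rcosets\<^bsub>quo H'\<^esub> ?N) = card (carrier (quo H))"
    using r.group_index_kernel r3 by (simp add: group_index_def)
  ultimately have c: "card (carrier (quo H)) * card ?N = card (carrier (quo H'))" by simp
  obtain l where "card (carrier (quo H')) = p ^ l" unfolding quo_def by (rule P.card_Mod)
  then have "card ?N dvd p ^ l" using c by (metis dvd_triv_right)
  then obtain k where k: "card ?N = p ^ k" using divides_primepow_nat[OF prime] by blast
  have "size H' = size H * card ?N" unfolding size_def c[symmetric] by simp
  with r1 r3 r2 k show ?thesis by (rule that)
qed

lemma log_mono_quotient:
  assumes "0 < u'" "0 < u" "u' \<le> u ^ n" "s' = s * real n" "0 < s'"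
  shows "log p (real u') / s' \<le> log p (real u) / s"
proof -
  have "n > 0" using assms(4,5) by (cases n) auto
  have "log p (real u') \<le> log p (real (u ^ n))"
    using assms p_gt_1 by (subst log_le_cancel_iff) (auto simp del: of_nat_power)
  also have "\<dots> = n * log p (real u)" using assms(2) by (simp add: log_nat_power)
  finally have "log p (real u') / s' \<le> n * log p (real u) / s'" using assms(5) by (simp add: divide_right_mono)
  also have "\<dots> = log p (real u) / s" using assms(4,5) \<open>n > 0\<close> by simp
  finally show ?thesis .
qed

lemma mono:
  assumes H': "H' \<in> PN" and H: "H \<in> PN" and sub: "H' \<subseteq> H"
  shows "g H' \<le> g H" and "S \<subseteq> carrier K \<Longrightarrow> log p (cS S H') / size H' \<le> log p (cS S H) / size H"
proof -
  interpret b: group_hom K \<Gamma> base using base_hom K by (simp add: group_hom_def group_hom_axioms_def)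
  note q = quo[OF H] and q' = quo[OF H']
  obtain r k where r: "r \<in> hom (quo H') (quo H)" "r ` carrier (quo H') = carrier (quo H)"
    "\<And>x. x \<in> carrier \<Gamma> \<Longrightarrow> r (proj H' x) = proj H x" "card (kernel (quo H') (quo H) r) = p ^ k"
    "size H' = size H * card (kernel (quo H') (quo H) r)"
    by (rule quotient_map[OF assms]) blast
  have r\<theta>: "r (\<theta> H' x) = \<theta> H x" if "x \<in> carrier K" for x using that by (simp add: \<theta>_def r(3))
  have "cK H' \<le> cK H ^ card (kernel (quo H') (quo H) r)"
    unfolding cK_def by (rule card_cocycles_quotient[OF K fgK q'(1) q(1) q'(2) r(1,2,4) q'(6) q(6) r\<theta>])
  from log_mono_quotient[OF cK_pos[OF H'] cK_pos[OF H] this r(5) q'(4)]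
  show "g H' \<le> g H" using g_eq[OF H] g_eq[OF H'] by simp
  assume S: "S \<subseteq> carrier K"
  have "proj H' st \<in> carrier (quo H')" using q'(8) st_carrier by blast
  from card_hcocycles_quotient[OF K fgK q'(1) q(1) q'(2) r(1,2,4) q'(6) q(6) r\<theta> this r(3)[OF st_carrier] S]
  have "cS S H' \<le> cS S H ^ card (kernel (quo H') (quo H) r)" by (simp add: cS_def)
  from log_mono_quotient[OF cS_pos[OF H'] cS_pos[OF H] this r(5) q'(4)]
  show "log p (cS S H') / size H' \<le> log p (cS S H) / size H" .
qed

text \<open>Without relations the normalised dimension is that of K plus 1, and imposing those in
  \<open>S\<close> costs at most |\<Theta>|. The right-hand side is the rate for the relations in
  \<open>S\<close> alone; it becomes \<open>f\<close> only where \<open>S\<close> implies all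
  relations.\<close>

lemma lower:
  assumes H: "H \<in> PN" and S: "finite S" "S \<subseteq> A"
  obtains \<Theta> where "forest_coordinates (K\<lparr>carrier := A\<rparr>) (quo H) (\<theta> H) S \<Theta>"
    "g H + 1 - card \<Theta> / size H \<le> log p (cS S H) / size H - 1"
proof -
  note q = quo[OF H]
  interpret h: group_hom \<Gamma> "quo H" "proj H" using q \<Gamma>.group_axioms by (simp add: group_hom_def group_hom_axioms_def)
  interpret b: group_hom K \<Gamma> base using base_hom K by (simp add: group_hom_def group_hom_axioms_def)
  let ?A = "K\<lparr>carrier := A\<rparr>"
  have gA: "group ?A" by (rule K.subgroup_imp_group[OF A])
  have \<theta>A: "\<theta> H \<in> hom ?A (quo H)" using q(6) Ac by (auto simp: hom_def)
  have tc: "proj H st \<in> carrier (quo H)" using st_carrier by simp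
  have t: "proj H st \<otimes>\<^bsub>quo H\<^esub> \<theta> H a = \<theta> H (\<phi> a) \<otimes>\<^bsub>quo H\<^esub> proj H st" if a: "a \<in> A" for a
    using st_base[OF a] st_carrier Ac[OF a] \<phi>_carrier[OF a] by (simp add: \<theta>_def flip: h.hom_mult)
  obtain \<Theta> where \<Theta>: "finite \<Theta>" "\<Theta> \<subseteq> S \<times> carrier (quo H)"
    "card (cocycles K (quo H) (\<theta> H)) * p ^ card (carrier (quo H)) \<le>
      p ^ card \<Theta> * card (hcocycles K S \<phi> (quo H) (\<theta> H) (proj H st))"
    "\<forall>f. (\<forall>e\<in>\<Theta>. f e \<in> F) \<longrightarrow> (\<exists>w\<in>cocycles ?A (quo H) (\<theta> H). \<forall>e\<in>\<Theta>. w e = f e)"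
    by (rule hcocycles_lower_bound[OF K fgK q(1,2,6) A \<phi>_carrier \<phi>_mult tc t S(2)])
  have "forest_coordinates ?A (quo H) (\<theta> H) S \<Theta>"
    unfolding forest_coordinates_def
  proof (intro conjI allI ballI impI \<Theta>(1,2))
    fix X y assume y: "y \<in> carrier (quo H)" and X: "finite X \<and> X \<noteq> {} \<and> X \<subseteq> carrier ?A \<and> inj_on (\<theta> H) X"
    show "card {(s, x). s \<in> S \<and> x \<in> X \<and> s \<otimes>\<^bsub>?A\<^esub> x \<in> X \<and> (s, \<theta> H x \<otimes>\<^bsub>quo H\<^esub> y) \<in> \<Theta>} < card X"
      by (rule independent_coordinates_forest[OF gA q(1) \<theta>A \<Theta>(1,4) _ _ _ _ _ y]) (use X S in auto)
  qed
  moreover have "g H + 1 - card \<Theta> / size H \<le> log p (cS S H) / size H - 1"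
  proof -
    have "cK H * p ^ card (carrier (quo H)) \<le> p ^ card \<Theta> * cS S H" using \<Theta>(3) by (simp add: cK_def cS_def)
    then have "real (cK H * p ^ card (carrier (quo H))) \<le> real (p ^ card \<Theta> * cS S H)" by (simp only: of_nat_le_iff)
    then have "log p (real (cK H * p ^ card (carrier (quo H)))) \<le> log p (real (p ^ card \<Theta> * cS S H))"
      using p_gt_1 cK_pos[OF H] cS_pos[OF H, of S] by (subst log_le_cancel_iff) (simp_all del: of_nat_mult of_nat_power)
    then have "log p (cK H) + size H \<le> card \<Theta> + log p (cS S H)"
      using p_gt_1 cK_pos[OF H] cS_pos[OF H, of S] by (simp add: log_mult log_nat_power size_def)
    then have "(log p (cK H) + size H - card \<Theta>) / size H \<le> log p (cS S H) / size H"
      using q(4) by (intro divide_right_mono) auto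
    then show ?thesis unfolding g_eq[OF H] using q(4) by (simp add: add_divide_distrib diff_divide_distrib)
  qed
  ultimately show ?thesis by (rule that)
qed

text \<open>The finitely many elements x y^-1 with x and y distinct in \<open>X\<close> stay
  nontrivial in the HNN extension because K embeds. Each is missed by a member of \<open>L\<close>,
  and closure under intersections combines these members with \<open>H\<close>.\<close>

lemma separate:
  assumes L: "subgroup_lattice \<Gamma> L" "L \<subseteq> PN" "\<Inter>L = {\<one>\<^bsub>\<Gamma>\<^esub>}" and H: "H \<in> L"
    and X: "finite X" "X \<subseteq> A"
  obtains H' where "H' \<in> L" "H' \<subseteq> H" "inj_on (\<theta> H') X"
proof -
  interpret b: group_hom K \<Gamma> base using base_hom K by (simp add: group_hom_def group_hom_axioms_def)
  define D where "D = {base (x \<otimes>\<^bsub>K\<^esub> inv\<^bsub>K\<^esub> y) |x y. x \<in> X \<and> y \<in> X \<and> x \<noteq> y}"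
  have "D \<subseteq> (\<lambda>(x, y). base (x \<otimes>\<^bsub>K\<^esub> inv\<^bsub>K\<^esub> y)) ` (X \<times> X)" by (auto simp: D_def)
  then have finD: "finite D" using X(1) by (meson finite_SigmaI finite_imageI finite_subset)
  have "\<exists>N\<in>L. d \<notin> N" if "d \<in> D" for d
  proof -
    from that obtain x y where xy: "x \<in> X" "y \<in> X" "x \<noteq> y" "d = base (x \<otimes>\<^bsub>K\<^esub> inv\<^bsub>K\<^esub> y)" by (auto simp: D_def)
    have c: "x \<in> carrier K" "y \<in> carrier K" using xy X(2) Ac by auto
    have "d \<noteq> \<one>\<^bsub>\<Gamma>\<^esub>"
    proof
      assume "d = \<one>\<^bsub>\<Gamma>\<^esub>"
      then have "x \<otimes>\<^bsub>K\<^esub> inv\<^bsub>K\<^esub> y = \<one>\<^bsub>K\<^esub>" using base_eq_one[of "x \<otimes>\<^bsub>K\<^esub> inv\<^bsub>K\<^esub> y"] xy(4) c by simp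
      then show False using K.inv_equality[of x "inv\<^bsub>K\<^esub> y"] c xy(3) by simp
    qed
    then show ?thesis using L(3) by blast
  qed
  then obtain N where N: "\<And>d. d \<in> D \<Longrightarrow> N d \<in> L \<and> d \<notin> N d" by metis
  \<comment> \<open>Including \<open>H\<close> keeps the finite family nonempty and puts
    \<open>H'\<close> below \<open>H\<close>.\<close>
  define H' where "H' = \<Inter> (insert H (N ` D))"
  have H'L: "H' \<in> L"
  proof -
    have "finite (insert H (N ` D))" "insert H (N ` D) \<noteq> {}" "insert H (N ` D) \<subseteq> L" using finD N H by auto
    then show ?thesis using L(1) unfolding subgroup_lattice_def H'_def by blast
  qed
  have "inj_on (\<theta> H') X"
  proof (rule inj_onI, rule ccontr)
    fix x y assume xy: "x \<in> X" "y \<in> X" "\<theta> H' x = \<theta> H' y" "x \<noteq> y"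
    have c: "x \<in> carrier K" "y \<in> carrier K" using xy X(2) Ac by auto
    have PN: "H' \<in> PN" using H'L L(2) by blast
    interpret h: group_hom K "quo H'" "\<theta> H'" using quo[OF PN] K by (simp add: group_hom_def group_hom_axioms_def)
    have "x \<otimes>\<^bsub>K\<^esub> inv\<^bsub>K\<^esub> y \<in> kernel K (quo H') (\<theta> H')" using c xy(3) by (simp add: kernel_def)
    then have "base (x \<otimes>\<^bsub>K\<^esub> inv\<^bsub>K\<^esub> y) \<in> H'" by (simp add: kernel_\<theta>[OF PN] hnn_base_inter_def base_def)
    moreover have "base (x \<otimes>\<^bsub>K\<^esub> inv\<^bsub>K\<^esub> y) \<in> D" using xy by (auto simp: D_def)
    ultimately show False using N unfolding H'_def by blast
  qed
  then show ?thesis using that[OF H'L] by (auto simp: H'_def)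
qed

lemma g_bdd: "bdd_below (g ` L)"
  unfolding g_def by (rule bdd_belowI2[OF gradient_quotient_ge])

lemma f_bdd: "bdd_below (f ` L)"
  unfolding f_def by (rule bdd_belowI2[OF gradient_quotient_ge])

text \<open>Starting from an \<open>H\<close> that nearly attains the infimum of \<open>g\<close>,
  pass to a smaller member where the image of A is large. There \<open>f_le\<close> has nearly the
  right error term, and monotonicity keeps \<open>g\<close> near its infimum.\<close>

lemma gradient_upper:
  assumes L: "subgroup_lattice \<Gamma> L" "L \<subseteq> PN" "\<Inter>L = {\<one>\<^bsub>\<Gamma>\<^esub>}" "L \<noteq> {}"
  shows "(INF H\<in>L. f H) \<le> (INF H\<in>L. g H) + 1 / card A"
proof (rule field_le_epsilon)
  fix \<epsilon> :: real assume \<epsilon>: "\<epsilon> > 0"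
  have "(INF H\<in>L. g H) < (INF H\<in>L. g H) + \<epsilon> / 2" using \<epsilon> by simp
  then obtain H where H: "H \<in> L" "g H < (INF H\<in>L. g H) + \<epsilon> / 2"
    using cINF_less_iff[OF L(4) g_bdd] by blast
  \<comment> \<open>For finite A take all of A. For infinite A the term \<open>1 / card A\<close> is
    0, since \<open>card\<close> and division by 0 both give 0, and any \<open>X\<close> with at
    least 2/\<epsilon> elements will do.\<close>
  obtain X where X: "finite X" "X \<subseteq> A" "X \<noteq> {}" "1 / card X \<le> 1 / card A + \<epsilon> / 2"
  proof (cases "finite A")
    case True
    then show ?thesis using that[of A] subgroup.one_closed[OF A] \<epsilon> by auto
  next
    case False
    define n where "n = Suc (nat \<lceil>2 / \<epsilon>\<rceil>)"
    obtain X where X: "finite X" "card X = n" "X \<subseteq> A" using infinite_arbitrarily_large[OF False] by metis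
    have "2 / \<epsilon> \<le> real n" unfolding n_def by linarith
    moreover have "real n > 0" by (simp add: n_def)
    ultimately have "1 / real n \<le> \<epsilon> / 2" using \<epsilon> by (simp add: field_simps)
    moreover have "X \<noteq> {}" using X(2) by (auto simp: n_def)
    ultimately show ?thesis using that[of X] X False by simp
  qed
  obtain H' where H': "H' \<in> L" "H' \<subseteq> H" "inj_on (\<theta> H') X" by (rule separate[OF L(1-3) H(1) X(1,2)])
  have PN: "H \<in> PN" "H' \<in> PN" using H(1) H'(1) L(2) by auto
  have "finite (\<theta> H' ` A)"
  proof -
    interpret h: group_hom K "quo H'" "\<theta> H'" using quo[OF PN(2)] K by (simp add: group_hom_def group_hom_axioms_def)
    have "\<theta> H' ` A \<subseteq> carrier (quo H')" using Ac by auto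
    then show ?thesis using quo(2)[OF PN(2)] by (rule finite_subset)
  qed
  then have "card X \<le> card (\<theta> H' ` A)"
    using card_image[OF H'(3)] card_mono[of "\<theta> H' ` A" "\<theta> H' ` X"] X(2) by auto
  moreover have "card X > 0" using X by (simp add: card_gt_0_iff)
  ultimately have "1 / card (\<theta> H' ` A) \<le> 1 / card X" by (intro divide_left_mono) auto
  moreover have "(INF H\<in>L. f H) \<le> f H'" by (rule cINF_lower[OF f_bdd H'(1)])
  moreover have "f H' \<le> g H' + 1 / card (\<theta> H' ` A)" by (rule f_le[OF PN(2)])
  moreover have "g H' \<le> g H" by (rule mono(1)[OF PN(2,1) H'(2)])
  ultimately show "(INF H\<in>L. f H) \<le> (INF H\<in>L. g H) + 1 / card A + \<epsilon>" using H(2) X(4) by linarith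
qed

text \<open>Each \<open>f H\<close> is bounded separately. \<open>S\<close> is chosen for this
  \<open>H\<close>, the member \<open>H'\<close> below it is chosen for \<open>S\<close>, and the
  rate with relations \<open>S\<close> does not increase from \<open>H\<close> to
  \<open>H'\<close>.\<close>

lemma gradient_lower:
  assumes L: "subgroup_lattice \<Gamma> L" "L \<subseteq> PN" "\<Inter>L = {\<one>\<^bsub>\<Gamma>\<^esub>}" "L \<noteq> {}"
    and am: "amenable (K\<lparr>carrier := A\<rparr>)"
  shows "(INF H\<in>L. g H) + 1 / card A \<le> (INF H\<in>L. f H)"
proof (rule cINF_greatest[OF L(4)], rule field_le_epsilon)
  fix H and \<epsilon> :: real assume H: "H \<in> L" and \<epsilon>: "\<epsilon> > 0"
  let ?A = "K\<lparr>carrier := A\<rparr>"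
  have gA: "group ?A" by (rule K.subgroup_imp_group[OF A])
  have PNH: "H \<in> PN" using H L(2) by auto
  note q = quo[OF PNH]
  obtain S where S: "finite S" "S \<subseteq> A"
    "hcocycles K S \<phi> (quo H) (\<theta> H) (proj H st) = hcocycles K A \<phi> (quo H) (\<theta> H) (proj H st)"
    by (rule hcocycles_finite_relations[OF K q(1,6) fgK q(2)])
  have hom: "\<theta> N \<in> hom ?A (quo N)" if "N \<in> PN" for N using quo(6)[OF that] Ac by (auto simp: hom_def)
  \<comment> \<open>One bound for both cases: for finite A it comes from counting edges of a forest
    on all of A, for infinite A from amenability, where \<open>1 / card A\<close> is 0.\<close>
  obtain H' and \<Theta> :: "('a \<times> 'a hnn_letter list set set) set" where H': "H' \<in> L" "H' \<subseteq> H"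
    and \<Theta>: "g H' + 1 - card \<Theta> / size H' \<le> log p (cS S H') / size H' - 1" "card \<Theta> \<le> (1 - 1 / card A + \<epsilon>) * size H'"
  proof (cases "finite A")
    case True
    obtain H' where H': "H' \<in> L" "H' \<subseteq> H" "inj_on (\<theta> H') A" by (rule separate[OF L(1-3) H True order_refl])
    then have PN: "H' \<in> PN" using L(2) by auto
    obtain \<Theta> where \<Theta>: "forest_coordinates ?A (quo H') (\<theta> H') S \<Theta>"
      "g H' + 1 - card \<Theta> / size H' \<le> log p (cS S H') / size H' - 1" by (rule lower[OF PN S(1,2)])
    have "card \<Theta> \<le> (1 - 1 / card A) * size H'"
      using forest_coordinates_finite[OF gA quo(1)[OF PN] hom[OF PN] quo(2)[OF PN] S(1) _ \<Theta>(1)] S(2) True H'(3)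
      by (simp add: size_def)
    also have "\<dots> \<le> (1 - 1 / card A + \<epsilon>) * size H'"
      using quo(4)[OF PN] \<epsilon> by (intro mult_right_mono) auto
    finally show ?thesis by (rule that[OF H'(1,2) \<Theta>(2)])
  next
    case False
    have SA: "S \<subseteq> carrier ?A" using S(2) by simp
    obtain B where B: "finite B" "B \<subseteq> carrier ?A"
      "\<forall>(Q :: 'a hnn_letter list set set monoid) \<theta> \<Theta>. group Q \<longrightarrow> finite (carrier Q) \<longrightarrow> \<theta> \<in> hom ?A Q \<longrightarrow> inj_on \<theta> B \<longrightarrow>
       forest_coordinates ?A Q \<theta> S \<Theta> \<longrightarrow> real (card \<Theta>) \<le> (1 + \<epsilon>) * card (carrier Q)"
      by (rule forest_coordinates_amenable[OF gA am S(1) SA \<epsilon>])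
    have "B \<subseteq> A" using B(2) by simp
    then obtain H' where H': "H' \<in> L" "H' \<subseteq> H" "inj_on (\<theta> H') B" by (rule separate[OF L(1-3) H B(1)])
    then have PN: "H' \<in> PN" using L(2) by auto
    obtain \<Theta> where \<Theta>: "forest_coordinates ?A (quo H') (\<theta> H') S \<Theta>"
      "g H' + 1 - card \<Theta> / size H' \<le> log p (cS S H') / size H' - 1" by (rule lower[OF PN S(1,2)])
    have "card \<Theta> \<le> (1 + \<epsilon>) * size H'"
      using B(3)[rule_format, OF quo(1)[OF PN] quo(2)[OF PN] hom[OF PN] H'(3) \<Theta>(1)] by (simp add: size_def)
    then show ?thesis using False by (intro that[OF H'(1,2) \<Theta>(2)]) simp
  qed
  have PN: "H' \<in> PN" using H'(1) L(2) by auto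
  have "card \<Theta> / size H' \<le> 1 - 1 / card A + \<epsilon>" using \<Theta>(2) quo(4)[OF PN] by (simp add: pos_divide_le_eq)
  then have "g H' + 1 / card A \<le> log p (cS S H') / size H' - 1 + \<epsilon>" using \<Theta>(1) by linarith
  \<comment> \<open>Here \<open>S\<close> is fixed while the quotient shrinks; at \<open>H\<close>
    the relations in \<open>S\<close> imply all others, so the last count is the one for A.\<close>
  also have "log p (cS S H') / size H' \<le> log p (cS S H) / size H"
    by (rule mono(2)[OF PN PNH H'(2)]) (use S(2) Ac in auto)
  also have "cS S H = cS A H" using S(3) by (simp add: cS_def)
  finally have "g H' + 1 / card A \<le> f H + \<epsilon>" using f_eq[OF PNH] by simp
  moreover have "(INF H\<in>L. g H) \<le> g H'" by (rule cINF_lower[OF g_bdd H'(1)])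
  ultimately show "(INF H\<in>L. g H) + 1 / card A \<le> f H + \<epsilon>" by linarith
qed

end

\<comment> \<open>A coefficient group for every prime: the circle group of reals modulo
  integers\<close>
quotient_type circle = real / "\<lambda>x y. x - y \<in> \<int>"
proof (rule equivpI)
  show "reflp (\<lambda>x y :: real. x - y \<in> \<int>)" by (simp add: reflp_def)
  show "symp (\<lambda>x y :: real. x - y \<in> \<int>)" by (auto simp: symp_def intro: Ints_minus) (metis Ints_minus minus_diff_eq)
  show "transp (\<lambda>x y :: real. x - y \<in> \<int>)"
    by (rule transpI) (metis Ints_add diff_add_cancel add_diff_eq)
qed

instantiation circle :: ab_group_add
begin

lift_definition zero_circle :: circle is 0 .

lift_definition plus_circle :: "circle \<Rightarrow> circle \<Rightarrow> circle" is "(+)"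
  by (metis Ints_add add_diff_add)

lift_definition uminus_circle :: "circle \<Rightarrow> circle" is uminus
  by (metis Ints_minus minus_diff_minus)

lift_definition minus_circle :: "circle \<Rightarrow> circle \<Rightarrow> circle" is "(-)"
  by (metis Ints_diff diff_diff_eq2 diff_diff_eq add_diff_eq diff_add_eq)

instance
  by standard (transfer, simp add: algebra_simps)+

end

lift_definition circle_of :: "real \<Rightarrow> circle" is "\<lambda>x. x" .

text \<open>The multiples of 1/p form the p-torsion of the circle, so a single type provides the
  coefficients for all primes at once.\<close>

lemma prime_coeff_circle:
  assumes "Factorial_Ring.prime p"
  shows "prime_coeff p (\<lambda>i. circle_of (of_int i / of_nat p))"
proof
  have p: "p > 0" using assms prime_gt_0_nat by blast
  show "circle_of (of_int (i + j) / of_nat p) = circle_of (of_int i / of_nat p) + circle_of (of_int j / of_nat p)" for i j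
    by transfer (simp add: add_divide_distrib)
  show "circle_of (of_int i / of_nat p) = 0 \<longleftrightarrow> int p dvd i" for i
  proof -
    have "circle_of (of_int i / of_nat p) = 0 \<longleftrightarrow> of_int i / real p \<in> \<int>" by transfer simp
    also have "\<dots> \<longleftrightarrow> int p dvd i"
    proof
      assume "of_int i / real p \<in> \<int>"
      then obtain k where "of_int i / real p = of_int k" by (auto elim: Ints_cases)
      then have "real_of_int i = real_of_int (int p * k)" using p by (simp add: field_simps)
      then have "i = int p * k" by (simp only: of_int_eq_iff)
      then show "int p dvd i" by simp
    qed (use p in auto)
    finally show ?thesis .
  qed
qed (fact assms)

theorem theorem5p3:
  fixes p :: nat
    and K :: "('a, 'b) monoid_scheme"
    and A B :: "'a set"
    and \<phi> :: "'a \<Rightarrow> 'a"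
  defines "\<Gamma> \<equiv> hnn_extension K A \<phi>"
  assumes "Factorial_Ring.prime p"
    and "group K" and "finitely_generated K"
    and "subgroup A K" and "subgroup B K"
    and "\<phi> \<in> iso (K\<lparr>carrier := A\<rparr>) (K\<lparr>carrier := B\<rparr>)"
    and "finitely_generated \<Gamma>" and "residually_p p \<Gamma>"
    and "amenable (K\<lparr>carrier := A\<rparr>)"
  shows "(\<forall>L. subgroup_lattice \<Gamma> L \<and> L \<subseteq> p_normal_subgroups p \<Gamma> \<and> \<Inter> L = {\<one>\<^bsub>\<Gamma>\<^esub>} \<longrightarrow>
            p_gradient_rel p \<Gamma> L =
              p_gradient_rel p K (hnn_base_inter K A \<phi> ` L) + 1 / real (card A))
         \<and> p_gradient p \<Gamma> \<ge> p_gradient p K + 1 / real (card A)"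
proof -
  have hnn: "hnn K A B \<phi>" using assms by (simp add: hnn_def)
  interpret hnn_p K A B \<phi> p "\<lambda>i. circle_of (of_int i / of_nat p)"
    rewrites "hnn.\<Gamma> K A \<phi> = \<Gamma>"
  proof -
    show \<Gamma>: "hnn.\<Gamma> K A \<phi> = \<Gamma>" unfolding \<Gamma>_def using hnn.\<Gamma>_def[OF hnn] by simp
    show "hnn_p K A B \<phi> p (\<lambda>i. circle_of (of_int i / of_nat p))"
      using hnn prime_coeff_circle assms \<Gamma> by (simp add: hnn_p_def hnn_p_axioms_def)
  qed
  \<comment> \<open>An empty family would have the whole type as its intersection, which contains
    more than one set of words.\<close>
  have ne: "L \<noteq> {}" if "\<Inter>L = {\<one>\<^bsub>\<Gamma>\<^esub>}" for L :: "'a hnn_letter list set set set"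
  proof
    assume "L = {}"
    then have "UNIV = {\<one>\<^bsub>\<Gamma>\<^esub>}" using that by simp
    then have "({} :: 'a hnn_letter list set) = UNIV" by (metis UNIV_I singletonD)
    then show False by simp
  qed
  have rel: "p_gradient_rel p \<Gamma> L = p_gradient_rel p K (hnn_base_inter K A \<phi> ` L) + 1 / real (card A)"
    if L: "subgroup_lattice \<Gamma> L" "L \<subseteq> p_normal_subgroups p \<Gamma>" "\<Inter> L = {\<one>\<^bsub>\<Gamma>\<^esub>}" for L
  proof -
    have ne: "L \<noteq> {}" using ne L(3) by blast
    have "(INF H\<in>L. f H) = (INF H\<in>L. g H) + 1 / card A"
      using gradient_upper[OF L ne] gradient_lower[OF L ne assms(10)] by (rule antisym)
    then show ?thesis
      unfolding p_gradient_rel_def image_image f_def[abs_def] g_def[abs_def] by simp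
  qed
  \<comment> \<open>Residual p-ness says exactly that the family of all normal subgroups of p-power
    index meets the intersection condition of the relative formula.\<close>
  have triv: "\<Inter> (p_normal_subgroups p \<Gamma>) = {\<one>\<^bsub>\<Gamma>\<^esub>}" using assms(9) by (simp add: residually_p_def)
  then have eq: "p_gradient p \<Gamma> =
      p_gradient_rel p K (hnn_base_inter K A \<phi> ` p_normal_subgroups p \<Gamma>) + 1 / real (card A)"
    using rel[OF p_normal_lattice[OF prime \<Gamma>.group_axioms] order_refl] by (simp add: p_gradient_def)
  \<comment> \<open>The traces on K of these subgroups are among the normal subgroups of p-power
    index in K, and an infimum over a larger family is no larger.\<close>
  have "p_gradient p K \<le> p_gradient_rel p K (hnn_base_inter K A \<phi> ` p_normal_subgroups p \<Gamma>)"
    unfolding p_gradient_def p_gradient_rel_def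
  proof (rule cINF_superset_mono)
    show "hnn_base_inter K A \<phi> ` p_normal_subgroups p \<Gamma> \<noteq> {}" using ne[OF triv] by simp
    show "hnn_base_inter K A \<phi> ` p_normal_subgroups p \<Gamma> \<subseteq> p_normal_subgroups p K"
    proof (rule image_subsetI)
      fix H assume H: "H \<in> p_normal_subgroups p \<Gamma>"
      interpret H: p_normal \<Gamma> p H by (rule p_normal[OF H])
      obtain k where "card (carrier (quo H)) = p ^ k" unfolding quo_def by (rule H.card_Mod)
      from p_normal_kernel[OF prime K quo(1,6)[OF H] this]
      show "hnn_base_inter K A \<phi> H \<in> p_normal_subgroups p K" by (simp add: kernel_\<theta>[OF H])
    qed
    show "bdd_below ((\<lambda>H. (real (d_p p (K\<lparr>carrier := H\<rparr>)) - 1) / real (group_index K H)) ` p_normal_subgroups p K)"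
      by (rule bdd_belowI2[OF gradient_quotient_ge])
  qed simp
  then show ?thesis using rel eq by simp
qed

end
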